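(* Let $p$ be a prime and write $G(n,m,r)=\langle a,b \mid a^{p^{n}}=1,\ b^{p^{m}}=1,\ [a,b]=a^{p^{r}}\rangle$, where $n-r\le m$ and $2\le r\le n-1$, and $A(\bar n)=C_{p^{\bar n}}\times C_{p^{\bar n}}$. Consider the powerfully nilpotent $p$-groups of rank $2$ as vertices of the ancestry tree. The only such groups that have grandparents are the groups $A(\bar n)$ with $\bar n\ge 2$ and the groups $G(\bar n,\bar n,r)$ with $\bar n\ge 3$ and $2\le r\le\bar n-1$. In particular, if there is an infinite branch, it must start with one of the abelian groups $A(\bar n)$, and all the subsequent groups must be of the second type, that is, of the form $G(k,k,r)$ with $k\ge 3$ and $2\le r\le k-1$. One thus gets chains of ancestors of the form $$A(\bar n)\to G(\bar n+(r-1),\bar n+(r-1),r)\to\cdots\to G(\bar n+i(r-1),\bar n+i(r-1),r)\to\cdots ,$$ where there is one such infinite branch for each pair of integers $(\bar n,r)$ with $\bar n,r\ge 2$.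
   Context: All $p$-groups are finite; $C_k$ denotes the cyclic group of order $k$. $[x,y]=x^{-1}y^{-1}xy$. The rank of a $p$-group considered here is its minimal number of generators. For a group $H$ and a positive integer $k$, $H^{k}$ denotes the subgroup generated by all $k$-th powers of elements of $H$. A finite $p$-group $G$ is powerful if $[G,G]\le G^{p}$ when $p$ is odd, and $[G,G]\le G^{4}$ when $p=2$. A powerful $p$-group $G$ is powerfully nilpotent if it has an ascending chain of subgroups $\{1\}=H_{0}\le H_{1}\le\cdots\le H_{n}=G$ such that $[H_{i},G]\le H_{i-1}^{p}$ for $i=1,\ldots,n$. The ancestry tree (for a fixed prime $p$) has as vertices the powerfully nilpotent $p$-groups, one for each isomorphism class, with a directed edge $H\to G$ if and only if $H\cong G/Z(G)^{p}$ and $G$ is not abelian, where $Z(G)$ is the centre of $G$; then $G$ is called a direct ancestor of $H$. A grandparent of $H$ is a direct ancestor of a direct ancestor of $H$. An infinite branch is an infinite chain $H_{0}\to H_{1}\to H_{2}\to\cdots$ of directed edges, starting with an abelian group $H_0$ (here of rank $2$).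
   Formalization: Infinite branches correspond to pairs with 2 ≤ n̄ ≤ r, not all n̄,r ≥ 2: the first edge A(n̄) → G(n̄+r−1,n̄+r−1,r) exists iff n̄ ≤ r (e.g. G(4,4,2)/Z^p = G(3,3,2) is nonabelian, so not A(3)); the later edges are proved for all n̄,r ≥ 2. *)

theory Defs
  imports "HOL-Algebra.Algebra" "HOL-Computational_Algebra.Primes"
begin

section \<open>Powerfully nilpotent groups\<close>

definition finite_p_group :: "nat \<Rightarrow> ('a, 'b) monoid_scheme \<Rightarrow> bool" where
  "finite_p_group p G \<longleftrightarrow> group G \<and> finite (carrier G) \<and> (\<exists>k. order G = p ^ k)"

text \<open>The library's \<^const>\<open>derived\<close> uses \<open>x y x\<inverse> y\<inverse>\<close> and only covers \<open>[H, H]\<close>; here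
  \<open>[x, y] = x\<inverse> y\<inverse> x y\<close>.\<close>

definition commutator_subgroup ::
    "('a, 'b) monoid_scheme \<Rightarrow> 'a set \<Rightarrow> 'a set \<Rightarrow> 'a set" where
  "commutator_subgroup G H K =
     generate G {inv\<^bsub>G\<^esub> x \<otimes>\<^bsub>G\<^esub> inv\<^bsub>G\<^esub> y \<otimes>\<^bsub>G\<^esub> x \<otimes>\<^bsub>G\<^esub> y | x y. x \<in> H \<and> y \<in> K}"

definition power_subgroup :: "('a, 'b) monoid_scheme \<Rightarrow> 'a set \<Rightarrow> nat \<Rightarrow> 'a set" where
  "power_subgroup G H k = generate G {x [^]\<^bsub>G\<^esub> k | x. x \<in> H}"

definition centre :: "('a, 'b) monoid_scheme \<Rightarrow> 'a set" where
  "centre G = {z \<in> carrier G. \<forall>g \<in> carrier G. z \<otimes>\<^bsub>G\<^esub> g = g \<otimes>\<^bsub>G\<^esub> z}"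

definition group_rank :: "('a, 'b) monoid_scheme \<Rightarrow> nat" where
  "group_rank G =
     (LEAST d. \<exists>S \<subseteq> carrier G. finite S \<and> card S = d \<and> generate G S = carrier G)"

definition powerful :: "nat \<Rightarrow> ('a, 'b) monoid_scheme \<Rightarrow> bool" where
  "powerful p G \<longleftrightarrow> finite_p_group p G \<and>
     commutator_subgroup G (carrier G) (carrier G)
       \<subseteq> power_subgroup G (carrier G) (if p = 2 then 4 else p)"

definition powerfully_nilpotent :: "nat \<Rightarrow> ('a, 'b) monoid_scheme \<Rightarrow> bool" where
  "powerfully_nilpotent p G \<longleftrightarrow> powerful p G \<and>
     (\<exists>n H. H 0 = {\<one>\<^bsub>G\<^esub>} \<and> H n = carrier G \<and>
        (\<forall>i\<le>n. subgroup (H i) G) \<and>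
        (\<forall>i<n. H i \<subseteq> H (Suc i) \<and>
           commutator_subgroup G (H (Suc i)) (carrier G) \<subseteq> power_subgroup G (H i) p))"


section \<open>The ancestry tree\<close>

text \<open>Isomorphism classes are represented inside \<open>nat monoid\<close>; every finite group, on whatever
  type, has an isomorphic copy there.\<close>

definition iso_class :: "('a, 'b) monoid_scheme \<Rightarrow> nat monoid set" where
  "iso_class H = {K :: nat monoid. group K \<and> K \<cong> H}"

definition vertices_of_rank :: "nat \<Rightarrow> nat \<Rightarrow> nat monoid set set" where
  "vertices_of_rank p d =
     {iso_class H | H :: nat monoid. powerfully_nilpotent p H \<and> group_rank H = d}"

text \<open>\<open>ancestry_edge p V W\<close> is the edge \<open>V \<rightarrow> W\<close>, i.e. \<open>W\<close> is a direct ancestor of \<open>V\<close>.\<close>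

definition ancestry_edge :: "nat \<Rightarrow> nat monoid set \<Rightarrow> nat monoid set \<Rightarrow> bool" where
  "ancestry_edge p V W \<longleftrightarrow>
     (\<exists>(H :: nat monoid) (G :: nat monoid).
        powerfully_nilpotent p H \<and> powerfully_nilpotent p G \<and>
        V = iso_class H \<and> W = iso_class G \<and>
        H \<cong> G Mod power_subgroup G (centre G) p \<and> \<not> comm_group G)"

definition has_grandparent :: "nat \<Rightarrow> nat monoid set \<Rightarrow> bool" where
  "has_grandparent p V \<longleftrightarrow> (\<exists>W U. ancestry_edge p V W \<and> ancestry_edge p W U)"

definition infinite_branch :: "nat \<Rightarrow> (nat \<Rightarrow> nat monoid set) \<Rightarrow> bool" where
  "infinite_branch p S \<longleftrightarrow>
     (\<exists>H :: nat monoid. powerfully_nilpotent p H \<and> comm_group H \<and> group_rank H = 2 \<and>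
        S 0 = iso_class H) \<and>
     (\<forall>i. ancestry_edge p (S i) (S (Suc i)))"


section \<open>Groups given by generators and relations\<close>

text \<open>A letter \<open>(x, False)\<close> stands for the generator \<open>x\<close> and \<open>(x, True)\<close> for its inverse; a pair
  \<open>(u, v) \<in> R\<close> is the relation \<open>u = v\<close>.\<close>

type_synonym 'x gword = "('x \<times> bool) list"

inductive word_eq :: "('x gword \<times> 'x gword) set \<Rightarrow> 'x gword \<Rightarrow> 'x gword \<Rightarrow> bool"
  for R where
  word_eq_refl: "word_eq R u u"
| word_eq_sym: "word_eq R u v \<Longrightarrow> word_eq R v u"
| word_eq_trans: "word_eq R u v \<Longrightarrow> word_eq R v w \<Longrightarrow> word_eq R u w"
| word_eq_append: "word_eq R u u' \<Longrightarrow> word_eq R v v' \<Longrightarrow> word_eq R (u @ v) (u' @ v')"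
| word_eq_cancel: "word_eq R [(x, s), (x, \<not> s)] []"
| word_eq_relation: "(u, v) \<in> R \<Longrightarrow> word_eq R u v"

definition word_class :: "('x gword \<times> 'x gword) set \<Rightarrow> 'x gword \<Rightarrow> 'x gword set" where
  "word_class R u = {v. word_eq R u v}"

definition presented_group :: "('x gword \<times> 'x gword) set \<Rightarrow> 'x gword set monoid" where
  "presented_group R =
     \<lparr>carrier = range (word_class R),
      monoid.mult = (\<lambda>C D. \<Union>u\<in>C. \<Union>v\<in>D. word_class R (u @ v)),
      one = word_class R []\<rparr>"

lemma word_class_eq_iff: "word_class R u = word_class R v \<longleftrightarrow> word_eq R u v"
proof
  assume "word_class R u = word_class R v"
  then show "word_eq R u v"
    using word_eq_refl[of R v] unfolding word_class_def by blast
next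
  assume uv: "word_eq R u v"
  have "word_eq R u w \<longleftrightarrow> word_eq R v w" for w
    using uv word_eq_trans word_eq_sym by metis
  then show "word_class R u = word_class R v"
    unfolding word_class_def by blast
qed

lemma presented_group_mult:
  "word_class R u \<otimes>\<^bsub>presented_group R\<^esub> word_class R v = word_class R (u @ v)"
proof -
  have eq: "word_class R (u' @ v') = word_class R (u @ v)"
    if "u' \<in> word_class R u" "v' \<in> word_class R v" for u' v'
    using that word_eq_append[of R u u' v v'] word_eq_sym
    unfolding word_class_eq_iff by (simp add: word_class_def)
  have "u \<in> word_class R u" "v \<in> word_class R v"
    by (simp_all add: word_class_def word_eq_refl)
  then have "(\<Union>u'\<in>word_class R u. \<Union>v'\<in>word_class R v. word_class R (u' @ v'))
      = word_class R (u @ v)"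
    using eq by blast
  then show ?thesis
    by (simp add: presented_group_def)
qed

lemma word_eq_inverse: "word_eq R (rev (map (\<lambda>(x, s). (x, \<not> s)) u) @ u) []"
proof (induction u)
  case Nil
  show ?case by (simp add: word_eq_refl)
next
  case (Cons l u)
  obtain x s where l: "l = (x, s)" by (cases l)
  let ?w = "rev (map (\<lambda>(x, s). (x, \<not> s)) u)"
  have "word_eq R [(x, \<not> s), (x, s)] []"
    using word_eq_cancel[of R x "\<not> s"] by simp
  then have "word_eq R (?w @ [(x, \<not> s), (x, s)] @ u) (?w @ [] @ u)"
    by (intro word_eq_append word_eq_refl)
  then have "word_eq R (?w @ [(x, \<not> s), (x, s)] @ u) []"
    using Cons.IH by (auto elim: word_eq_trans)
  then show ?case
    by (simp add: l)
qed

lemma group_presented_group: "group (presented_group R)"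
proof (rule groupI)
  have carrierE: "\<exists>u. C = word_class R u" if "C \<in> carrier (presented_group R)" for C
    using that by (auto simp: presented_group_def)
  have carrierI: "word_class R u \<in> carrier (presented_group R)" for u
    by (simp add: presented_group_def)
  have one: "\<one>\<^bsub>presented_group R\<^esub> = word_class R []"
    by (simp add: presented_group_def)
  show "\<one>\<^bsub>presented_group R\<^esub> \<in> carrier (presented_group R)"
    unfolding one by (rule carrierI)
  fix C assume "C \<in> carrier (presented_group R)"
  then obtain u where u: "C = word_class R u"
    using carrierE by blast
  show "\<one>\<^bsub>presented_group R\<^esub> \<otimes>\<^bsub>presented_group R\<^esub> C = C"
    unfolding one u presented_group_mult by simp
  have "word_class R (rev (map (\<lambda>(x, s). (x, \<not> s)) u)) \<otimes>\<^bsub>presented_group R\<^esub> C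
      = \<one>\<^bsub>presented_group R\<^esub>"
    unfolding one u presented_group_mult word_class_eq_iff by (rule word_eq_inverse)
  then show "\<exists>D\<in>carrier (presented_group R). D \<otimes>\<^bsub>presented_group R\<^esub> C = \<one>\<^bsub>presented_group R\<^esub>"
    using carrierI by blast
  fix D assume "D \<in> carrier (presented_group R)"
  then obtain v where v: "D = word_class R v"
    using carrierE by blast
  show "C \<otimes>\<^bsub>presented_group R\<^esub> D \<in> carrier (presented_group R)"
    unfolding u v presented_group_mult by (rule carrierI)
  fix E assume "E \<in> carrier (presented_group R)"
  then obtain w where w: "E = word_class R w"
    using carrierE by blast
  show "C \<otimes>\<^bsub>presented_group R\<^esub> D \<otimes>\<^bsub>presented_group R\<^esub> E
      = C \<otimes>\<^bsub>presented_group R\<^esub> (D \<otimes>\<^bsub>presented_group R\<^esub> E)"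
    unfolding u v w presented_group_mult by simp
qed


section \<open>The groups $A(n)$ and $G(n,m,r)$\<close>

datatype gen = GenA | GenB

text \<open>\<open>\<langle>a, b | a^(p^n) = 1, b^(p^m) = 1, [a, b] = a^(p^r)\<rangle>\<close>\<close>

definition G_group :: "nat \<Rightarrow> nat \<Rightarrow> nat \<Rightarrow> nat \<Rightarrow> gen gword set monoid" where
  "G_group p n m r = presented_group
     {(replicate (p ^ n) (GenA, False), []),
      (replicate (p ^ m) (GenB, False), []),
      ([(GenA, True), (GenB, True), (GenA, False), (GenB, False)],
       replicate (p ^ r) (GenA, False))}"

definition A_group :: "nat \<Rightarrow> nat \<Rightarrow> (int \<times> int) monoid" where
  "A_group p n = integer_mod_group (p ^ n) \<times>\<times> integer_mod_group (p ^ n)"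

definition ancestor_chain :: "nat \<Rightarrow> nat \<Rightarrow> nat \<Rightarrow> nat \<Rightarrow> nat monoid set" where
  "ancestor_chain p n r i =
     (if i = 0 then iso_class (A_group p n)
      else iso_class (G_group p (n + i * (r - 1)) (n + i * (r - 1)) r))"

text \<open>The consecutive terms of \<open>ancestor_chain p n r\<close> with positive index are joined by an edge for
  all \<open>n, r \<ge> 2\<close>. The first edge needs \<open>n \<le> r\<close> in addition:
  with \<open>N = n + (r-1)\<close> the centre of \<open>G(N, N, r)\<close> is
  generated by \<open>a^(p^(n-1))\<close> and \<open>b^(p^(n-1))\<close>, so \<open>G(N, N, r) / Z^p\<close> is \<open>G(n, n, r)\<close>, in which
  \<open>[a, b] = a^(p^r)\<close> is nontrivial if \<open>r < n\<close>. For \<open>r < n\<close> the terms with positive index are the tail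
  of the chain of the pair \<open>(n - j(r-1), r)\<close>, with \<open>j\<close> the number for which
  \<open>2 \<le> n - j(r-1) \<le> r\<close>.\<close>

end

(* Let T be powerfully nilpotent, nonabelian and generated by two elements.

   T is metacyclic: going down through quotients by central subgroups of order p inside [T, T], one
   reaches a group with commutator subgroup of order p.  There the chain in the definition of powerful
   nilpotency shows that [T, T] is generated by an element z
       = v^p with v central, and an element g with
   g^(p^s) = z and s as large as possible is part of a generating pair.  After replacing b by a power,
   T = <a, b> with [a, b] = a^(p^r), r >= 2, and a has order p^(r + e).

   The centre is <a^(p^e), b^(p^e)>, so T/Z(T)^p kills the p^(e+1)-th powers of a and b.  A relation
   a^i = b^j in T forces p^e to divide i and j, and this survives in the quotient, where
       the new e is
   smaller by at least one if the quotient is nonabelian; hence the second quotient has order exactly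
   p^(2(e'+1)) and is G(e'+1, e'+1, r).  The same computation
       shows that the quotient of G(N, N, r) by
   Z^p is G(N-r+1, N-r+1, r), and orders distinguish these groups. *)
theory Submission
  imports Defs "HOL-Number_Theory.Cong"
begin

section \<open>Powers of integers congruent to one\<close>

text \<open>The prime 2 needs no separate argument: as \<open>r >= 2\<close>, the square of a
  multiple of \<open>p^(r+j)\<close> is divisible by \<open>p^(r+j+2)\<close>, so second-order terms
  of binomial expansions never interfere with the first-order term. The abelian groups are not a
  separate family either: \<open>A(n)\<close> is the metacyclic model with parameters
  \<open>n\<close> and any \<open>r >= n\<close>, where the twisting is trivial modulo
  \<open>p^n\<close>. The price is that the class of \<open>A(n)\<close> does not determine
  \<open>r\<close>; a branch reveals its \<open>r\<close> only at its second vertex, and several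
  branches share one starting point. Isomorphisms are obtained by counting. The presentation maps
  onto every group that satisfies its relations and has at most \<open>p^(2n)\<close> elements, so a
  group of that order with suitable generators is \<open>G(n,n,r)\<close>; the concrete model
  supplies such a group. The obstacle in a single quotient is a gap of one factor \<open>p\<close>:
  relations in an arbitrary \<open>T\<close> are only controlled modulo \<open>p^e\<close>, while
  the kernel consists of products of \<open>p^(e+1)\<close>-th powers. Hence the appeal to
  grandparents.\<close>

lemma one_plus_power_expand: "\<exists>s. (1 + y) ^ n = 1 + n * y + y\<^sup>2 * s" for y n :: nat
proof (induction n)
  case (Suc n)
  then obtain s where "(1 + y) ^ n = 1 + n * y + y\<^sup>2 * s" by blast
  then have "(1 + y) ^ Suc n = 1 + Suc n * y + y\<^sup>2 * (n + s + y * s)"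
    by (simp add: algebra_simps power2_eq_square)
  then show ?case by blast
qed simp

text \<open>Each further \<open>p\<close>-th power moves the first-order term up by one factor
  \<open>p\<close>. With \<open>y\<close> divisible by \<open>p^(r+j)\<close>, the remainder
  \<open>y^2 s\<close> is divisible by \<open>p^(2(r+j))\<close>, and \<open>2(r+j) >= r+j+2\<close>
  is exactly where \<open>r >= 2\<close> enters.\<close>

lemma one_plus_power_prime_power:
  fixes p r u j :: nat
  assumes "2 \<le> r"
  shows "\<exists>w. (1 + u * p ^ r) ^ (p ^ j) = 1 + u * p ^ (r + j) + w * p ^ (r + j + 1)"
proof (induction j)
  case 0
  show ?case by (rule exI[of _ 0]) simp
next
  case (Suc j)
  then obtain w where w: "(1 + u * p ^ r) ^ (p ^ j) = 1 + u * p ^ (r + j) + w * p ^ (r + j + 1)"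
    by blast
  define y where "y = p ^ (r + j) * (u + w * p)"
  obtain s where s: "(1 + y) ^ p = 1 + p * y + y\<^sup>2 * s"
    using one_plus_power_expand by blast
  obtain d where d: "2 * (r + j) = r + j + 2 + d"
    using assms by (metis add_le_mono1 le_Suc_ex mult_2 nat_add_left_cancel_le trans_le_add1)
  have "y\<^sup>2 = p ^ (2 * (r + j)) * (u + w * p)\<^sup>2"
    by (simp add: y_def power_mult_distrib power_mult[symmetric] mult.commute)
  then have y2: "y\<^sup>2 = p ^ (r + j + 2) * (p ^ d * (u + w * p)\<^sup>2)"
    by (simp only: d power_add mult.assoc)
  have "(1 + u * p ^ r) ^ (p ^ Suc j) = ((1 + u * p ^ r) ^ (p ^ j)) ^ p"
    by (simp add: power_mult[symmetric] mult.commute)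
  also have "\<dots> = (1 + y) ^ p"
    unfolding w by (simp add: y_def algebra_simps)
  also have "\<dots> = 1 + u * p ^ (r + Suc j) + (w + p ^ d * (u + w * p)\<^sup>2 * s) * p ^ (r + Suc j + 1)"
    unfolding s y2 by (simp add: y_def algebra_simps)
  finally show ?case by blast
qed

lemma one_plus_power_prime_power_mult:
  fixes p r u j t :: nat
  assumes "2 \<le> r"
  shows "\<exists>w. (1 + u * p ^ r) ^ (p ^ j * t) = 1 + t * u * p ^ (r + j) + w * p ^ (r + j + 1)"
proof -
  obtain w where w: "(1 + u * p ^ r) ^ (p ^ j) = 1 + u * p ^ (r + j) + w * p ^ (r + j + 1)"
    using one_plus_power_prime_power[OF assms] by blast
  define y where "y = p ^ (r + j) * (u + w * p)"
  obtain s where s: "(1 + y) ^ t = 1 + t * y + y\<^sup>2 * s"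
    using one_plus_power_expand by blast
  obtain d where d: "2 * (r + j) = r + j + 1 + d"
    using assms by (metis One_nat_def Suc_1 add_leD2 le_Suc_ex mult_2 nat_add_left_cancel_le plus_1_eq_Suc trans_le_add1)
  have "y\<^sup>2 = p ^ (2 * (r + j)) * (u + w * p)\<^sup>2"
    by (simp add: y_def power_mult_distrib power_mult[symmetric] mult.commute)
  then have y2: "y\<^sup>2 = p ^ (r + j + 1) * (p ^ d * (u + w * p)\<^sup>2)"
    by (simp only: d power_add mult.assoc)
  have "(1 + u * p ^ r) ^ (p ^ j * t) = (1 + y) ^ t"
    unfolding power_mult w by (simp add: y_def algebra_simps)
  also have "\<dots> = 1 + t * u * p ^ (r + j) + (t * w + p ^ d * (u + w * p)\<^sup>2 * s) * p ^ (r + j + 1)"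
    unfolding s y2 by (simp add: y_def algebra_simps)
  finally show ?thesis by blast
qed

text \<open>Writing \<open>j = p^f t\<close> with \<open>p\<close> not dividing \<open>t\<close>,
  the difference has \<open>p\<close>-adic valuation exactly \<open>r + f\<close>. In other words
  \<open>1 + p^r\<close> has order \<open>p^e\<close> modulo \<open>p^(r+e)\<close>, which later
  decides which powers of \<open>b\<close> commute with \<open>a\<close>.\<close>

lemma prime_power_dvd_one_plus_power_diff_iff:
  fixes p r e j :: nat
  assumes "Factorial_Ring.prime p" "2 \<le> r"
  shows "p ^ (r + e) dvd (1 + p ^ r) ^ j - 1 \<longleftrightarrow> p ^ e dvd j"
proof
  assume "p ^ e dvd j"
  then obtain t where j: "j = p ^ e * t" by blast
  obtain w where "(1 + 1 * p ^ r) ^ (p ^ e * t) = 1 + t * 1 * p ^ (r + e) + w * p ^ (r + e + 1)"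
    using one_plus_power_prime_power_mult[OF assms(2)] by blast
  then have "(1 + p ^ r) ^ j - 1 = p ^ (r + e) * (t + w * p)"
    by (simp add: j algebra_simps)
  then show "p ^ (r + e) dvd (1 + p ^ r) ^ j - 1" by simp
next
  assume L: "p ^ (r + e) dvd (1 + p ^ r) ^ j - 1"
  show "p ^ e dvd j"
  proof (cases "j = 0")
    case False
    then obtain f t where j: "j = p ^ f * t" and t: "\<not> p dvd t"
      using prime_power_canonical[OF assms(1)] by (metis neq0_conv mult.commute)
    obtain w where "(1 + 1 * p ^ r) ^ (p ^ f * t) = 1 + t * 1 * p ^ (r + f) + w * p ^ (r + f + 1)"
      using one_plus_power_prime_power_mult[OF assms(2)] by blast
    then have eq: "(1 + p ^ r) ^ j - 1 = p ^ (r + f) * (t + w * p)"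
      by (simp add: j algebra_simps)
    have "e \<le> f"
    proof (rule ccontr)
      assume "\<not> e \<le> f"
      then have "p ^ (r + f + 1) dvd p ^ (r + e)"
        by (intro le_imp_power_dvd) simp
      then have "p ^ (r + f + 1) dvd p ^ (r + f) * (t + w * p)"
        using L eq dvd_trans by metis
      then have "p dvd t + w * p"
        using assms(1) by (simp add: prime_gt_0_nat)
      then show False using t by (simp add: dvd_add_left_iff)
    qed
    then show ?thesis by (simp add: j dvd_mult2 le_imp_power_dvd)
  qed simp
qed

text \<open>The residues \<open>1 + v p\<^sup>r\<close> form a cyclic group generated by any \<open>1 + u p\<^sup>r\<close> with \<open>p\<close> not
  dividing \<open>u\<close>; the induction corrects one digit at a time.\<close>

lemma ex_power_cong_one_plus_prime_power:
  fixes p r u N :: nat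
  assumes "Factorial_Ring.prime p" "2 \<le> r" "\<not> p dvd u" "r \<le> N"
  shows "\<exists>t. [(1 + u * p ^ r) ^ t = 1 + p ^ r] (mod p ^ N)"
  using assms(4)
proof (induction N rule: dec_induct)
  case base
  have "[1 + u * p ^ r = 1 + p ^ r] (mod p ^ r)"
    by (intro cong_add cong_refl) (simp add: cong_def)
  then show ?case by (metis power_one_right)
next
  case (step N)
  define q where "q = 1 + u * p ^ r"
  obtain t where t: "[q ^ t = 1 + p ^ r] (mod p ^ N)"
    using step q_def by auto
  have cop: "coprime u p"
    using assms by (metis coprime_commute prime_imp_coprime)
  obtain v where v: "[u * v = 1] (mod p)"
    using cop cong_solve_coprime_nat by (metis One_nat_def)
  have "[int (q ^ t) = int (1 + p ^ r)] (mod int (p ^ N))"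
    using t cong_int_iff by blast
  then obtain x where x: "int (1 + p ^ r) = int (q ^ t) + int (p ^ N) * x"
    unfolding cong_iff_lin by auto
  \<comment> \<open>The defect \<open>x\<close> may be negative, hence the integers. Multiplying
    \<open>q^t\<close> by \<open>1 + s u p^N\<close> changes it by \<open>q^t s u p^N\<close>, and
    \<open>q^t\<close> is 1 modulo \<open>p\<close>; so the digit must satisfy
    \<open>s u = x\<close> modulo \<open>p\<close>, and \<open>v\<close> is the inverse of
    \<open>u\<close>.\<close>
  define s where "s = nat ((x * int v) mod int p)"
  have p0: "0 < p" using assms(1) prime_gt_0_nat by blast
  have s: "[int s = x * int v] (mod int p)"
    unfolding s_def using p0 by (simp add: cong_def)
  obtain w where "(1 + u * p ^ r) ^ (p ^ (N - r) * s)
      = 1 + s * u * p ^ (r + (N - r)) + w * p ^ (r + (N - r) + 1)"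
    using one_plus_power_prime_power_mult[OF assms(2)] by blast
  then have w: "q ^ (p ^ (N - r) * s) = 1 + s * u * p ^ N + w * p ^ (N + 1)"
    using step by (simp add: q_def)
  have "[int (q ^ t) = 1] (mod int p)"
  proof -
    have "[q ^ t = 1 ^ t] (mod p)"
    proof (rule cong_pow)
      have "[u * p ^ r = 0] (mod p)"
        using assms(2) by (simp add: cong_0_iff dvd_power)
      then have "[1 + u * p ^ r = 1 + 0] (mod p)"
        by (intro cong_add cong_refl)
      then show "[q = 1] (mod p)" by (simp add: q_def)
    qed
    then show ?thesis using cong_int_iff[of "q ^ t" 1 p] by simp
  qed
  moreover have "[int s * int u = x] (mod int p)"
  proof -
    have "[int s * int u = x * int v * int u] (mod int p)"
      using s by (rule cong_scalar_right)
    also have "[x * int v * int u = x * 1] (mod int p)"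
      using v unfolding mult.assoc
      by (intro cong_scalar_left) (metis cong_int_iff mult.commute of_nat_1 of_nat_mult)
    finally show ?thesis by simp
  qed
  ultimately have "[int (q ^ t) * (int s * int u) = 1 * x] (mod int p)"
    by (rule cong_mult)
  then have d1: "int p dvd int (q ^ t) * (int s * int u) - x"
    by (simp add: cong_iff_dvd_diff)
  have "int (q ^ (t + p ^ (N - r) * s)) - int (1 + p ^ r)
     = int (p ^ N) * ((int (q ^ t) * (int s * int u) - x) + int (q ^ t) * int w * int p)"
    unfolding x power_add[of q] w by (simp add: algebra_simps)
  moreover have "int p dvd (int (q ^ t) * (int s * int u) - x) + int (q ^ t) * int w * int p"
    using d1 by simp
  ultimately have "int (p ^ Suc N) dvd int (q ^ (t + p ^ (N - r) * s)) - int (1 + p ^ r)"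
    by (simp add: mult_dvd_mono mult.commute[of "int p"])
  then have "[q ^ (t + p ^ (N - r) * s) = 1 + p ^ r] (mod p ^ Suc N)"
    using cong_iff_dvd_diff cong_int_iff by blast
  then show ?case unfolding q_def by blast
qed

section \<open>Transport along homomorphisms\<close>

lemma group_homI: "group G \<Longrightarrow> group H \<Longrightarrow> h \<in> hom G H \<Longrightarrow> group_hom G H h"
  by (simp add: group_hom_def group_hom_axioms_def)

lemma is_isoE:
  assumes "G \<cong> H"
  obtains h where "h \<in> hom G H" "bij_betw h (carrier G) (carrier H)"
  using assms unfolding is_iso_def iso_def by blast

lemma surj_hom_card_iso:
  assumes "h \<in> hom G H" "h ` carrier G = carrier H" "finite (carrier G)"
    "card (carrier G) \<le> card (carrier H)"
  shows "G \<cong> H"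
proof -
  have "card (h ` carrier G) = card (carrier G)"
    using assms card_image_le[OF assms(3), of h] by simp
  then have "inj_on h (carrier G)"
    using assms(3) by (simp add: eq_card_imp_inj_on)
  then show ?thesis
    using assms unfolding is_iso_def iso_def bij_betw_def by blast
qed

lemma ex_iso_nat_monoid:
  fixes G (structure)
  assumes "group G" "finite (carrier G)"
  shows "\<exists>K :: nat monoid. group K \<and> G \<cong> K"
proof -
  interpret group G by fact
  obtain f where f: "bij_betw f (carrier G) {0..<card (carrier G)}"
    using ex_bij_betw_finite_nat[OF assms(2)] by blast
  define g where "g = inv_into (carrier G) f"
  have gf: "g (f x) = x" if "x \<in> carrier G" for x
    using f that unfolding g_def bij_betw_def by simp
  define K :: "nat monoid" where
    "K = \<lparr>carrier = f ` carrier G, monoid.mult = (\<lambda>x y. f (g x \<otimes>\<^bsub>G\<^esub> g y)), one = f \<one>\<^bsub>G\<^esub>\<rparr>"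
  have K: "f \<in> iso G K"
    using f unfolding iso_def hom_def K_def by (auto simp: gf bij_betw_def)
  have "group K"
  proof -
    have "K\<lparr>one := f \<one>\<rparr> = K" by (simp add: K_def)
    moreover have "monoid K"
      by unfold_locales (auto simp: K_def gf m_assoc)
    ultimately show ?thesis using iso_imp_img_group[OF K] by simp
  qed
  then show ?thesis using K unfolding is_iso_def by blast
qed

lemma iso_class_eqI:
  assumes "group G" "group H" "G \<cong> H"
  shows "iso_class G = iso_class H"
proof -
  have "H \<cong> G" using group.iso_sym[OF assms(1,3)] .
  then have "K \<cong> G \<longleftrightarrow> K \<cong> H" for K :: "nat monoid"
    using assms(3) iso_trans[of K G H] iso_trans[of K H G] by blast
  then show ?thesis
    by (simp add: iso_class_def)
qed

text \<open>A finite group has a copy among the groups on \<open>nat\<close>, so its class is never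
  empty; a common member of both classes links the two groups.\<close>

lemma iso_class_eqD:
  fixes G :: "('a, 'b) monoid_scheme" and H :: "('c, 'd) monoid_scheme"
  assumes "group G" "finite (carrier G)" "group H" "iso_class G = iso_class H"
  shows "G \<cong> H"
proof -
  obtain K :: "nat monoid" where K: "group K" "G \<cong> K"
    using ex_iso_nat_monoid[OF assms(1,2)] by blast
  then have "K \<in> iso_class G"
    using group.iso_sym[OF assms(1)] by (simp add: iso_class_def)
  then have "K \<in> iso_class H"
    using assms(4) by (simp only:)
  then have "K \<cong> H" by (simp add: iso_class_def)
  with K(2) show ?thesis by (rule iso_trans)
qed

lemma iso_carrier:
  assumes "G \<cong> H"
  shows "card (carrier G) = card (carrier H)" and "finite (carrier G) \<longleftrightarrow> finite (carrier H)"
  using assms by (auto elim!: is_isoE dest: bij_betw_same_card bij_betw_finite)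

lemma (in group_hom) commutator_subgroup_img:
  assumes "A \<subseteq> carrier G" "B \<subseteq> carrier G"
  shows "h ` commutator_subgroup G A B = commutator_subgroup H (h ` A) (h ` B)"
proof -
  have eq: "h (inv x \<otimes> inv y \<otimes> x \<otimes> y)
      = inv\<^bsub>H\<^esub> h x \<otimes>\<^bsub>H\<^esub> inv\<^bsub>H\<^esub> h y \<otimes>\<^bsub>H\<^esub> h x \<otimes>\<^bsub>H\<^esub> h y"
    if "x \<in> A" "y \<in> B" for x y
    using that assms by (auto simp: subset_iff)
  have "h ` {inv x \<otimes> inv y \<otimes> x \<otimes> y | x y. x \<in> A \<and> y \<in> B}
    = {inv\<^bsub>H\<^esub> x \<otimes>\<^bsub>H\<^esub> inv\<^bsub>H\<^esub> y \<otimes>\<^bsub>H\<^esub> x \<otimes>\<^bsub>H\<^esub> y | x y. x \<in> h ` A \<and> y \<in> h ` B}"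
    (is "?L = ?R")
  proof (intro equalityI subsetI)
    fix z assume "z \<in> ?L"
    then obtain x y where "x \<in> A" "y \<in> B" "z = h (inv x \<otimes> inv y \<otimes> x \<otimes> y)" by blast
    then show "z \<in> ?R" using eq by blast
  next
    fix z assume "z \<in> ?R"
    then obtain x y where xy: "x \<in> A" "y \<in> B"
      "z = inv\<^bsub>H\<^esub> h x \<otimes>\<^bsub>H\<^esub> inv\<^bsub>H\<^esub> h y \<otimes>\<^bsub>H\<^esub> h x \<otimes>\<^bsub>H\<^esub> h y" by blast
    then have "z = h (inv x \<otimes> inv y \<otimes> x \<otimes> y)" using eq by simp
    then show "z \<in> ?L" using xy by blast
  qed
  moreover have "{inv x \<otimes> inv y \<otimes> x \<otimes> y | x y. x \<in> A \<and> y \<in> B} \<subseteq> carrier G"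
    using assms by (auto simp: subset_iff)
  ultimately show ?thesis
    unfolding commutator_subgroup_def
    using generate_img[of "{inv x \<otimes> inv y \<otimes> x \<otimes> y | x y. x \<in> A \<and> y \<in> B}"] by simp
qed

lemma (in group_hom) power_subgroup_img:
  assumes "A \<subseteq> carrier G"
  shows "h ` power_subgroup G A k = power_subgroup H (h ` A) k"
proof -
  have "h ` {x [^] k | x. x \<in> A} = {x [^]\<^bsub>H\<^esub> k | x. x \<in> h ` A}" (is "?L = ?R")
  proof (intro equalityI subsetI)
    fix z assume "z \<in> ?L"
    then obtain x where "x \<in> A" "z = h (x [^] k)" by blast
    then show "z \<in> ?R" using assms by (auto simp: hom_nat_pow subset_iff)
  next
    fix z assume "z \<in> ?R"
    then obtain x where x: "x \<in> A" "z = h x [^]\<^bsub>H\<^esub> k" by blast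
    then have "z = h (x [^] k)" using assms by (auto simp: hom_nat_pow subset_iff)
    then show "z \<in> ?L" using x by blast
  qed
  moreover have "{x [^] k | x. x \<in> A} \<subseteq> carrier G"
    using assms by auto
  ultimately show ?thesis
    unfolding power_subgroup_def using generate_img[of "{x [^] k | x. x \<in> A}"] by simp
qed

lemma (in group_hom) finite_p_group_img:
  assumes "Factorial_Ring.prime p" "finite_p_group p G" "h ` carrier G = carrier H"
  shows "finite_p_group p H"
proof -
  obtain k where fin: "finite (carrier G)" and k: "order G = p ^ k"
    using assms(2) unfolding finite_p_group_def by blast
  have "G Mod kernel G H h \<cong> H"
    using FactGroup_iso[OF assms(3)] .
  then have "order H = card (rcosets kernel G H h)"
    using iso_carrier(1) by (fastforce simp: order_def FactGroup_def)
  then have "order H dvd p ^ k"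
    using G.lagrange[OF subgroup_kernel] k by (metis dvd_triv_left)
  then have "\<exists>j. order H = p ^ j"
    using assms(1) divides_primepow_nat by blast
  then show ?thesis
    using fin assms(3) H.is_group unfolding finite_p_group_def by (metis finite_imageI)
qed

lemma (in group_hom) powerful_img:
  assumes "Factorial_Ring.prime p" "powerful p G" "h ` carrier G = carrier H"
  shows "powerful p H"
proof -
  have "h ` commutator_subgroup G (carrier G) (carrier G)
    \<subseteq> h ` power_subgroup G (carrier G) (if p = 2 then 4 else p)"
    using assms(2) unfolding powerful_def by (intro image_mono) blast
  then show ?thesis
    using assms finite_p_group_img[OF assms(1) _ assms(3)] unfolding powerful_def
    by (simp only: commutator_subgroup_img power_subgroup_img subset_refl simp_thms)
qed

lemma (in group_hom) powerfully_nilpotent_img: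
  assumes "Factorial_Ring.prime p" "powerfully_nilpotent p G" "h ` carrier G = carrier H"
  shows "powerfully_nilpotent p H"
proof -
  obtain n K where nK: "K 0 = {\<one>} \<and> K n = carrier G \<and> (\<forall>i\<le>n. subgroup (K i) G) \<and>
      (\<forall>i<n. K i \<subseteq> K (Suc i) \<and>
        commutator_subgroup G (K (Suc i)) (carrier G) \<subseteq> power_subgroup G (K i) p)"
    using assms(2) unfolding powerfully_nilpotent_def by (elim conjE exE) (rule that, intro conjI)
  then have K: "K 0 = {\<one>}" "K n = carrier G" "\<And>i. i \<le> n \<Longrightarrow> subgroup (K i) G"
    "\<And>i. i < n \<Longrightarrow> K i \<subseteq> K (Suc i)"
    "\<And>i. i < n \<Longrightarrow> commutator_subgroup G (K (Suc i)) (carrier G) \<subseteq> power_subgroup G (K i) p"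
    by simp_all
  have sub: "K i \<subseteq> carrier G" if "i \<le> n" for i
    using K(3)[OF that] subgroup.subset by blast
  show ?thesis
    unfolding powerfully_nilpotent_def
  proof (intro conjI exI[of _ n] exI[of _ "\<lambda>i. h ` K i"] allI impI)
    show "powerful p H"
      using assms powerful_img unfolding powerfully_nilpotent_def by blast
    fix i assume i: "i < n"
    have "h ` commutator_subgroup G (K (Suc i)) (carrier G) \<subseteq> h ` power_subgroup G (K i) p"
      using K(5)[OF i] by blast
    then show "commutator_subgroup H (h ` K (Suc i)) (carrier H) \<subseteq> power_subgroup H (h ` K i) p"
      using i sub[of i] sub[of "Suc i"] assms(3)
      by (simp add: commutator_subgroup_img power_subgroup_img)
    show "h ` K i \<subseteq> h ` K (Suc i)" using K(4)[OF i] by blast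
  qed (use K assms(3) subgroup_img_is_subgroup in auto)
qed

lemma powerfully_nilpotent_iso:
  assumes "Factorial_Ring.prime p" "powerfully_nilpotent p G" "G \<cong> H" "group H"
  shows "powerfully_nilpotent p H"
proof -
  obtain h where h: "h \<in> hom G H" "bij_betw h (carrier G) (carrier H)"
    using assms(3) by (rule is_isoE)
  have "group G"
    using assms(2) unfolding powerfully_nilpotent_def powerful_def finite_p_group_def by blast
  then have "group_hom G H h"
    using h assms(4) by (simp add: group_homI)
  then show ?thesis
    using group_hom.powerfully_nilpotent_img assms h unfolding bij_betw_def by blast
qed

lemma powerfully_nilpotentD:
  assumes "powerfully_nilpotent p G"
  shows "group G" "finite (carrier G)" "\<exists>k. order G = p ^ k"
  using assms unfolding powerfully_nilpotent_def powerful_def finite_p_group_def by blast+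

lemma (in group_hom) comm_group_img:
  assumes "comm_group G" "h ` carrier G = carrier H"
  shows "comm_group H"
proof (rule group.group_comm_groupI)
  fix x y assume "x \<in> carrier H" "y \<in> carrier H"
  then obtain u v where "u \<in> carrier G" "v \<in> carrier G" "x = h u" "y = h v"
    using assms(2) by (metis imageE)
  then show "x \<otimes>\<^bsub>H\<^esub> y = y \<otimes>\<^bsub>H\<^esub> x"
    using comm_groupE(4)[OF assms(1)] by (metis hom_mult)
qed (rule H.is_group)

lemma comm_group_iso:
  assumes "comm_group G" "G \<cong> H" "group H"
  shows "comm_group H"
proof -
  obtain h where h: "h \<in> hom G H" "bij_betw h (carrier G) (carrier H)"
    using assms(2) by (rule is_isoE)
  have "group_hom G H h"
    using h assms comm_group.axioms(2) by (blast intro: group_homI)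
  then show ?thesis
    using group_hom.comm_group_img assms(1) h unfolding bij_betw_def by blast
qed

section \<open>Generation by two elements and the rank\<close>

text \<open>Rank at most two, in the form that passes to images at once and, for direct ancestors,
  also back from the quotient. The exact value 2 of the rank is only tracked for the model
  groups.\<close>

definition two_generated :: "('a, 'b) monoid_scheme \<Rightarrow> bool" where
  "two_generated G \<longleftrightarrow> (\<exists>x\<in>carrier G. \<exists>y\<in>carrier G. generate G {x, y} = carrier G)"

lemma (in group_hom) two_generated_img:
  assumes "two_generated G" "h ` carrier G = carrier H"
  shows "two_generated H"
proof -
  obtain x y where xy: "x \<in> carrier G" "y \<in> carrier G" "generate G {x, y} = carrier G"
    using assms(1) unfolding two_generated_def by blast
  then have "generate H {h x, h y} = carrier H"
    using generate_img[of "{x, y}"] assms(2) by simp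
  then show ?thesis
    unfolding two_generated_def using xy(1,2)[THEN hom_closed] by blast
qed

lemma group_rank_two_imp_two_generated:
  assumes "group G" "finite (carrier G)" "group_rank G = 2"
  shows "two_generated G"
proof -
  interpret group G by fact
  let ?P = "\<lambda>d. \<exists>S\<subseteq>carrier G. finite S \<and> card S = d \<and> generate G S = carrier G"
  have "generate G (carrier G) = carrier G"
    using generate_incl[OF subset_refl] generate.incl[of _ "carrier G" G] by blast
  then have "?P (card (carrier G))" using assms(2) by blast
  then have "?P (group_rank G)" unfolding group_rank_def by (rule LeastI)
  then obtain S where S: "S \<subseteq> carrier G" "card S = 2" "generate G S = carrier G"
    using assms(3) by auto
  then obtain x y where "S = {x, y}" by (metis card_2_iff)
  then show ?thesis unfolding two_generated_def using S by auto
qed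

lemma group_rank_eq_twoI:
  fixes G (structure)
  assumes "group G" "two_generated G"
    and not_cyclic: "\<And>x. x \<in> carrier G \<Longrightarrow> generate G {x} \<noteq> carrier G"
  shows "group_rank G = 2"
proof -
  interpret group G by fact
  obtain x y where xy: "x \<in> carrier G" "y \<in> carrier G" "generate G {x, y} = carrier G"
    using assms(2) unfolding two_generated_def by blast
  have "x \<noteq> y"
  proof
    assume "x = y"
    then have "generate G {x} = carrier G" using xy(3) by simp
    then show False using not_cyclic[OF xy(1)] by contradiction
  qed
  show ?thesis
    unfolding group_rank_def
  proof (rule Least_equality)
    show "\<exists>S\<subseteq>carrier G. finite S \<and> card S = 2 \<and> generate G S = carrier G"
      using xy \<open>x \<noteq> y\<close> by (intro exI[of _ "{x, y}"]) simp
    fix d assume "\<exists>S\<subseteq>carrier G. finite S \<and> card S = d \<and> generate G S = carrier G"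
    then obtain S where S: "S \<subseteq> carrier G" "finite S" "card S = d" "generate G S = carrier G"
      by blast
    \<comment> \<open>An empty generating set would make the group trivial, hence generated by the
      single element \<open>\<one>\<close>.\<close>
    have "d \<noteq> 0"
      using S not_cyclic[of \<one>] by (auto simp: generate_empty generate_one)
    moreover have "d \<noteq> 1"
      using S not_cyclic by (auto simp: card_1_singleton_iff)
    ultimately show "2 \<le> d" by linarith
  qed
qed

section \<open>The centre, its powers and quotients by them\<close>

lemma centre_comm: "z \<in> centre G \<Longrightarrow> g \<in> carrier G \<Longrightarrow> z \<otimes>\<^bsub>G\<^esub> g = g \<otimes>\<^bsub>G\<^esub> z"
  by (simp add: centre_def)

lemma centre_closed: "z \<in> centre G \<Longrightarrow> z \<in> carrier G"
  by (simp add: centre_def)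

lemma (in group) subgroup_centre: "subgroup (centre G) G"
proof (rule subgroupI)
  show "centre G \<noteq> {}" by (auto simp: centre_def intro!: exI[of _ \<one>])
  fix x assume x: "x \<in> centre G"
  then have xc: "x \<in> carrier G" by (simp add: centre_def)
  show "inv x \<in> centre G"
    unfolding centre_def
  proof (intro CollectI conjI ballI)
    fix g assume g: "g \<in> carrier G"
    then have "inv (x \<otimes> inv g) = inv (inv g \<otimes> x)"
      using x by (simp add: centre_def)
    then show "inv x \<otimes> g = g \<otimes> inv x"
      using xc g by (simp add: inv_mult_group)
  qed (use xc in simp)
  fix y assume y: "y \<in> centre G"
  then have yc: "y \<in> carrier G" by (simp add: centre_def)
  show "x \<otimes> y \<in> centre G"
    unfolding centre_def
  proof (intro CollectI conjI ballI)
    fix g assume g: "g \<in> carrier G"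
    have "x \<otimes> y \<otimes> g = x \<otimes> g \<otimes> y"
      using y g xc yc by (simp add: centre_def m_assoc)
    also have "\<dots> = g \<otimes> (x \<otimes> y)"
      using x g xc yc by (simp add: centre_def m_assoc)
    finally show "x \<otimes> y \<otimes> g = g \<otimes> (x \<otimes> y)" .
  qed (use xc yc in simp)
qed (auto simp: centre_def)

text \<open>Powers of commuting elements multiply, so the set of \<open>k\<close>-th powers is
  already closed and generating from it adds nothing.\<close>

lemma (in group) power_subgroup_centre:
  "power_subgroup G (centre G) k = {z [^] k | z. z \<in> centre G}" (is "_ = ?S")
proof -
  interpret Z: subgroup "centre G" G by (rule subgroup_centre)
  have "subgroup ?S G"
  proof (rule subgroupI)
    show "?S \<noteq> {}" using Z.one_closed by blast
    fix x assume "x \<in> ?S"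
    then obtain z where z: "z \<in> centre G" "x = z [^] k" by blast
    then have "inv x = inv z [^] k" by (simp add: nat_pow_inv)
    then show "inv x \<in> ?S" using z by auto
    fix y assume "y \<in> ?S"
    then obtain w where w: "w \<in> centre G" "y = w [^] k" by blast
    have "x \<otimes> y = (z \<otimes> w) [^] k"
      unfolding z(2) w(2)
      using pow_mult_distrib[OF centre_comm[OF z(1)], of w k] z(1) w(1) centre_closed by simp
    moreover have "z \<otimes> w \<in> centre G" using z(1) w(1) by (rule Z.m_closed)
    ultimately show "x \<otimes> y \<in> ?S" by blast
  qed auto
  then show ?thesis
    unfolding power_subgroup_def
    by (intro equalityI generate_subgroup_incl subset_refl subsetI generate.incl)
qed

lemma (in group) normal_power_subgroup_centre: "power_subgroup G (centre G) k \<lhd> G"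
proof -
  interpret Z: subgroup "centre G" G by (rule subgroup_centre)
  have 1: "{z [^] k | z. z \<in> centre G} \<subseteq> centre G"
  proof safe
    fix z assume "z \<in> centre G"
    then show "z [^] k \<in> centre G" by (induction k) auto
  qed
  have "g \<otimes> x \<otimes> inv g = x" if "x \<in> centre G" "g \<in> carrier G" for x g
  proof -
    have "g \<otimes> x \<otimes> inv g = x \<otimes> g \<otimes> inv g"
      by (subst centre_comm[OF that]) (rule refl)
    also have "\<dots> = x" using that(2) centre_closed[OF that(1)] by (simp add: m_assoc)
    finally show ?thesis .
  qed
  then have conj: "g \<otimes> x \<otimes> inv g \<in> {z [^] k | z. z \<in> centre G}"
    if "x \<in> {z [^] k | z. z \<in> centre G}" "g \<in> carrier G" for x g
    using that 1 by (simp add: subset_iff)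
  have "{z [^] k | z. z \<in> centre G} \<subseteq> carrier G"
    using 1 by (meson centre_closed subset_iff)
  then show ?thesis
    unfolding power_subgroup_def by (rule normal_generateI) (rule conj)
qed

lemma (in group) ex_hom_of_quotient_iso:
  assumes "N \<lhd> G" "group H" "G Mod N \<cong> H"
  shows "\<exists>f\<in>hom G H. f ` carrier G = carrier H \<and> kernel G H f = N"
proof -
  interpret N: normal N G by fact
  have img: "(\<lambda>x. N #> x) ` carrier G = carrier (G Mod N)"
    by (auto simp: FactGroup_def RCOSETS_def)
  obtain h where h: "h \<in> hom (G Mod N) H" "bij_betw h (carrier (G Mod N)) (carrier H)"
    using assms(3) by (rule is_isoE)
  define f where "f = (\<lambda>x. h (N #> x))"
  have f: "f \<in> hom G H"
    using N.r_coset_hom_Mod h(1) unfolding f_def hom_def by (auto simp: Pi_iff)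
  have "f ` carrier G = h ` ((\<lambda>x. N #> x) ` carrier G)"
    unfolding f_def by (simp add: image_image)
  then have fi: "f ` carrier G = carrier H"
    using h(2) unfolding img bij_betw_def by simp
  have "x \<in> kernel G H f \<longleftrightarrow> x \<in> N" for x
  proof (cases "x \<in> carrier G")
    case True
    have c: "N #> x \<in> carrier (G Mod N)" "N \<in> carrier (G Mod N)"
      using rcosetsI[OF N.subset True] rcosetsI[OF N.subset one_closed] coset_mult_one[OF N.subset]
      by (auto simp: FactGroup_def)
    have "h N = \<one>\<^bsub>H\<^esub>"
      using hom_one[OF h(1) N.factorgroup_is_group assms(2)] by simp
    then have "f x = \<one>\<^bsub>H\<^esub> \<longleftrightarrow> N #> x = N"
      using c h(2) unfolding f_def bij_betw_def by (metis inj_onD)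
    then show ?thesis
      using True rcos_self[OF True N.subgroup_axioms] coset_join2[OF True N.subgroup_axioms]
      by (auto simp: kernel_def)
  next
    case False
    then show ?thesis using N.subset by (auto simp: kernel_def)
  qed
  then have "kernel G H f = N" by blast
  then show ?thesis using f fi by blast
qed

section \<open>Edges as surjections with kernel \<open>Z(G)\<^sup>p\<close>\<close>

text \<open>\<open>ancestry_edge\<close> on representatives of arbitrary type, with the quotient replaced by a
  surjective homomorphism so that it can be composed with isomorphisms.\<close>

definition direct_ancestor ::
    "nat \<Rightarrow> ('a, 'b) monoid_scheme \<Rightarrow> ('c, 'd) monoid_scheme \<Rightarrow> bool" where
  "direct_ancestor p H G \<longleftrightarrow>
     powerfully_nilpotent p H \<and> powerfully_nilpotent p G \<and> \<not> comm_group G \<and>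
     (\<exists>f\<in>hom G H. f ` carrier G = carrier H \<and>
        kernel G H f = power_subgroup G (centre G) p)"

lemma iso_centre_power:
  assumes "group G" "group G'" "h \<in> hom G G'" "bij_betw h (carrier G) (carrier G')"
  shows "h ` power_subgroup G (centre G) k = power_subgroup G' (centre G') k"
proof -
  interpret h: group_hom G G' h using assms by (simp add: group_homI)
  have inj: "inj_on h (carrier G)" and img: "h ` carrier G = carrier G'"
    using assms(4) by (auto simp: bij_betw_def)
  have iff: "z \<in> centre G \<longleftrightarrow> h z \<in> centre G'" if z: "z \<in> carrier G" for z
  proof -
    have "(h z \<otimes>\<^bsub>G'\<^esub> h g = h g \<otimes>\<^bsub>G'\<^esub> h z) \<longleftrightarrow> (z \<otimes>\<^bsub>G\<^esub> g = g \<otimes>\<^bsub>G\<^esub> z)"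
      if "g \<in> carrier G" for g
      using that z inj_on_eq_iff[OF inj, of "z \<otimes>\<^bsub>G\<^esub> g" "g \<otimes>\<^bsub>G\<^esub> z"] by simp
    then show ?thesis using z unfolding centre_def img[symmetric] by auto
  qed
  have "h ` centre G = centre G'"
  proof (intro equalityI subsetI)
    fix w assume w: "w \<in> centre G'"
    then obtain z where z: "z \<in> carrier G" "w = h z"
      using img centre_closed by (metis imageE)
    then have "z \<in> centre G" using w iff by simp
    then show "w \<in> h ` centre G" using z(2) by (rule rev_image_eqI)
  next
    fix w assume "w \<in> h ` centre G"
    then show "w \<in> centre G'" using iff centre_closed by (metis imageE)
  qed
  then show ?thesis
    using h.power_subgroup_img[of "centre G"] by (auto simp: centre_def)
qed

lemma direct_ancestor_iso:
  assumes "Factorial_Ring.prime p" "direct_ancestor p H G" "H \<cong> H'" "G \<cong> G'" "group H'" "group G'"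
  shows "direct_ancestor p H' G'"
proof -
  have gr: "group H" "group G"
    using assms(2) powerfully_nilpotentD(1) unfolding direct_ancestor_def by blast+
  obtain f where f: "f \<in> hom G H" "f ` carrier G = carrier H"
    "kernel G H f = power_subgroup G (centre G) p"
    using assms(2) unfolding direct_ancestor_def by blast
  obtain h where h: "h \<in> hom H H'" "bij_betw h (carrier H) (carrier H')"
    using assms(3) by (rule is_isoE)
  have "G' \<cong> G" using group.iso_sym[OF gr(2) assms(4)] .
  then obtain g where g: "g \<in> hom G' G" "bij_betw g (carrier G') (carrier G)"
    by (rule is_isoE)
  have gi: "g ` carrier G' = carrier G" and hi: "h ` carrier H = carrier H'"
    using g h by (auto simp: bij_betw_def)
  define F where "F = (\<lambda>x. h (f (g x)))"
  have F: "F \<in> hom G' H'"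
    using f(1) g(1) h(1) unfolding F_def hom_def by (auto simp: Pi_iff)
  have Fi: "F ` carrier G' = carrier H'"
    unfolding F_def using f(2) gi hi by (metis image_image)
  have "kernel G' H' F = power_subgroup G' (centre G') p"
  proof -
    have h1: "h y = \<one>\<^bsub>H'\<^esub> \<longleftrightarrow> y = \<one>\<^bsub>H\<^esub>" if "y \<in> carrier H" for y
      using that h hom_one[OF h(1) gr(1) assms(5)] unfolding bij_betw_def
      by (metis gr(1) group.is_monoid inj_onD monoid.one_closed)
    have "x \<in> kernel G' H' F \<longleftrightarrow> g x \<in> kernel G H f" if "x \<in> carrier G'" for x
    proof -
      have gx: "g x \<in> carrier G" using that gi by blast
      then have "f (g x) \<in> carrier H" using f(2) by blast
      then show ?thesis using that gx h1 unfolding kernel_def F_def by simp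
    qed
    moreover have "g x \<in> power_subgroup G (centre G) p \<longleftrightarrow> x \<in> power_subgroup G' (centre G') p"
      if "x \<in> carrier G'" for x
    proof -
      have "power_subgroup G' (centre G') p \<subseteq> carrier G'"
        using group.normal_power_subgroup_centre[OF assms(6)] normal_imp_subgroup subgroup.subset
        by blast
      then show ?thesis
        using that g(2) iso_centre_power[OF assms(6) gr(2) g, of p, symmetric]
          inj_on_image_mem_iff[of g "carrier G'" x "power_subgroup G' (centre G') p"]
        unfolding bij_betw_def by simp
    qed
    moreover have "power_subgroup G' (centre G') p \<subseteq> carrier G'"
      using group.normal_power_subgroup_centre[OF assms(6)] normal_imp_subgroup subgroup.subset
      by blast
    ultimately show ?thesis
      using f(3) unfolding kernel_def by blast
  qed
  moreover have "powerfully_nilpotent p H'" "powerfully_nilpotent p G'"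
    using assms powerfully_nilpotent_iso unfolding direct_ancestor_def by blast+
  moreover have "\<not> comm_group G'"
    using assms(2) comm_group_iso[OF _ \<open>G' \<cong> G\<close> gr(2)] unfolding direct_ancestor_def by blast
  ultimately show ?thesis
    unfolding direct_ancestor_def using F Fi by blast
qed

lemma ancestry_edgeE:
  assumes "ancestry_edge p V W"
  obtains H G :: "nat monoid" where "V = iso_class H" "W = iso_class G" "direct_ancestor p H G"
proof -
  obtain H G :: "nat monoid" where HG: "powerfully_nilpotent p H" "powerfully_nilpotent p G"
    "V = iso_class H" "W = iso_class G" "H \<cong> G Mod power_subgroup G (centre G) p" "\<not> comm_group G"
    using assms unfolding ancestry_edge_def by blast
  note H = powerfully_nilpotentD(1)[OF HG(1)]
  interpret group G using powerfully_nilpotentD HG by blast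
  have "G Mod power_subgroup G (centre G) p \<cong> H"
    using group.iso_sym[OF H HG(5)] .
  then have "direct_ancestor p H G"
    unfolding direct_ancestor_def
    using ex_hom_of_quotient_iso[OF normal_power_subgroup_centre H] HG by blast
  then show ?thesis using that HG by blast
qed

lemma ancestry_edgeI:
  assumes "Factorial_Ring.prime p" "direct_ancestor p H G"
  shows "ancestry_edge p (iso_class H) (iso_class G)"
proof -
  have pn: "powerfully_nilpotent p H" "powerfully_nilpotent p G"
    using assms(2) unfolding direct_ancestor_def by blast+
  note gr = powerfully_nilpotentD[OF pn(1)] powerfully_nilpotentD[OF pn(2)]
  obtain H' :: "nat monoid" where H': "group H'" "H \<cong> H'"
    using ex_iso_nat_monoid gr by blast
  obtain G' :: "nat monoid" where G': "group G'" "G \<cong> G'"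
    using ex_iso_nat_monoid gr by blast
  have D: "direct_ancestor p H' G'"
    using direct_ancestor_iso[OF assms H'(2) G'(2) H'(1) G'(1)] .
  then obtain f where f: "f \<in> hom G' H'" "f ` carrier G' = carrier H'"
    "kernel G' H' f = power_subgroup G' (centre G') p"
    unfolding direct_ancestor_def by blast
  interpret f: group_hom G' H' f using f G' H' by (simp add: group_homI)
  have "G' Mod power_subgroup G' (centre G') p \<cong> H'"
    using f.FactGroup_iso[OF f(2)] f(3) by simp
  then have "H' \<cong> G' Mod power_subgroup G' (centre G') p"
    using group.iso_sym normal.factorgroup_is_group f.G.normal_power_subgroup_centre by blast
  moreover have "iso_class H = iso_class H'" "iso_class G = iso_class G'"
    using iso_class_eqI gr H' G' by metis+
  ultimately show ?thesis
    unfolding ancestry_edge_def using D unfolding direct_ancestor_def by blast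
qed

text \<open>An edge between classes only provides some pair of representatives; transport along
  isomorphisms yields the relation for the representatives at hand.\<close>

lemma direct_ancestor_of_edge:
  assumes "Factorial_Ring.prime p" "ancestry_edge p (iso_class H) (iso_class G)"
    "group H" "finite (carrier H)" "group G" "finite (carrier G)"
  shows "direct_ancestor p H G"
proof -
  obtain H' G' :: "nat monoid" where D: "iso_class H = iso_class H'" "iso_class G = iso_class G'"
    "direct_ancestor p H' G'"
    using assms(2) by (rule ancestry_edgeE)
  then have gr: "group H'" "group G'" "finite (carrier H')" "finite (carrier G')"
    unfolding direct_ancestor_def using powerfully_nilpotentD by blast+
  have "H' \<cong> H" "G' \<cong> G"
    using iso_class_eqD D(1,2) assms gr by metis+
  then show ?thesis
    using direct_ancestor_iso[OF assms(1) D(3)] assms by blast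
qed

text \<open>The kernel \<open>Z(G)^p\<close> depends on \<open>G\<close> alone, so both groups are
  the same quotient. This is the tree property, and it is used as an invariant: the parameters of a
  group can be compared through its unique quotient.\<close>

lemma direct_ancestor_unique:
  assumes "direct_ancestor p H G" "direct_ancestor p H' G"
  shows "H \<cong> H'"
proof -
  obtain f where f: "f \<in> hom G H" "f ` carrier G = carrier H"
    "kernel G H f = power_subgroup G (centre G) p"
    using assms(1) unfolding direct_ancestor_def by blast
  obtain f' where f': "f' \<in> hom G H'" "f' ` carrier G = carrier H'"
    "kernel G H' f' = power_subgroup G (centre G) p"
    using assms(2) unfolding direct_ancestor_def by blast
  have gr: "group G" "group H" "group H'"
    using assms powerfully_nilpotentD(1) unfolding direct_ancestor_def by blast+
  have 1: "G Mod power_subgroup G (centre G) p \<cong> H"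
    using group_hom.FactGroup_iso[OF group_homI[OF gr(1,2) f(1)] f(2)] f(3) by simp
  have 2: "G Mod power_subgroup G (centre G) p \<cong> H'"
    using group_hom.FactGroup_iso[OF group_homI[OF gr(1,3) f'(1)] f'(2)] f'(3) by simp
  have "group (G Mod power_subgroup G (centre G) p)"
    using normal.factorgroup_is_group group.normal_power_subgroup_centre gr(1) by blast
  then show ?thesis using 1 2 group.iso_sym iso_trans by blast
qed

section \<open>Metacyclic normal forms\<close>

context group
begin

lemma inv_mult_cancel:
  assumes "w \<in> carrier G" "s \<in> carrier G" "t \<in> carrier G"
  shows "inv (w \<otimes> s) \<otimes> (w \<otimes> t) = inv s \<otimes> t"
proof -
  have "inv w \<otimes> (w \<otimes> t) = t" using assms by (simp add: m_assoc[symmetric])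
  then show ?thesis using assms by (simp add: inv_mult_group m_assoc)
qed

text \<open>Conjugation by \<open>b\<close> acts on the powers of \<open>a\<close> as multiplication
  of exponents by \<open>q\<close>, so passing \<open>b^j\<close> costs a factor \<open>q^j\<close>.
  In the application \<open>q = 1 + p^r\<close>.\<close>

lemma pow_conj_pow:
  assumes "a \<in> carrier G" "b \<in> carrier G" "a \<otimes> b = b \<otimes> a [^] (q::nat)"
  shows "a [^] (i::nat) \<otimes> b [^] (j::nat) = b [^] j \<otimes> a [^] (i * q ^ j)"
proof (induction j)
  case (Suc j)
  have one: "a [^] (i::nat) \<otimes> b = b \<otimes> a [^] (i * q)" for i
  proof (induction i)
    case (Suc i)
    have "a [^] Suc i \<otimes> b = a [^] i \<otimes> (a \<otimes> b)"
      using assms(1,2) by (simp add: m_assoc)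
    also have "\<dots> = (a [^] i \<otimes> b) \<otimes> a [^] q"
      using assms by (simp add: m_assoc)
    also have "\<dots> = b \<otimes> a [^] (Suc i * q)"
      using Suc assms(1,2) by (simp add: m_assoc nat_pow_mult add.commute)
    finally show ?case .
  qed (use assms in simp)
  have "a [^] i \<otimes> b [^] Suc j = (a [^] i \<otimes> b [^] j) \<otimes> b"
    using assms(1,2) by (simp add: m_assoc)
  also have "\<dots> = b [^] j \<otimes> (a [^] (i * q ^ j) \<otimes> b)"
    using Suc assms(1,2) by (simp add: m_assoc)
  also have "\<dots> = b [^] Suc j \<otimes> a [^] (i * q ^ Suc j)"
    using one[of "i * q ^ j"] assms(1,2) by (simp add: m_assoc mult_ac)
  finally show ?case .
qed (use assms in simp)

lemma normal_form_mult:
  assumes "a \<in> carrier G" "b \<in> carrier G" "a \<otimes> b = b \<otimes> a [^] (q::nat)"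
  shows "(b [^] (j::nat) \<otimes> a [^] (i::nat)) \<otimes> (b [^] (j'::nat) \<otimes> a [^] (i'::nat))
    = b [^] (j + j') \<otimes> a [^] (i * q ^ j' + i')"
proof -
  have "(b [^] j \<otimes> a [^] i) \<otimes> (b [^] j' \<otimes> a [^] i')
      = b [^] j \<otimes> (a [^] i \<otimes> b [^] j') \<otimes> a [^] i'"
    using assms(1,2) by (simp add: m_assoc)
  also have "\<dots> = b [^] j \<otimes> (b [^] j' \<otimes> a [^] (i * q ^ j')) \<otimes> a [^] i'"
    using pow_conj_pow[OF assms] by simp
  also have "\<dots> = (b [^] j \<otimes> b [^] j') \<otimes> (a [^] (i * q ^ j') \<otimes> a [^] i')"
    using assms(1,2) by (simp add: m_assoc)
  finally show ?thesis
    using assms(1,2) by (simp add: nat_pow_mult)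
qed

text \<open>Inverses are rewritten as powers with natural exponents, \<open>A - 1\<close> standing
  for \<open>-1\<close>. All exponent arithmetic can then stay in the natural numbers.\<close>

lemma inv_pow_eq_pow:
  assumes "a \<in> carrier G" "a [^] A = \<one>" "0 < (A::nat)"
  shows "inv (a [^] (i::nat)) = a [^] (i * (A - 1))"
proof (rule inv_equality)
  have "i * (A - 1) + i = A * i"
    using assms(3) by (cases A) (simp_all add: algebra_simps)
  then show "a [^] (i * (A - 1)) \<otimes> a [^] i = \<one>"
    using assms by (simp add: nat_pow_mult) (metis nat_pow_one nat_pow_pow)
qed (use assms in auto)

lemma generate_normal_form:
  assumes ab: "a \<in> carrier G" "b \<in> carrier G" "a \<otimes> b = b \<otimes> a [^] (q::nat)"
    and A: "a [^] A = \<one>" "0 < (A::nat)" and B: "b [^] B = \<one>" "0 < (B::nat)"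
  shows "generate G {a, b} = {b [^] j \<otimes> a [^] i | (i::nat) (j::nat). True}" (is "_ = ?S")
proof -
  have S: "b [^] j \<otimes> a [^] i \<in> ?S" for i j :: nat by blast
  have sub: "subgroup ?S G"
  proof (rule subgroupI)
    show "?S \<subseteq> carrier G" using ab by auto
    show "?S \<noteq> {}" using S by blast
    fix x assume "x \<in> ?S"
    then obtain i j :: nat where x: "x = b [^] j \<otimes> a [^] i" by blast
    have "inv x = a [^] (i * (A - 1)) \<otimes> b [^] (j * (B - 1))"
      unfolding x using ab A B by (simp add: inv_mult_group inv_pow_eq_pow)
    then show "inv x \<in> ?S"
      unfolding pow_conj_pow[OF ab] using S by simp
    fix y assume "y \<in> ?S"
    then obtain i' j' :: nat where y: "y = b [^] j' \<otimes> a [^] i'" by blast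
    show "x \<otimes> y \<in> ?S"
      unfolding x y normal_form_mult[OF ab] by (rule S)
  qed
  have "{a, b} \<subseteq> ?S"
    using S[of 0 1] S[of 1 0] ab by simp
  moreover have "?S \<subseteq> generate G {a, b}"
  proof
    fix x assume "x \<in> ?S"
    then obtain i j :: nat where x: "x = b [^] j \<otimes> a [^] i" by blast
    have gen: "subgroup (generate G {a, b}) G"
      using ab by (intro generate_is_subgroup) simp
    have "a [^] i \<in> generate G {a, b}" for i :: nat
      by (induction i) (auto intro: generate.intros)
    moreover have "b [^] j \<in> generate G {a, b}" for j :: nat
      by (induction j) (auto intro: generate.intros)
    ultimately show "x \<in> generate G {a, b}"
      unfolding x by (intro generate.eng)
  qed
  ultimately show ?thesis
    using generate_subgroup_incl[OF _ sub] by blast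
qed

lemma pow_mod_eq:
  assumes "a \<in> carrier G" "a [^] A = \<one>"
  shows "a [^] (i mod A) = a [^] (i::nat)"
proof -
  have "a [^] i = a [^] (A * (i div A) + i mod A)" by simp
  also have "\<dots> = (a [^] A) [^] (i div A) \<otimes> a [^] (i mod A)"
    using assms(1) by (simp only: nat_pow_mult nat_pow_pow)
  finally show ?thesis using assms by simp
qed

lemma generate_normal_form_image:
  assumes ab: "a \<in> carrier G" "b \<in> carrier G" "a \<otimes> b = b \<otimes> a [^] (q::nat)"
    and A: "a [^] A = \<one>" "0 < (A::nat)" and B: "b [^] B = \<one>" "0 < (B::nat)"
  shows "generate G {a, b} = (\<lambda>(j, i). b [^] j \<otimes> a [^] i) ` ({..<B} \<times> {..<A})"
proof -
  have "b [^] j \<otimes> a [^] i \<in> (\<lambda>(j, i). b [^] j \<otimes> a [^] i) ` ({..<B} \<times> {..<A})" for i j :: nat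
  proof (rule image_eqI)
    show "b [^] j \<otimes> a [^] i = (\<lambda>(j, i). b [^] j \<otimes> a [^] i) (j mod B, i mod A)"
      using pow_mod_eq ab A B by simp
  qed (use A B in auto)
  then show ?thesis
    unfolding generate_normal_form[OF assms] by auto
qed

text \<open>Two equal normal forms rearrange to \<open>a^(i' - i) = b^(j - j')\<close>. The
  differences are written with \<open>P - i\<close> and \<open>P - j'\<close>, so that
  \<open>indep\<close> applies; below \<open>P\<close> the resulting divisibilities force
  equality.\<close>

lemma inj_on_normal_form:
  assumes ab: "a \<in> carrier G" "b \<in> carrier G" "a [^] P = \<one>" "b [^] P = \<one>"
    and indep: "\<And>i j. a [^] i = b [^] j \<Longrightarrow> (P::nat) dvd i \<and> P dvd j"
  shows "inj_on (\<lambda>(j, i). b [^] j \<otimes> a [^] i) ({..<P} \<times> {..<P})"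
proof (rule inj_onI)
  fix x y assume xy: "x \<in> {..<P} \<times> {..<P}" "y \<in> {..<P} \<times> {..<P}"
    "(case x of (j, i) \<Rightarrow> b [^] j \<otimes> a [^] i) = (case y of (j, i) \<Rightarrow> b [^] j \<otimes> a [^] i)"
  obtain j i where x: "x = (j, i)" by fastforce
  obtain j' i' where y: "y = (j', i')" by fastforce
  have lt: "j \<in> {..<P}" "i \<in> {..<P}" "j' \<in> {..<P}" "i' \<in> {..<P}"
    and eq: "b [^] j \<otimes> a [^] i = b [^] j' \<otimes> a [^] i'"
    using xy by (simp_all add: x y)
  have "a [^] (i' + (P - i)) = b [^] (P - j') \<otimes> (b [^] j' \<otimes> a [^] i') \<otimes> a [^] (P - i)"
    using ab lt by (simp add: nat_pow_mult m_assoc[symmetric])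
  also have "\<dots> = b [^] (P - j') \<otimes> (b [^] j \<otimes> a [^] i) \<otimes> a [^] (P - i)"
    using eq by simp
  also have "\<dots> = (b [^] (P - j') \<otimes> b [^] j) \<otimes> (a [^] i \<otimes> a [^] (P - i))"
    using ab(1,2) by (simp add: m_assoc)
  also have "\<dots> = b [^] (P - j' + j)"
    using ab lt by (simp add: nat_pow_mult)
  finally have d: "P dvd i' + (P - i)" "P dvd P - j' + j"
    using indep by blast+
  have *: "x = y" if xy: "x < P" "y < P" "P dvd x + (P - y)" for x y
  proof -
    obtain k where k: "x + (P - y) = P * k" using xy(3) by (elim dvdE)
    have "0 < P * k" "P * k < P * 2" using k xy(1,2) by linarith+
    then have "k = 1" by (simp del: mult_Suc_right)
    then show ?thesis using k xy(1,2) by simp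
  qed
  show "x = y"
    unfolding x y using *[of i' i] *[of j j'] d lt by (simp add: add.commute)
qed

lemma card_generate_normal_form:
  assumes ab: "a \<in> carrier G" "b \<in> carrier G" "a \<otimes> b = b \<otimes> a [^] (q::nat)"
    "a [^] P = \<one>" "b [^] P = \<one>" "0 < (P::nat)"
    and indep: "\<And>i j. a [^] i = b [^] j \<Longrightarrow> P dvd i \<and> P dvd j"
  shows "card (generate G {a, b}) = P * P"
  unfolding generate_normal_form_image[OF ab(1-4,6,5,6)]
  using card_image[OF inj_on_normal_form[OF ab(1,2,4,5) indep]] by (simp add: card_cartesian_product)

end

text \<open>The orders of \<open>a\<close> and \<open>b\<close> are left open, so that every
  homomorphic image is again an instance with the same \<open>p\<close> and \<open>r\<close>.
  Abelian groups are included: they are the instances with \<open>a^(p^r) = \<one>\<close>.\<close>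

locale metacyclic = group G for G (structure) +
  fixes a b :: 'a and p r :: nat
  assumes prime: "Factorial_Ring.prime p"
    and r: "2 \<le> r"
    and p_group: "finite_p_group p G"
    and a [simp]: "a \<in> carrier G" and b [simp]: "b \<in> carrier G"
    and gen: "generate G {a, b} = carrier G"
    and rel: "a \<otimes> b = b \<otimes> a [^] (1 + p ^ r)"
begin

lemma fin: "finite (carrier G)"
  using p_group by (simp add: finite_p_group_def)

lemma ex_exponent: "\<exists>N. \<forall>x\<in>carrier G. x [^] (p ^ N) = \<one>"
  using p_group pow_order_eq_1 unfolding finite_p_group_def by metis

lemma p_gt_1: "1 < p"
  using prime prime_gt_1_nat by blast

lemma inv_powE:
  assumes "x \<in> carrier G"
  obtains A :: nat where "\<And>i::nat. inv (x [^] i) = x [^] (i * A)"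
proof -
  obtain N where "x [^] (p ^ N) = \<one>" using ex_exponent assms by blast
  then show ?thesis
    using that inv_pow_eq_pow[OF assms] p_gt_1 by simp
qed

lemma carrier_eq: "carrier G = {b [^] j \<otimes> a [^] i | (i::nat) (j::nat). True}"
proof -
  obtain N where "\<forall>x\<in>carrier G. x [^] (p ^ N) = \<one>" using ex_exponent by blast
  then show ?thesis
    using generate_normal_form[OF a b rel, of "p ^ N" "p ^ N"] gen p_gt_1 by simp
qed

lemma normal_formE:
  assumes "x \<in> carrier G"
  obtains i j :: nat where "x = b [^] j \<otimes> a [^] i"
  using assms carrier_eq by blast

lemmas normal_form_mult' = normal_form_mult[OF a b rel]

text \<open>In normal form, \<open>x \<otimes> y\<close> and \<open>y \<otimes> x\<close> have the
  same exponent of \<open>b\<close>, and both exponents of \<open>a\<close> are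
  \<open>i + i'\<close> modulo \<open>p^r\<close>, because \<open>1 + p^r\<close> is 1 modulo
  \<open>p^r\<close>. The common part cancels.\<close>

lemma commutator_in_powers:
  assumes "x \<in> carrier G" "y \<in> carrier G"
  shows "\<exists>k. inv x \<otimes> inv y \<otimes> x \<otimes> y = a [^] (p ^ r * k)"
proof -
  obtain i j where x: "x = b [^] (j::nat) \<otimes> a [^] (i::nat)" using assms normal_formE by metis
  obtain i' j' where y: "y = b [^] (j'::nat) \<otimes> a [^] (i'::nat)" using assms normal_formE by metis
  obtain s where "(1 + p ^ r) ^ j' = 1 + j' * p ^ r + (p ^ r)\<^sup>2 * s"
    using one_plus_power_expand by blast
  then have "i * (1 + p ^ r) ^ j' + i' = (i + i') + p ^ r * (i * (j' + p ^ r * s))"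
    by (simp add: algebra_simps power2_eq_square)
  then obtain S where "i * (1 + p ^ r) ^ j' + i' = (i + i') + p ^ r * S" by blast
  then have xy: "x \<otimes> y = b [^] (j + j') \<otimes> a [^] (i + i') \<otimes> a [^] (p ^ r * S)"
    unfolding x y normal_form_mult' by (simp only: m_assoc nat_pow_mult a b nat_pow_closed)
  obtain t where "(1 + p ^ r) ^ j = 1 + j * p ^ r + (p ^ r)\<^sup>2 * t"
    using one_plus_power_expand by blast
  then have "i' * (1 + p ^ r) ^ j + i = (i + i') + p ^ r * (i' * (j + p ^ r * t))"
    by (simp add: algebra_simps power2_eq_square)
  then obtain T where "i' * (1 + p ^ r) ^ j + i = (i + i') + p ^ r * T" by blast
  then have yx: "y \<otimes> x = b [^] (j + j') \<otimes> a [^] (i + i') \<otimes> a [^] (p ^ r * T)"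
    unfolding x y normal_form_mult' add.commute[of j' j]
    by (simp only: m_assoc nat_pow_mult a b nat_pow_closed)
  obtain A where A: "\<And>i::nat. inv (a [^] i) = a [^] (i * A)"
    using inv_powE[OF a] by blast
  have "inv x \<otimes> inv y \<otimes> x \<otimes> y = inv (y \<otimes> x) \<otimes> (x \<otimes> y)"
    using assms by (simp add: inv_mult_group m_assoc)
  also have "\<dots> = inv (a [^] (p ^ r * T)) \<otimes> a [^] (p ^ r * S)"
    unfolding xy yx by (rule inv_mult_cancel) simp_all
  also have "\<dots> = a [^] (p ^ r * (T * A + S))"
    unfolding A by (simp add: nat_pow_mult algebra_simps)
  finally show ?thesis by blast
qed

text \<open>Commutation with a power of \<open>a\<close> gains a full factor \<open>p^r\<close> in
  the exponent. One factor \<open>p\<close> of this gain descends in the chain of powers of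
  \<open>a\<close>, another one provides the \<open>p\<close>-th power demanded by powerful
  nilpotency.\<close>

lemma commutator_of_power:
  assumes "y \<in> carrier G"
  shows "\<exists>c. inv (a [^] m) \<otimes> inv y \<otimes> a [^] m \<otimes> y = a [^] (m * p ^ r * c)"
proof -
  obtain i j where y: "y = b [^] (j::nat) \<otimes> a [^] (i::nat)" using assms normal_formE by metis
  obtain s where s: "(1 + p ^ r) ^ j = 1 + j * p ^ r + (p ^ r)\<^sup>2 * s"
    using one_plus_power_expand by blast
  have e: "m * (1 + p ^ r) ^ j + i = i + m + m * p ^ r * (j + p ^ r * s)"
    unfolding s by (simp add: algebra_simps power2_eq_square)
  have "a [^] m \<otimes> y = b [^] j \<otimes> a [^] (i + m + m * p ^ r * (j + p ^ r * s))"
    using normal_form_mult'[of 0 m j i] unfolding y e by simp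
  then have "a [^] m \<otimes> y = y \<otimes> a [^] m \<otimes> a [^] (m * p ^ r * (j + p ^ r * s))"
    unfolding y by (simp only: m_assoc nat_pow_mult a b nat_pow_closed)
  moreover have "inv (a [^] m) \<otimes> inv y \<otimes> a [^] m \<otimes> y = inv (y \<otimes> a [^] m) \<otimes> (a [^] m \<otimes> y)"
    using assms by (simp add: inv_mult_group m_assoc)
  moreover have "inv (y \<otimes> a [^] m) \<otimes> (y \<otimes> a [^] m \<otimes> a [^] n) = a [^] n" for n :: nat
    using assms inv_mult_cancel[of "y \<otimes> a [^] m" \<one> "a [^] n"] by simp
  ultimately show ?thesis by metis
qed

lemma subgroup_powers:
  assumes "x \<in> carrier G"
  shows "subgroup {x [^] (m * k) | k::nat. True} G"
proof (rule subgroupI)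
  obtain A where A: "\<And>i::nat. inv (x [^] i) = x [^] (i * A)"
    using inv_powE[OF assms] by blast
  fix y assume "y \<in> {x [^] (m * k) | k::nat. True}"
  then obtain k where y: "y = x [^] (m * k)" by blast
  show "inv y \<in> {x [^] (m * k) | k::nat. True}"
    unfolding y A mult.assoc by blast
  fix z assume "z \<in> {x [^] (m * k) | k::nat. True}"
  then obtain l where z: "z = x [^] (m * l)" by blast
  have "y \<otimes> z = x [^] (m * (k + l))"
    unfolding y z using assms by (simp add: nat_pow_mult distrib_left)
  then show "y \<otimes> z \<in> {x [^] (m * k) | k::nat. True}" by blast
qed (use assms in auto)

lemma commutator_subgroup_le: "commutator_subgroup G (carrier G) (carrier G)
    \<subseteq> {a [^] (p ^ r * k) | k. True}"
  unfolding commutator_subgroup_def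
proof (rule generate_subgroup_incl[OF _ subgroup_powers[OF a]])
  show "{inv x \<otimes> inv y \<otimes> x \<otimes> y | x y. x \<in> carrier G
      \<and> y \<in> carrier G} \<subseteq> {a [^] (p ^ r * k) | k. True}"
    using commutator_in_powers by auto
qed

lemma powerfully_nilpotent: "powerfully_nilpotent p G"
  unfolding powerfully_nilpotent_def
proof
  obtain d where d: "r = d + 2" using r by (metis add.commute le_Suc_ex)
  show "powerful p G"
    unfolding powerful_def
  proof (intro conjI p_group subset_trans[OF commutator_subgroup_le])
    \<comment> \<open>For \<open>p = 2\<close> the condition asks for fourth powers, and
      \<open>2^r = 4 * 2^d\<close> because \<open>r = d + 2\<close>.\<close>
    have four: "a [^] (p ^ r * k) = (a [^] (p ^ d * k)) [^] (4::nat)" if "p = 2" for k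
      using that by (simp add: nat_pow_pow d power_add mult_ac)
    have p_pow: "a [^] (p ^ r * k) = (a [^] (p ^ (d + 1) * k)) [^] p" for k
      by (simp add: nat_pow_pow d power_add mult_ac)
    have "\<exists>x\<in>carrier G. a [^] (p ^ r * k) = x [^] (if p = 2 then 4 else p)" for k
    proof (cases "p = 2")
      case True
      then show ?thesis using four[OF True, of k] by (intro bexI[of _ "a [^] (p ^ d * k)"]) simp_all
    next
      case False
      then show ?thesis using p_pow[of k] by (intro bexI[of _ "a [^] (p ^ (d + 1) * k)"]) simp_all
    qed
    then have "a [^] (p ^ r * k) \<in> {x [^] (if p = 2 then 4 else p) | x. x \<in> carrier G}" for k
      by blast
    then show "{a [^] (p ^ r * k) | k. True} \<subseteq> power_subgroup G (carrier G) (if p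
        = 2 then 4 else p)"
      unfolding power_subgroup_def by (intro subsetI generate.incl) (elim CollectE exE conjE, simp only:)
  qed
  obtain N where N: "\<And>x. x \<in> carrier G \<Longrightarrow> x [^] (p ^ N) = \<one>" using ex_exponent by blast
  \<comment> \<open>The chain climbs from the trivial group through the powers of \<open>a\<close>
    to the whole cyclic group at index \<open>N\<close>, and then jumps to \<open>G\<close>. Below
    the jump a commutator is \<open>a\<close> to a multiple of \<open>p^(N - i - 1 + r)\<close>,
    hence of \<open>p^(N - i) * p\<close>; at the jump \<open>p^r\<close> supplies the required
    \<open>p\<close>-th power.\<close>
  define K where "K = (\<lambda>i. if i \<le> N then {a [^] (p ^ (N - i) * k) | k. True} else carrier G)"
  show "\<exists>n H. H 0 = {\<one>} \<and> H n = carrier G \<and> (\<forall>i\<le>n. subgroup (H i) G) \<and>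
      (\<forall>i<n. H i \<subseteq> H (Suc i) \<and>
        commutator_subgroup G (H (Suc i)) (carrier G) \<subseteq> power_subgroup G (H i) p)"
  proof (intro exI[of _ "Suc N"] exI[of _ K] conjI allI impI)
    have "a [^] (p ^ N * k) = \<one>" for k
      using N[OF a] by (metis a nat_pow_one nat_pow_pow)
    then show "K 0 = {\<one>}" unfolding K_def by auto
    show "K (Suc N) = carrier G" by (simp add: K_def)
    show "subgroup (K i) G" for i
      unfolding K_def using subgroup_powers[OF a] subgroup_self by simp
    fix i assume i: "i < Suc N"
    show "K i \<subseteq> K (Suc i)"
    proof (cases "Suc i \<le> N")
      case True
      have "a [^] (p ^ (N - i) * k) = a [^] (p ^ (N - Suc i) * (p * k))" for k
        using True by (simp add: Suc_diff_Suc[symmetric] mult_ac del: Suc_diff_Suc)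
      then show ?thesis unfolding K_def using True by auto
    qed (auto simp: K_def)
    show "commutator_subgroup G (K (Suc i)) (carrier G) \<subseteq> power_subgroup G (K i) p"
    proof (cases "Suc i \<le> N")
      case True
      then have Ni: "N - i = Suc (N - Suc i)" by simp
      have "inv x \<otimes> inv y \<otimes> x \<otimes> y \<in> {x [^] p | x. x \<in> K i}"
        if x: "x \<in> K (Suc i)" and y: "y \<in> carrier G" for x y
      proof -
        obtain k where x: "x = a [^] (p ^ (N - Suc i) * k)"
          using x True unfolding K_def by auto
        obtain c where "inv x \<otimes> inv y \<otimes> x \<otimes> y = a [^] (p ^ (N - Suc i) * k * p ^ r * c)"
          using commutator_of_power[OF y] unfolding x by blast
        also have "p ^ (N - Suc i) * k * p ^ r * c = p ^ (N - i) * (k * p ^ d * c) * p"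
          unfolding Ni by (simp add: d power_add mult_ac)
        also have "a [^] \<dots> = (a [^] (p ^ (N - i) * (k * p ^ d * c))) [^] p"
          by (simp only: nat_pow_pow[OF a])
        finally show ?thesis unfolding K_def using i by auto
      qed
      then show ?thesis
        unfolding commutator_subgroup_def power_subgroup_def
        by (intro mono_generate) auto
    next
      case False
      then have iN: "i = N" using i by simp
      have "a [^] (p ^ r * k) \<in> {x [^] p | x. x \<in> K i}" for k
      proof -
        have "a [^] (p ^ r * k) = (a [^] (p ^ (d + 1) * k)) [^] p"
          by (simp add: nat_pow_pow d power_add mult_ac)
        moreover have "a [^] (p ^ (d + 1) * k) \<in> K i" unfolding K_def iN by auto
        ultimately show ?thesis by blast
      qed
      then have "{a [^] (p ^ r * k) | k. True} \<subseteq> power_subgroup G (K i) p"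
        unfolding power_subgroup_def by (auto intro: generate.incl)
      moreover have "K (Suc i) = carrier G" by (simp add: K_def iN)
      ultimately show ?thesis using commutator_subgroup_le by auto
    qed
  qed
qed

lemma comm_group_iff: "comm_group G \<longleftrightarrow> a [^] (p ^ r) = \<one>"
proof
  assume "comm_group G"
  then have "b \<otimes> a = b \<otimes> a [^] (1 + p ^ r)"
    using rel comm_groupE(4)[OF _ a b] by simp
  then have "a = a [^] (1 + p ^ r)" by simp
  also have "\<dots> = a \<otimes> a [^] (p ^ r)"
    by (simp only: nat_pow_mult[OF a, symmetric] nat_pow_eone a)
  finally show "a [^] (p ^ r) = \<one>"
    by (metis a l_cancel nat_pow_closed one_closed r_one)
next
  assume 1: "a [^] (p ^ r) = \<one>"
  have "a \<otimes> b = b \<otimes> a [^] (1::nat)"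
    unfolding rel nat_pow_mult[OF a, symmetric] by (simp add: 1)
  note nf = normal_form_mult[OF a b this]
  show "comm_group G"
  proof (rule group_comm_groupI)
    fix x y assume "x \<in> carrier G" "y \<in> carrier G"
    then obtain i j i' j' :: nat where "x = b [^] j \<otimes> a [^] i" "y = b [^] j' \<otimes> a [^] i'"
      by (metis normal_formE)
    then show "x \<otimes> y = y \<otimes> x" by (simp add: nf add.commute)
  qed
qed

lemma two_generated: "two_generated G"
  unfolding two_generated_def using gen by (intro bexI[of _ a] bexI[of _ b]) simp_all

end

section \<open>The centre and the quotient by \<open>Z(G)\<^sup>p\<close>\<close>

text \<open>The parameter \<open>e\<close> measures the failure of commutativity:
  \<open>[a, b] = a^(p^r)\<close> has order \<open>p^e\<close>, and \<open>e = 0\<close> means that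
  the group is abelian.\<close>

locale metacyclic_ord = metacyclic +
  fixes e :: nat
  assumes ord_a: "ord a = p ^ (r + e)"
begin

lemma pow_a_eq_one_iff: "a [^] n = \<one> \<longleftrightarrow> p ^ (r + e) dvd n" for n :: nat
  by (simp add: pow_eq_id ord_a)

lemma pow_a_add_eq_iff: "a [^] (i + n) = a [^] i \<longleftrightarrow> p ^ (r + e) dvd n" for i n :: nat
proof -
  have "a [^] (i + n) = a [^] i \<otimes> a [^] n" by (simp add: nat_pow_mult)
  then show ?thesis by (simp add: pow_a_eq_one_iff[symmetric])
qed

lemma pow_a_comm_b_iff: "a [^] i \<otimes> b = b \<otimes> a [^] i \<longleftrightarrow> p ^ e dvd i" for i :: nat
proof -
  have "a [^] i \<otimes> b = b \<otimes> a [^] (i + i * p ^ r)"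
    using pow_conj_pow[OF a b rel, of i 1] by simp
  then have "a [^] i \<otimes> b = b \<otimes> a [^] i \<longleftrightarrow> p ^ (r + e) dvd i * p ^ r"
    by (simp add: pow_a_add_eq_iff)
  then show ?thesis
    using p_gt_1 by (simp add: power_add mult.commute)
qed

text \<open>Conjugation by \<open>b^j\<close> fixes \<open>a\<close> exactly if
  \<open>(1 + p^r)^j\<close> is 1 modulo the order \<open>p^(r+e)\<close> of \<open>a\<close>; the
  valuation computation turns this into \<open>p^e dvd j\<close>.\<close>

lemma pow_b_comm_a_iff: "a \<otimes> b [^] j = b [^] j \<otimes> a \<longleftrightarrow> p ^ e dvd j" for j :: nat
proof -
  define n where "n = (1 + p ^ r) ^ j - 1"
  have n: "(1 + p ^ r) ^ j = 1 + n" by (simp add: n_def)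
  have "a \<otimes> b [^] j = b [^] j \<otimes> a [^] (1 + n)"
    using pow_conj_pow[OF a b rel, of 1 j] unfolding n by simp
  then have "a \<otimes> b [^] j = b [^] j \<otimes> a \<longleftrightarrow> a [^] (1 + n) = a [^] (1 :: nat)"
    by simp
  also have "\<dots> \<longleftrightarrow> p ^ e dvd j"
    unfolding pow_a_add_eq_iff n_def
    using prime_power_dvd_one_plus_power_diff_iff[OF prime r] by simp
  finally show ?thesis .
qed

text \<open>An element that is a power of both generators commutes with both. This is the control
  over the intersection of the two cyclic subgroups that holds in every such group, whatever the
  order of \<open>b\<close>.\<close>

lemma pow_a_eq_pow_bD:
  fixes i j :: nat
  assumes "a [^] i = b [^] j"
  shows "p ^ e dvd i" "p ^ e dvd j"
proof -
  have "b \<otimes> b [^] j = b [^] j \<otimes> b" "a \<otimes> a [^] i = a [^] i \<otimes> a"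
    using nat_pow_Suc2[OF b] nat_pow_Suc2[OF a] by simp_all
  then show "p ^ e dvd i" "p ^ e dvd j"
    using pow_a_comm_b_iff[of i] pow_b_comm_a_iff[of j] assms by simp_all
qed

text \<open>Commuting with \<open>b\<close> tests only the factor \<open>a^i\<close>, and commuting
  with \<open>a\<close> only the factor \<open>b^j\<close>, since the other factor commutes anyway
  and cancels. Conversely, exponents divisible by \<open>p^e\<close> leave no trace in the normal
  form of a product, as exponents of \<open>a\<close> count modulo \<open>p^(r+e)\<close>.\<close>

lemma centre_eq: "centre G = {b [^] (p ^ e * j) \<otimes> a [^] (p ^ e * i) | i j. True}"
proof (intro equalityI subsetI)
  fix z assume z: "z \<in> centre G"
  then obtain i j :: nat where ij: "z = b [^] j \<otimes> a [^] i"
    using normal_formE centre_closed by metis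
  have "b [^] j \<otimes> (a [^] i \<otimes> b) = b \<otimes> z"
    using centre_comm[OF z b] by (simp add: ij m_assoc)
  also have "\<dots> = b [^] j \<otimes> (b \<otimes> a [^] i)"
    unfolding ij using nat_pow_Suc2[OF b, of j] by (simp add: m_assoc[symmetric])
  finally have "p ^ e dvd i" using pow_a_comm_b_iff[of i] by simp
  moreover have "(a \<otimes> b [^] j) \<otimes> a [^] i = z \<otimes> a"
    using centre_comm[OF z a] by (simp add: ij m_assoc)
  then have "(a \<otimes> b [^] j) \<otimes> a [^] i = (b [^] j \<otimes> a) \<otimes> a [^] i"
    unfolding ij using nat_pow_Suc2[OF a, of i] by (simp add: m_assoc)
  then have "p ^ e dvd j" using pow_b_comm_a_iff[of j] by simp
  ultimately show "z \<in> {b [^] (p ^ e * j) \<otimes> a [^] (p ^ e * i) | i j. True}"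
    unfolding ij by (elim dvdE) blast
next
  fix z assume "z \<in> {b [^] (p ^ e * j) \<otimes> a [^] (p ^ e * i) | i j. True}"
  then obtain i j where z: "z = b [^] (p ^ e * j) \<otimes> a [^] (p ^ e * i)" by blast
  show "z \<in> centre G"
    unfolding centre_def
  proof (intro CollectI conjI ballI)
    show "z \<in> carrier G" by (simp add: z)
    fix g assume "g \<in> carrier G"
    then obtain i' j' :: nat where g: "g = b [^] j' \<otimes> a [^] i'" by (rule normal_formE)
    have ex: "\<exists>c. (1 + p ^ r) ^ j = 1 + p ^ r * c" for j
    proof -
      obtain s where "(1 + p ^ r) ^ j = 1 + j * p ^ r + (p ^ r)\<^sup>2 * s"
        using one_plus_power_expand by blast
      then have "(1 + p ^ r) ^ j = 1 + p ^ r * (j + p ^ r * s)"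
        by (simp add: algebra_simps power2_eq_square)
      then show ?thesis by blast
    qed
    obtain c where c: "(1 + p ^ r) ^ j' = 1 + p ^ r * c" using ex by blast
    have add: "a [^] (i + p ^ (r + e) * n) = a [^] i" for i n :: nat
      unfolding pow_a_add_eq_iff by simp
    have "p ^ e * i * (1 + p ^ r) ^ j' + i' = (p ^ e * i + i') + p ^ (r + e) * (i * c)"
      unfolding c by (simp add: algebra_simps power_add)
    then have zg: "z \<otimes> g = b [^] (p ^ e * j + j') \<otimes> a [^] (p ^ e * i + i')"
      unfolding z g normal_form_mult' by (simp only: add)
    have "p ^ (r + e) dvd (1 + p ^ r) ^ (p ^ e * j) - 1"
      using prime_power_dvd_one_plus_power_diff_iff[OF prime r] by simp
    then obtain d where "(1 + p ^ r) ^ (p ^ e * j) - 1 = p ^ (r + e) * d" by (elim dvdE)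
    then have d: "(1 + p ^ r) ^ (p ^ e * j) = 1 + p ^ (r + e) * d"
      by (metis One_nat_def Suc_pred le_add1 less_eq_Suc_le one_le_power plus_1_eq_Suc)
    have "i' * (1 + p ^ r) ^ (p ^ e * j) + p ^ e * i = (p ^ e * i + i') + p ^ (r + e) * (d * i')"
      unfolding d by (simp add: algebra_simps)
    then have gz: "g \<otimes> z = b [^] (p ^ e * j + j') \<otimes> a [^] (p ^ e * i + i')"
      unfolding z g normal_form_mult' by (simp only: add add.commute[of j'])
    show "z \<otimes> g = g \<otimes> z" unfolding zg gz ..
  qed
qed

text \<open>The factor \<open>b^(p^e j)\<close> is itself central, so the \<open>p\<close>-th power
  can be taken factor by factor.\<close>

lemma centre_power_eq:
  "power_subgroup G (centre G) p = {b [^] (p ^ (e + 1) * j) \<otimes> a [^] (p ^ (e + 1) * i) | i j. True}"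
proof -
  have pow: "(b [^] (p ^ e * j) \<otimes> a [^] (p ^ e * i)) [^] p
      = b [^] (p ^ (e + 1) * j) \<otimes> a [^] (p ^ (e + 1) * i)" for i j
  proof -
    have "b [^] (p ^ e * j) \<otimes> a [^] (p ^ e * 0) \<in> centre G"
      unfolding centre_eq by blast
    then have "b [^] (p ^ e * j) \<otimes> a [^] (p ^ e * i) = a [^] (p ^ e * i) \<otimes> b [^] (p ^ e * j)"
      using centre_comm[of "b [^] (p ^ e * j)" G "a [^] (p ^ e * i)"] by simp
    then have "(b [^] (p ^ e * j) \<otimes> a [^] (p ^ e * i)) [^] p
        = (b [^] (p ^ e * j)) [^] p \<otimes> (a [^] (p ^ e * i)) [^] p"
      by (rule pow_mult_distrib) simp_all
    then show ?thesis by (simp add: nat_pow_pow mult_ac)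
  qed
  show ?thesis
    unfolding power_subgroup_centre
  proof (intro equalityI subsetI)
    fix x assume "x \<in> {z [^] p | z. z \<in> centre G}"
    then obtain z where "z \<in> centre G" and x: "x = z [^] p" by blast
    then obtain i j where "z = b [^] (p ^ e * j) \<otimes> a [^] (p ^ e * i)"
      unfolding centre_eq by blast
    then have "x = b [^] (p ^ (e + 1) * j) \<otimes> a [^] (p ^ (e + 1) * i)"
      using x pow by (simp only:)
    then show "x \<in> {b [^] (p ^ (e + 1) * j) \<otimes> a [^] (p ^ (e + 1) * i) | i j. True}" by blast
  next
    fix x assume "x \<in> {b [^] (p ^ (e + 1) * j) \<otimes> a [^] (p ^ (e + 1) * i) | i j. True}"
    then obtain i j where "x = b [^] (p ^ (e + 1) * j) \<otimes> a [^] (p ^ (e + 1) * i)" by blast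
    then have "x = (b [^] (p ^ e * j) \<otimes> a [^] (p ^ e * i)) [^] p"
      using pow by (simp only:)
    moreover have "b [^] (p ^ e * j) \<otimes> a [^] (p ^ e * i) \<in> centre G"
      unfolding centre_eq by blast
    ultimately show "x \<in> {z [^] p | z. z \<in> centre G}" by blast
  qed
qed

end

locale metacyclic_quotient = metacyclic_ord +
  fixes H :: "('c, 'd) monoid_scheme" and f
  assumes H: "group H" and f: "f \<in> hom G H" and f_img: "f ` carrier G = carrier H"
    and ker_f: "kernel G H f = power_subgroup G (centre G) p"
begin

sublocale f: group_hom G H f
  using H f by (simp add: group_homI is_group)

lemma f_one_iff:
  assumes "x \<in> carrier G"
  shows "f x = \<one>\<^bsub>H\<^esub> \<longleftrightarrow> (\<exists>i j. x = b [^] (p ^ (e + 1) * j) \<otimes> a [^] (p ^ (e + 1) * i))"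
proof -
  have "f x = \<one>\<^bsub>H\<^esub> \<longleftrightarrow> x \<in> kernel G H f" using assms by (simp add: kernel_def)
  then show ?thesis unfolding ker_f centre_power_eq by blast
qed

lemma metacyclic_img: "metacyclic H (f a) (f b) p r"
proof (intro metacyclic.intro metacyclic_axioms.intro H prime r)
  show "finite_p_group p H"
    using f.finite_p_group_img[OF prime p_group f_img] .
  show "generate H {f a, f b} = carrier H"
    using f.generate_img[of "{a, b}"] gen f_img by simp
  show "f a \<otimes>\<^bsub>H\<^esub> f b = f b \<otimes>\<^bsub>H\<^esub> f a [^]\<^bsub>H\<^esub> (1 + p ^ r)"
    using arg_cong[OF rel, of f] by (simp only: f.hom_mult f.hom_nat_pow a b nat_pow_closed)
qed simp_all

lemma img_pow_eq_one:
  "f a [^]\<^bsub>H\<^esub> (p ^ (e + 1)) = \<one>\<^bsub>H\<^esub>" "f b [^]\<^bsub>H\<^esub> (p ^ (e + 1)) = \<one>\<^bsub>H\<^esub>"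
proof -
  have "f (a [^] (p ^ (e + 1))) = \<one>\<^bsub>H\<^esub>"
    unfolding f_one_iff[OF nat_pow_closed[OF a]] by (intro exI[of _ 1] exI[of _ 0]) simp
  then show "f a [^]\<^bsub>H\<^esub> (p ^ (e + 1)) = \<one>\<^bsub>H\<^esub>" by (simp only: f.hom_nat_pow a)
  have "f (b [^] (p ^ (e + 1))) = \<one>\<^bsub>H\<^esub>"
    unfolding f_one_iff[OF nat_pow_closed[OF b]] by (intro exI[of _ 0] exI[of _ 1]) simp
  then show "f b [^]\<^bsub>H\<^esub> (p ^ (e + 1)) = \<one>\<^bsub>H\<^esub>" by (simp only: f.hom_nat_pow b)
qed

text \<open>Any divisibility forced by relations \<open>a\<^sup>i = b\<^sup>j\<close> in \<open>G\<close> descends to the quotient, as long as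
  it is implied by the exponent \<open>p\<^sup>e\<^sup>+\<^sup>1\<close> of the kernel.\<close>

lemma img_pow_eqD:
  fixes i j :: nat
  assumes "f a [^]\<^bsub>H\<^esub> i = f b [^]\<^bsub>H\<^esub> j" and "d dvd p ^ (e + 1)"
    and indep: "\<And>i j :: nat. a [^] i = b [^] j \<Longrightarrow> d dvd i \<and> d dvd j"
  shows "d dvd i \<and> d dvd j"
proof -
  have "f (inv (b [^] j) \<otimes> a [^] i) = \<one>\<^bsub>H\<^esub>"
    using assms(1) by (simp add: f.hom_nat_pow)
  then obtain k l where kl: "inv (b [^] j) \<otimes> a [^] i
      = b [^] (p ^ (e + 1) * l) \<otimes> a [^] (p ^ (e + 1) * k)"
    using f_one_iff[of "inv (b [^] j) \<otimes> a [^] i"] by auto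
  obtain A where A: "\<And>i::nat. inv (a [^] i) = a [^] (i * A)"
    using inv_powE[OF a] by blast
  have "a [^] i = b [^] j \<otimes> (inv (b [^] j) \<otimes> a [^] i)"
    by (simp add: m_assoc[symmetric])
  also have "\<dots> = b [^] (j + p ^ (e + 1) * l) \<otimes> a [^] (p ^ (e + 1) * k)"
    unfolding kl by (simp only: m_assoc[symmetric] nat_pow_mult a b nat_pow_closed)
  finally have "a [^] i \<otimes> inv (a [^] (p ^ (e + 1) * k)) = b [^] (j + p ^ (e + 1) * l)"
    by (simp add: m_assoc)
  then have "a [^] (i + p ^ (e + 1) * k * A) = b [^] (j + p ^ (e + 1) * l)"
    unfolding A by (simp only: nat_pow_mult a)
  then have "d dvd i + p ^ (e + 1) * k * A \<and> d dvd j + p ^ (e + 1) * l"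
    by (rule indep)
  moreover have "d dvd p ^ (e + 1) * k * A" "d dvd p ^ (e + 1) * l"
    using assms(2) by (simp_all only: dvd_mult2)
  ultimately show ?thesis by (simp only: dvd_add_left_iff)
qed

text \<open>The hypothesis asks for one factor \<open>p\<close> more than
  \<open>pow_a_eq_pow_bD\<close> provides. With it, \<open>p^(e+1)\<close> is both the exponent of
  the images of \<open>a\<close> and \<open>b\<close> and the modulus of independence, so the normal
  forms below it are pairwise distinct.\<close>

lemma card_img:
  assumes "\<And>i j :: nat. a [^] i = b [^] j \<Longrightarrow> p ^ (e + 1) dvd i \<and> p ^ (e + 1) dvd j"
  shows "card (carrier H) = p ^ (e + 1) * p ^ (e + 1)"
proof -
  interpret H: metacyclic H "f a" "f b" p r by (rule metacyclic_img)
  show ?thesis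
    unfolding H.gen[symmetric]
  proof (rule f.H.card_generate_normal_form[OF H.a H.b H.rel img_pow_eq_one])
    show "0 < p ^ (e + 1)" using p_gt_1 by simp
    fix i j :: nat assume "f a [^]\<^bsub>H\<^esub> i = f b [^]\<^bsub>H\<^esub> j"
    then show "p ^ (e + 1) dvd i \<and> p ^ (e + 1) dvd j"
      by (rule img_pow_eqD[OF _ dvd_refl]) (rule assms)
  qed
qed

end

section \<open>The groups \<open>G(n, m, r)\<close>\<close>

definition eval_letter :: "('a, 'b) monoid_scheme \<Rightarrow> ('x \<Rightarrow> 'a) \<Rightarrow> 'x \<times> bool \<Rightarrow> 'a" where
  "eval_letter H f l = (if snd l then inv\<^bsub>H\<^esub> (f (fst l)) else f (fst l))"

definition eval_word :: "('a, 'b) monoid_scheme \<Rightarrow> ('x \<Rightarrow> 'a) \<Rightarrow> 'x gword \<Rightarrow> 'a" where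
  "eval_word H f w = foldr (\<lambda>l y. eval_letter H f l \<otimes>\<^bsub>H\<^esub> y) w \<one>\<^bsub>H\<^esub>"

lemma eval_word_simps [simp]:
  "eval_word H f [] = \<one>\<^bsub>H\<^esub>"
  "eval_word H f (l # w) = eval_letter H f l \<otimes>\<^bsub>H\<^esub> eval_word H f w"
  by (simp_all add: eval_word_def)

context group
begin

lemma eval_letter_closed [simp]: "(\<And>x. f x \<in> carrier G) \<Longrightarrow> eval_letter G f l \<in> carrier G"
  by (simp add: eval_letter_def)

lemma eval_word_closed [simp]: "(\<And>x. f x \<in> carrier G) \<Longrightarrow> eval_word G f w \<in> carrier G"
  by (induction w) auto

lemma eval_word_append:
  "(\<And>x. f x \<in> carrier G) \<Longrightarrow> eval_word G f (v @ w) = eval_word G f v \<otimes> eval_word G f w"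
  by (induction v) (auto simp: m_assoc)

lemma eval_word_replicate:
  "(\<And>x. f x \<in> carrier G) \<Longrightarrow> eval_word G f (replicate n (x, False)) = f x [^] n"
  by (induction n) (auto simp: eval_letter_def nat_pow_Suc2[symmetric])

lemma eval_word_eq:
  assumes "\<And>x. f x \<in> carrier G" "\<And>u v. (u, v) \<in> R \<Longrightarrow> eval_word G f u = eval_word G f v"
    and "word_eq R u v"
  shows "eval_word G f u = eval_word G f v"
  using assms(3)
proof (induction rule: word_eq.induct)
  case (word_eq_cancel x s)
  then show ?case using assms(1) by (cases s) (auto simp: eval_letter_def)
qed (use assms in \<open>auto simp: eval_word_append\<close>)

text \<open>This is von Dyck's theorem: evaluation of words respects the relations, so it does not
  depend on the word chosen to represent a class.\<close>

lemma presented_group_hom: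
  assumes "\<And>x. f x \<in> carrier G" "\<And>u v. (u, v) \<in> R \<Longrightarrow> eval_word G f u = eval_word G f v"
  shows "\<exists>h\<in>hom (presented_group R) G. \<forall>w. h (word_class R w) = eval_word G f w"
proof -
  define h where "h = (\<lambda>C. eval_word G f (SOME u. C = word_class R u))"
  have h: "h (word_class R w) = eval_word G f w" for w
  proof -
    have "word_class R w = word_class R (SOME u. word_class R w = word_class R u)"
      by (rule someI[of _ w]) simp
    then show ?thesis
      unfolding h_def using eval_word_eq[OF assms] word_class_eq_iff by metis
  qed
  have "h \<in> hom (presented_group R) G"
  proof (rule homI)
    fix C assume "C \<in> carrier (presented_group R)"
    then obtain u where u: "C = word_class R u" by (auto simp: presented_group_def)
    show "h C \<in> carrier G" unfolding u h using assms(1) by simp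
    fix D assume "D \<in> carrier (presented_group R)"
    then obtain v where v: "D = word_class R v" by (auto simp: presented_group_def)
    show "h (C \<otimes>\<^bsub>presented_group R\<^esub> D) = h C \<otimes> h D"
      unfolding u v h presented_group_mult using assms(1) by (simp add: eval_word_append)
  qed
  then show ?thesis using h by blast
qed

end

text \<open>The relators of the diagonal case \<open>m = n\<close>, the only one among the groups
  with grandparents.\<close>

definition G_rels :: "nat \<Rightarrow> nat \<Rightarrow> nat \<Rightarrow> (gen gword \<times> gen gword) set" where
  "G_rels p n r =
     {(replicate (p ^ n) (GenA, False), []),
      (replicate (p ^ n) (GenB, False), []),
      ([(GenA, True), (GenB, True), (GenA, False), (GenB, False)],
       replicate (p ^ r) (GenA, False))}"

definition gen_class :: "nat \<Rightarrow> nat \<Rightarrow> nat \<Rightarrow> gen \<Rightarrow> gen gword set" where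
  "gen_class p n r x = word_class (G_rels p n r) [(x, False)]"

lemma G_group_eq: "G_group p n n r = presented_group (G_rels p n r)"
  by (simp add: G_group_def G_rels_def)

lemma group_G_group: "group (G_group p n m r)"
  by (simp add: G_group_def group_presented_group)

lemma gen_class_closed: "gen_class p n r x \<in> carrier (G_group p n n r)"
  by (simp add: G_group_eq gen_class_def presented_group_def)

lemma word_class_pow:
  "word_class R [(x, False)] [^]\<^bsub>presented_group R\<^esub> (n::nat)
      = word_class R (replicate n (x, False))"
proof (induction n)
  case 0
  show ?case by (simp add: presented_group_def)
next
  case (Suc n)
  then show ?case
    by (simp add: presented_group_mult replicate_append_same)
qed

lemma gen_class_pow_eq_one: "gen_class p n r x [^]\<^bsub>G_group p n n r\<^esub> (p ^ n) = \<one>\<^bsub>G_group p n n r\<^esub>"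
proof -
  have "word_eq (G_rels p n r) (replicate (p ^ n) (x, False)) []"
    by (rule word_eq_relation) (cases x; simp add: G_rels_def)
  then have "word_class (G_rels p n r) (replicate (p ^ n) (x, False))
      = word_class (G_rels p n r) []"
    by (simp add: word_class_eq_iff)
  then show ?thesis
    unfolding gen_class_def G_group_eq word_class_pow by (simp add: presented_group_def)
qed

lemma word_class_inv: "inv\<^bsub>presented_group R\<^esub> word_class R [(x, s)] = word_class R [(x, \<not> s)]"
proof (rule group.inv_equality[OF group_presented_group])
  have "word_class R [(x, \<not> s), (x, s)] = word_class R []"
    using word_eq_cancel[of R x "\<not> s"] by (simp add: word_class_eq_iff)
  then show "word_class R [(x, \<not> s)] \<otimes>\<^bsub>presented_group R\<^esub> word_class R [(x, s)]
      = \<one>\<^bsub>presented_group R\<^esub>"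
    by (simp add: presented_group_mult) (simp add: presented_group_def)
qed (simp_all add: presented_group_def)

text \<open>The commutator relation solved for \<open>a \<otimes> b\<close>, which is the shape in
  which the normal form lemmas take it.\<close>

lemma gen_class_rel:
  "gen_class p n r GenA \<otimes>\<^bsub>G_group p n n r\<^esub> gen_class p n r GenB
    = gen_class p n r GenB \<otimes>\<^bsub>G_group p n n r\<^esub> gen_class p n r GenA [^]\<^bsub>G_group p n n r\<^esub> (1 + p ^ r)"
proof -
  let ?R = "G_rels p n r" and ?G = "G_group p n n r"
  let ?a = "gen_class p n r GenA" and ?b = "gen_class p n r GenB"
  interpret group ?G by (rule group_G_group)
  note c = gen_class_closed[of p n r]
  have "word_class ?R [(GenA, True), (GenB, True), (GenA, False), (GenB, False)]
      = word_class ?R (replicate (p ^ r) (GenA, False))"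
    unfolding word_class_eq_iff by (rule word_eq_relation) (simp add: G_rels_def)
  moreover have "inv\<^bsub>?G\<^esub> gen_class p n r x = word_class ?R [(x, True)]" for x
    unfolding G_group_eq gen_class_def word_class_inv by simp
  ultimately have "inv\<^bsub>?G\<^esub> ?a \<otimes>\<^bsub>?G\<^esub> (inv\<^bsub>?G\<^esub> ?b \<otimes>\<^bsub>?G\<^esub> (?a \<otimes>\<^bsub>?G\<^esub> ?b)) = ?a [^]\<^bsub>?G\<^esub> (p ^ r)"
    by (simp add: G_group_eq gen_class_def word_class_pow presented_group_mult)
  then have "inv\<^bsub>?G\<^esub> (?b \<otimes>\<^bsub>?G\<^esub> ?a) \<otimes>\<^bsub>?G\<^esub> (?a \<otimes>\<^bsub>?G\<^esub> ?b) = ?a [^]\<^bsub>?G\<^esub> (p ^ r)"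
    using c by (simp add: inv_mult_group m_assoc)
  then have "?a \<otimes>\<^bsub>?G\<^esub> ?b = (?b \<otimes>\<^bsub>?G\<^esub> ?a) \<otimes>\<^bsub>?G\<^esub> ?a [^]\<^bsub>?G\<^esub> (p ^ r)"
    using c by (metis inv_solve_left m_closed nat_pow_closed)
  also have "\<dots> = ?b \<otimes>\<^bsub>?G\<^esub> ?a [^]\<^bsub>?G\<^esub> (1 + p ^ r)"
    using c by (simp only: m_assoc nat_pow_closed nat_pow_mult[symmetric] nat_pow_eone)
  finally show ?thesis .
qed

lemma gen_class_generate:
  "generate (G_group p n n r) {gen_class p n r GenA, gen_class p n r GenB}
      = carrier (G_group p n n r)"
    (is "generate ?G ?S = _")
proof
  interpret group ?G by (rule group_G_group)
  show "generate ?G ?S \<subseteq> carrier ?G"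
    using gen_class_closed by (intro generate_incl) auto
  have letter: "word_class (G_rels p n r) [(x, s)] \<in> generate ?G ?S" for x s
  proof -
    have x: "gen_class p n r x \<in> ?S" by (cases x) simp_all
    show ?thesis
    proof (cases s)
      case True
      then have "word_class (G_rels p n r) [(x, s)] = inv\<^bsub>?G\<^esub> gen_class p n r x"
        by (simp add: gen_class_def G_group_eq word_class_inv)
      then show ?thesis using generate.inv[OF x, of ?G] by simp
    next
      case False
      then show ?thesis using generate.incl[OF x, of ?G] by (simp add: gen_class_def)
    qed
  qed
  have "word_class (G_rels p n r) w \<in> generate ?G ?S" for w
  proof (induction w)
    case Nil
    show ?case using generate.one[of ?G ?S] by (simp add: G_group_eq presented_group_def)
  next
    case (Cons l w)
    obtain x s where l: "l = (x, s)" by fastforce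
    have "word_class (G_rels p n r) (l # w)
        = word_class (G_rels p n r) [(x, s)] \<otimes>\<^bsub>?G\<^esub> word_class (G_rels p n r) w"
      by (simp add: G_group_eq presented_group_mult l)
    then show ?case using generate.eng[OF letter[of x s] Cons] by simp
  qed
  then show "carrier ?G \<subseteq> generate ?G ?S"
    by (auto simp: G_group_eq presented_group_def)
qed

lemma (in group) G_group_hom:
  assumes ab: "a \<in> carrier G" "b \<in> carrier G" "a [^] (p ^ n) = \<one>" "b [^] (p ^ n) = \<one>"
    "a \<otimes> b = b \<otimes> a [^] (1 + p ^ r)"
  shows "\<exists>h\<in>hom (G_group p n n r) G. h (gen_class p n r GenA) = a \<and> h (gen_class p n r GenB) = b"
proof -
  define f where "f = case_gen a b"
  have f: "f x \<in> carrier G" for x using ab by (cases x) (simp_all add: f_def)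
  have "inv a \<otimes> (inv b \<otimes> (a \<otimes> b)) = inv (b \<otimes> a) \<otimes> (a \<otimes> b)"
    using ab(1,2) by (simp add: inv_mult_group m_assoc)
  also have "\<dots> = inv (b \<otimes> a) \<otimes> ((b \<otimes> a) \<otimes> a [^] (p ^ r))"
    unfolding ab(5) using ab(1,2) by (simp only: m_assoc nat_pow_closed nat_pow_mult[symmetric] nat_pow_eone)
  also have "\<dots> = a [^] (p ^ r)"
    using ab(1,2) inv_mult_cancel[of "b \<otimes> a" \<one> "a [^] (p ^ r)"] by simp
  finally have comm: "inv a \<otimes> (inv b \<otimes> (a \<otimes> b)) = a [^] (p ^ r)" .
  have "\<exists>h\<in>hom (presented_group (G_rels p n r)) G. \<forall>w. h (word_class (G_rels p n r) w)
      = eval_word G f w"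
  proof (rule presented_group_hom[OF f])
    fix u v assume "(u, v) \<in> G_rels p n r"
    then show "eval_word G f u = eval_word G f v"
      using ab comm f unfolding G_rels_def
      by (elim insertE) (simp_all add: eval_word_replicate, simp_all add: f_def eval_letter_def)
  qed
  then obtain h where h: "h \<in> hom (G_group p n n r) G"
    "\<And>w. h (word_class (G_rels p n r) w) = eval_word G f w"
    unfolding G_group_eq by blast
  have "h (gen_class p n r x) = f x" for x
    unfolding gen_class_def h(2) using f by (simp add: eval_letter_def)
  then show ?thesis using h(1) by (intro bexI[of _ h]) (simp_all add: f_def)
qed

text \<open>The relations allow every word to be collected to \<open>b^j a^i\<close> with reduced
  exponents. Distinctness of these forms is not claimed here; it comes from comparison with a group
  of known order.\<close>

lemma card_G_group_le:
  assumes "0 < p"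
  shows "finite (carrier (G_group p n n r))" "card (carrier (G_group p n n r)) \<le> p ^ n * p ^ n"
proof -
  interpret group "G_group p n n r" by (rule group_G_group)
  have eq: "carrier (G_group p n n r)
    = (\<lambda>(j, i). gen_class p n r GenB [^]\<^bsub>G_group p n n r\<^esub> j \<otimes>\<^bsub>G_group p n n r\<^esub>
          gen_class p n r GenA [^]\<^bsub>G_group p n n r\<^esub> i) ` ({..<p ^ n} \<times> {..<p ^ n})"
    unfolding gen_class_generate[symmetric]
    by (rule generate_normal_form_image[OF gen_class_closed gen_class_closed gen_class_rel])
      (simp_all add: gen_class_pow_eq_one assms)
  show "finite (carrier (G_group p n n r))" unfolding eq by simp
  have "card ({..<p ^ n} \<times> {..<p ^ n}) = p ^ n * p ^ n" by (simp add: card_cartesian_product)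
  then show "card (carrier (G_group p n n r)) \<le> p ^ n * p ^ n"
    unfolding eq by (metis card_image_le finite_SigmaI finite_lessThan)
qed

text \<open>The map from the presentation is onto because its image contains the generators. The
  source has at most as many elements as the target, so the map is bijective.\<close>

lemma (in group) G_group_isoI:
  assumes "a \<in> carrier G" "b \<in> carrier G" "a [^] (p ^ n) = \<one>" "b [^] (p ^ n) = \<one>"
    "a \<otimes> b = b \<otimes> a [^] (1 + p ^ r)" "generate G {a, b} = carrier G" "0 < p"
    "card (carrier G) = p ^ n * p ^ n"
  shows "G_group p n n r \<cong> G"
proof -
  obtain h where h: "h \<in> hom (G_group p n n r) G"
    "h (gen_class p n r GenA) = a" "h (gen_class p n r GenB) = b"
    using G_group_hom[OF assms(1-5)] by blast
  interpret h: group_hom "G_group p n n r" G h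
    using group_homI[OF group_G_group is_group h(1)] .
  have "h ` carrier (G_group p n n r) = carrier G"
    using h.generate_img[of "{gen_class p n r GenA, gen_class p n r GenB}"] h(2,3) assms(6)
      gen_class_closed[of p n r] gen_class_generate[of p n r] by simp
  then show ?thesis
    using surj_hom_card_iso[OF h(1)] card_G_group_le[OF assms(7), of n r] assms(8) by simp
qed

section \<open>Powerfully nilpotent groups of rank two are metacyclic\<close>

context group
begin

text \<open>For generators of finite order the inverse is a power with natural exponent. The case of
  inverses therefore reduces to products, and only generators and products have to be
  treated.\<close>

lemma generate_torsion_induct:
  assumes "g \<in> generate G A" and A: "A \<subseteq> carrier G"
    and torsion: "\<And>x. x \<in> A \<Longrightarrow> \<exists>n>0. x [^] (n::nat) = \<one>"
    and one: "P \<one>" and base: "\<And>x. x \<in> A \<Longrightarrow> P x"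
    and mult: "\<And>x y. x \<in> carrier G \<Longrightarrow> y \<in> carrier G \<Longrightarrow> P x \<Longrightarrow> P y \<Longrightarrow> P (x \<otimes> y)"
  shows "P g"
  using assms(1)
proof (induction rule: generate.induct)
  case (inv x)
  then have x: "x \<in> carrier G" using A by blast
  have "P (x [^] n)" for n :: nat
    by (induction n) (use x one base[OF inv] mult in auto)
  then show ?case
    using torsion[OF inv] inv_pow_eq_pow[OF x, of _ 1] x by (metis nat_pow_eone)
qed (use one base mult generate_in_carrier[OF A] in auto)

lemma comm_group_of_generators:
  assumes "finite (carrier G)" "a \<in> carrier G" "b \<in> carrier G" "generate G {a, b} = carrier G"
    "a \<otimes> b = b \<otimes> a"
  shows "comm_group G"
proof -
  have rel: "a \<otimes> b = b \<otimes> a [^] (1::nat)" using assms by simp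
  have ord: "x [^] ord x = \<one>" "0 < ord x" if "x \<in> carrier G" for x
    using that ord_ge_1[OF assms(1) that] by simp_all
  have eq: "carrier G = {b [^] j \<otimes> a [^] i | (i::nat) (j::nat). True}"
    using generate_normal_form[OF assms(2,3) rel ord[OF assms(2)] ord[OF assms(3)]] assms(4) by simp
  show ?thesis
  proof (rule group_comm_groupI)
    fix x y assume "x \<in> carrier G" "y \<in> carrier G"
    then obtain i j i' j' :: nat where "x = b [^] j \<otimes> a [^] i" "y = b [^] j' \<otimes> a [^] i'"
      unfolding eq by blast
    then show "x \<otimes> y = y \<otimes> x"
      by (simp add: normal_form_mult[OF assms(2,3) rel] add.commute)
  qed
qed

lemma comm_quotientD:
  assumes "N \<lhd> G" "comm_group (G Mod N)" "g \<in> carrier G" "h \<in> carrier G"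
  shows "\<exists>n\<in>N. g \<otimes> h = h \<otimes> g \<otimes> n"
proof -
  interpret N: normal N G by fact
  have "(N #> g) <#> (N #> h) = (N #> h) <#> (N #> g)"
    using comm_groupE(4)[OF assms(2), of "N #> g" "N #> h"] assms(3,4)
    by (auto simp: FactGroup_def RCOSETS_def)
  then have "N #> (g \<otimes> h) = N #> (h \<otimes> g)"
    using assms by (simp add: N.rcos_sum)
  then have "g \<otimes> h \<in> (h \<otimes> g) <# N"
    using assms rcos_self[OF _ N.subgroup_axioms, of "g \<otimes> h"] N.coset_eq by simp
  then show ?thesis by (auto simp: l_coset_def)
qed

lemma generators_comm_modI:
  assumes "finite (carrier G)" "a \<in> carrier G" "b \<in> carrier G" "generate G {a, b} = carrier G"
    "N \<lhd> G" "n \<in> N" "a \<otimes> b = b \<otimes> a \<otimes> n"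
  shows "comm_group (G Mod N)"
proof -
  interpret N: normal N G by fact
  have h: "(\<lambda>x. N #> x) \<in> hom G (G Mod N)" by (rule N.r_coset_hom_Mod)
  interpret h: group_hom G "G Mod N" "\<lambda>x. N #> x"
    using group_homI[OF is_group N.factorgroup_is_group h] .
  have img: "(\<lambda>x. N #> x) ` carrier G = carrier (G Mod N)"
    by (auto simp: FactGroup_def RCOSETS_def)
  have n: "n \<in> carrier G" using assms(6) N.subset by blast
  have "N #> n = N"
    using n assms(6) by (simp add: coset_join2 N.subgroup_axioms)
  then have "N #> (b \<otimes> a \<otimes> n) = N #> (b \<otimes> a)"
    using assms(2,3) n h.hom_mult[of "b \<otimes> a" n] h.hom_closed[of "b \<otimes> a"] h.H.r_one
    by (simp only: m_closed) simp
  then have "(N #> a) \<otimes>\<^bsub>G Mod N\<^esub> (N #> b) = (N #> b) \<otimes>\<^bsub>G Mod N\<^esub> (N #> a)"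
    using assms(2,3,7) by (metis h.hom_mult)
  moreover have "generate (G Mod N) {N #> a, N #> b} = carrier (G Mod N)"
    using h.generate_img[of "{a, b}"] assms(2-4) img by simp
  moreover have "finite (carrier (G Mod N))"
    using assms(1) img by (metis finite_imageI)
  ultimately show ?thesis
    using group.comm_group_of_generators[OF N.factorgroup_is_group] h.hom_closed assms(2,3) by metis
qed

lemma subgroup_torsion_powers:
  assumes "x \<in> carrier G" "x [^] (n::nat) = \<one>" "0 < n"
  shows "subgroup {x [^] (k::nat) | k. True} G"
proof (rule subgroupI)
  fix y assume "y \<in> {x [^] (k::nat) | k. True}"
  then obtain k :: nat where y: "y = x [^] k" by blast
  show "inv y \<in> {x [^] (k::nat) | k. True}"
    unfolding y inv_pow_eq_pow[OF assms] by blast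
  fix w assume "w \<in> {x [^] (k::nat) | k. True}"
  then obtain l :: nat where w: "w = x [^] l" by blast
  show "y \<otimes> w \<in> {x [^] (k::nat) | k. True}"
    unfolding y w nat_pow_mult[OF assms(1)] by blast
qed (use assms in auto)

lemma pow_of_coprime_exponent:
  assumes "x \<in> carrier G" "x [^] (p ^ N) = \<one>" "Factorial_Ring.prime (p::nat)" "\<not> p dvd i"
  shows "\<exists>k::nat. (x [^] i) [^] k = x"
proof (cases "N = 0")
  case True
  then show ?thesis using assms by (intro exI[of _ 0]) simp
next
  case False
  have "coprime i (p ^ N)"
    using assms(3,4) by (metis coprime_commute coprime_power_right_iff prime_imp_coprime)
  then obtain k where k: "[i * k = 1] (mod p ^ N)"
    using cong_solve_coprime_nat by (metis One_nat_def)
  have "(x [^] i) [^] k = x [^] (i * k)" using assms(1) by (simp add: nat_pow_pow)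
  also have "\<dots> = x [^] (i * k mod p ^ N)" by (rule pow_mod_eq[OF assms(1,2), symmetric])
  also have "\<dots> = x [^] (1 mod p ^ N)" using k by (simp add: cong_def)
  also have "\<dots> = x [^] (1::nat)" by (rule pow_mod_eq[OF assms(1,2)])
  finally show ?thesis using assms(1) by auto
qed

end

text \<open>The case in which \<open>[G, G]\<close> has order \<open>p\<close> and is generated by a \<open>p\<close>-th power \<open>z = v\<^sup>p\<close> of a
  central element.\<close>

locale small_commutator = group G for G (structure) +
  fixes x y z v :: 'a and p N :: nat
  assumes prime: "Factorial_Ring.prime p" and fin: "finite (carrier G)"
    and exponent: "\<And>g. g \<in> carrier G \<Longrightarrow> g [^] (p ^ N) = \<one>"
    and x [simp]: "x \<in> carrier G" and y [simp]: "y \<in> carrier G"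
    and gen: "generate G {x, y} = carrier G"
    and v: "v \<in> centre G" and z_eq: "z = v [^] p" and z_neq: "z \<noteq> \<one>" and z_pow: "z [^] p = \<one>"
    and comm: "\<And>g h. g \<in> carrier G \<Longrightarrow> h \<in> carrier G \<Longrightarrow> \<exists>l::nat. g \<otimes> h = h \<otimes> g \<otimes> z [^] l"
    and noncomm: "\<not> comm_group G"
begin

lemma v_closed [simp]: "v \<in> carrier G"
  using v by (rule centre_closed)

lemma z_closed [simp]: "z \<in> carrier G"
  by (simp add: z_eq)

lemma p_pos: "0 < p"
  using prime prime_gt_0_nat by blast

lemma v_pow_comm: "g \<in> carrier G \<Longrightarrow> v [^] (l::nat) \<otimes> g = g \<otimes> v [^] l"
proof (induction l)
  case (Suc l)
  have "v [^] Suc l \<otimes> g = v [^] l \<otimes> (v \<otimes> g)" using Suc(2) by (simp add: m_assoc)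
  also have "\<dots> = (v [^] l \<otimes> g) \<otimes> v" using Suc(2) by (simp add: m_assoc centre_comm[OF v])
  also have "\<dots> = g \<otimes> v [^] Suc l" unfolding Suc(1)[OF Suc(2)] using Suc(2) by (simp add: m_assoc)
  finally show ?case .
qed simp

lemma z_pow_eq: "z [^] (l::nat) = v [^] (p * l)"
  by (simp add: z_eq nat_pow_pow)

lemma z_pow_comm: "g \<in> carrier G \<Longrightarrow> z [^] (l::nat) \<otimes> g = g \<otimes> z [^] l"
  unfolding z_pow_eq by (rule v_pow_comm)

text \<open>Interchanging letters costs only powers of \<open>z\<close>, and these are central. So
  the exponents of \<open>x\<close> and \<open>y\<close> simply add up, as in the abelian quotient
  by the powers of \<open>z\<close>.\<close>

lemma form_mult:
  "\<exists>t::nat. (y [^] (j::nat) \<otimes> x [^] (i::nat) \<otimes> z [^] (l::nat)) \<otimes>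
      (y [^] (j'::nat) \<otimes> x [^] (i'::nat) \<otimes> z [^] (l'::nat))
    = y [^] (j + j') \<otimes> x [^] (i + i') \<otimes> z [^] t"
proof -
  obtain t :: nat where t: "x [^] i \<otimes> y [^] j' = y [^] j' \<otimes> x [^] i \<otimes> z [^] t"
    using comm[of "x [^] i" "y [^] j'"] by auto
  have "(y [^] j \<otimes> x [^] i \<otimes> z [^] l) \<otimes> (y [^] j' \<otimes> x [^] i' \<otimes> z [^] l')
      = y [^] j \<otimes> x [^] i \<otimes> (z [^] l \<otimes> (y [^] j' \<otimes> x [^] i')) \<otimes> z [^] l'"
    by (simp add: m_assoc)
  also have "z [^] l \<otimes> (y [^] j' \<otimes> x [^] i') = (y [^] j' \<otimes> x [^] i') \<otimes> z [^] l"
    by (rule z_pow_comm) simp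
  also have "y [^] j \<otimes> x [^] i \<otimes> ((y [^] j' \<otimes> x [^] i') \<otimes> z [^] l) \<otimes> z [^] l'
      = y [^] j \<otimes> (x [^] i \<otimes> y [^] j') \<otimes> x [^] i' \<otimes> z [^] l \<otimes> z [^] l'"
    by (simp add: m_assoc)
  also have "\<dots> = y [^] j \<otimes> y [^] j' \<otimes> x [^] i \<otimes> (z [^] t \<otimes> x [^] i') \<otimes> z [^] l \<otimes> z [^] l'"
    unfolding t by (simp add: m_assoc)
  also have "\<dots> = (y [^] j \<otimes> y [^] j') \<otimes> (x [^] i \<otimes> x [^] i') \<otimes> (z [^] t \<otimes> z [^] l \<otimes> z [^] l')"
    unfolding z_pow_comm[OF nat_pow_closed[OF x]] by (simp add: m_assoc)
  also have "\<dots> = y [^] (j + j') \<otimes> x [^] (i + i') \<otimes> z [^] (t + l + l')"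
    by (simp add: nat_pow_mult)
  finally show ?thesis by blast
qed

lemma formE:
  assumes "g \<in> carrier G"
  obtains i j l :: nat where "g = y [^] j \<otimes> x [^] i \<otimes> z [^] l"
proof -
  have "g \<in> generate G {x, y}" using assms gen by simp
  then have "\<exists>(i::nat) (j::nat) (l::nat). g = y [^] j \<otimes> x [^] i \<otimes> z [^] l"
  proof (rule generate_torsion_induct)
    show "\<exists>n>0. g [^] (n::nat) = \<one>" if "g \<in> {x, y}" for g
      using that exponent p_pos by (intro exI[of _ "p ^ N"]) auto
    show "\<exists>(i::nat) (j::nat) (l::nat). \<one> = y [^] j \<otimes> x [^] i \<otimes> z [^] l"
      by (intro exI[of _ 0]) simp
    show "\<exists>(i::nat) (j::nat) (l::nat). g = y [^] j \<otimes> x [^] i \<otimes> z [^] l" if "g \<in> {x, y}" for g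
    proof (cases "g = x")
      case True
      then show ?thesis by (intro exI[of _ 1] exI[of _ 0]) simp
    next
      case False
      then have "g = y [^] (1::nat) \<otimes> x [^] (0::nat) \<otimes> z [^] (0::nat)" using that by simp
      then show ?thesis by blast
    qed
    fix g h
    assume "\<exists>(i::nat) (j::nat) (l::nat). g = y [^] j \<otimes> x [^] i \<otimes> z [^] l"
    then obtain i j l :: nat where g: "g = y [^] j \<otimes> x [^] i \<otimes> z [^] l" by blast
    assume "\<exists>(i::nat) (j::nat) (l::nat). h = y [^] j \<otimes> x [^] i \<otimes> z [^] l"
    then obtain i' j' l' :: nat where h: "h = y [^] j' \<otimes> x [^] i' \<otimes> z [^] l'" by blast
    show "\<exists>(i::nat) (j::nat) (l::nat). g \<otimes> h = y [^] j \<otimes> x [^] i \<otimes> z [^] l"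
      unfolding g h using form_mult by blast
  qed simp
  then show ?thesis using that by blast
qed

lemma form_pow:
  "\<exists>t::nat. (y [^] (j::nat) \<otimes> x [^] (i::nat)) [^] (n::nat)
      = y [^] (n * j) \<otimes> x [^] (n * i) \<otimes> z [^] t"
proof (induction n)
  case 0
  show ?case by (intro exI[of _ 0]) simp
next
  case (Suc n)
  then obtain t :: nat where t: "(y [^] j \<otimes> x [^] i) [^] n
      = y [^] (n * j) \<otimes> x [^] (n * i) \<otimes> z [^] t"
    by blast
  obtain t' :: nat where "(y [^] (n * j) \<otimes> x [^] (n * i) \<otimes> z [^] t) \<otimes> (y [^] j \<otimes> x [^] i \<otimes> z [^] (0::nat))
      = y [^] (n * j + j) \<otimes> x [^] (n * i + i) \<otimes> z [^] t'"
    using form_mult by blast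
  then have "(y [^] j \<otimes> x [^] i) [^] Suc n = y [^] (Suc n * j) \<otimes> x [^] (Suc n * i) \<otimes> z [^] t'"
    by (simp add: t add.commute)
  then show ?case by blast
qed

text \<open>The obvious \<open>p\<close>-th root \<open>y^j' x^i'\<close> is correct up to a power
  of \<open>z\<close>. Since \<open>z = v^p\<close> with \<open>v\<close> central, multiplying the
  root by a power of \<open>v\<close> repairs the error; this is where the central root of
  \<open>z\<close> is indispensable.\<close>

lemma form_pth_power:
  assumes "p dvd i" "p dvd j"
  shows "\<exists>h\<in>carrier G. y [^] j \<otimes> x [^] i \<otimes> z [^] (l::nat) = h [^] p"
proof -
  obtain i' j' where ij: "i = p * i'" "j = p * j'" using assms by (elim dvdE)
  obtain t :: nat where t: "(y [^] j' \<otimes> x [^] i') [^] p = y [^] j \<otimes> x [^] i \<otimes> z [^] t"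
    using form_pow unfolding ij by blast
  \<comment> \<open>This is \<open>l - t\<close> modulo \<open>p\<close> in natural numbers:
    \<open>t + m = p t + l\<close>, and \<open>z^p = \<one>\<close>, so
    \<open>z^(t+m) = z^l\<close>.\<close>
  define m where "m = l + t * (p - 1)"
  have tm: "t + m = p * t + l"
    unfolding m_def using p_pos by (cases p) (simp_all add: algebra_simps)
  have "((y [^] j' \<otimes> x [^] i') \<otimes> v [^] m) [^] p = (y [^] j' \<otimes> x [^] i') [^] p \<otimes> (v [^] m) [^] p"
    by (rule pow_mult_distrib) (simp_all add: v_pow_comm)
  also have "(v [^] m) [^] p = z [^] m"
    by (simp add: z_pow_eq nat_pow_pow mult.commute)
  also have "(y [^] j' \<otimes> x [^] i') [^] p \<otimes> z [^] m = y [^] j \<otimes> x [^] i \<otimes> (z [^] (t + m))"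
    unfolding t by (simp add: m_assoc nat_pow_mult)
  also have "z [^] (t + m) = (z [^] p) [^] t \<otimes> z [^] l"
    unfolding tm by (simp only: nat_pow_pow nat_pow_mult z_closed)
  also have "\<dots> = z [^] l" by (simp add: z_pow)
  finally show ?thesis by (intro bexI[of _ "(y [^] j' \<otimes> x [^] i') \<otimes> v [^] m"]) simp_all
qed

text \<open>A substitute for the Burnside basis theorem. By \<open>form_pth_power\<close>, one of
  the exponents \<open>i\<close>, \<open>j\<close> of \<open>g\<close> is prime to \<open>p\<close>;
  the matching generator is recovered from \<open>g\<close> and the other one by taking a root. As
  \<open>z\<close> is a power of \<open>g\<close>, the factor \<open>z^l\<close> can be removed
  inside the generated subgroup.\<close>

lemma not_pth_power_generates:
  assumes g: "g \<in> carrier G" and not_pow: "\<And>h. h \<in> carrier G \<Longrightarrow> g \<noteq> h [^] p"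
    and zg: "z = g [^] (k::nat)"
  shows "\<exists>h\<in>carrier G. generate G {g, h} = carrier G"
proof -
  obtain i j l :: nat where gf: "g = y [^] j \<otimes> x [^] i \<otimes> z [^] l"
    using formE[OF g] by blast
  have sub: "subgroup (generate G {g, h}) G" if "h \<in> carrier G" for h
    using that g by (intro generate_is_subgroup) simp
  have pow: "w [^] (n::nat) \<in> generate G {g, h}" if "w \<in> generate G {g, h}" "h \<in> carrier G" for w h n
    using that by (induction n) (auto intro: generate.intros)
  have all: "generate G {g, h} = carrier G"
    if "h \<in> carrier G" "x \<in> generate G {g, h}" "y \<in> generate G {g, h}" for h
  proof -
    have "generate G {x, y} \<subseteq> generate G {g, h}"
      using that by (intro generate_subgroup_incl sub) simp_all
    then show ?thesis using gen subgroup.subset[OF sub[OF that(1)]] by simp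
  qed
  have zin: "inv (z [^] l) \<in> generate G {g, h}" if h: "h \<in> carrier G" for h
  proof -
    have "z [^] l \<in> generate G {g, h}"
      unfolding zg using h by (intro pow generate.incl) simp_all
    then show ?thesis using subgroup.m_inv_closed[OF sub[OF h]] by blast
  qed
  have "\<not> (p dvd i \<and> p dvd j)"
    using form_pth_power[of i j l] not_pow unfolding gf by blast
  then consider "\<not> p dvd i" | "\<not> p dvd j" by blast
  then show ?thesis
  proof cases
    case 1
    let ?M = "generate G {g, y}"
    interpret M: subgroup ?M G by (rule sub) simp
    have yM: "y \<in> ?M" and gM: "g \<in> ?M" by (auto intro: generate.incl)
    have "g \<otimes> inv (z [^] l) = y [^] j \<otimes> x [^] i"
      unfolding gf by (simp add: m_assoc)
    then have "inv (y [^] j) \<otimes> (g \<otimes> inv (z [^] l)) = x [^] i"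
      by (simp add: m_assoc[symmetric])
    moreover have "inv (y [^] j) \<otimes> (g \<otimes> inv (z [^] l)) \<in> ?M"
      by (rule M.m_closed[OF M.m_inv_closed[OF pow[OF yM y]] M.m_closed[OF gM zin[OF y]]])
    ultimately have "x [^] i \<in> ?M" by simp
    moreover obtain k :: nat where "(x [^] i) [^] k = x"
      using pow_of_coprime_exponent[OF x exponent[OF x] prime 1] by blast
    ultimately have "x \<in> ?M" using pow[of "x [^] i" y k] by simp
    then show ?thesis using all[OF y _ yM] by (intro bexI[of _ y]) simp_all
  next
    case 2
    let ?M = "generate G {g, x}"
    interpret M: subgroup ?M G by (rule sub) simp
    have xM: "x \<in> ?M" and gM: "g \<in> ?M" by (auto intro: generate.incl)
    have "g \<otimes> inv (z [^] l) \<otimes> inv (x [^] i) = y [^] j"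
      unfolding gf by (simp add: m_assoc)
    moreover have "g \<otimes> inv (z [^] l) \<otimes> inv (x [^] i) \<in> ?M"
      by (rule M.m_closed[OF M.m_closed[OF gM zin[OF x]] M.m_inv_closed[OF pow[OF xM x]]])
    ultimately have "y [^] j \<in> ?M" by simp
    moreover obtain k :: nat where "(y [^] j) [^] k = y"
      using pow_of_coprime_exponent[OF y exponent[OF y] prime 2] by blast
    ultimately have "y \<in> ?M" using pow[of "y [^] j" x k] by simp
    then show ?thesis using all[OF x xM] by (intro bexI[of _ x]) simp_all
  qed
qed

lemma metacyclic_generators:
  "\<exists>a\<in>carrier G. \<exists>b\<in>carrier G. \<exists>k. generate G {a, b} = carrier G
      \<and> a \<otimes> b = b \<otimes> a [^] (1 + p ^ 2 * k)"
proof -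
  \<comment> \<open>Otherwise \<open>v\<close> would belong to a generating pair, and being central
    it would make the group abelian. So \<open>z\<close> is a \<open>p^2\<close>-th power, which
    provides the lower bound 2 for the exponent \<open>s\<close> and thus the factor
    \<open>p^2\<close> in the final relation.\<close>
  have "\<exists>h\<in>carrier G. v = h [^] p"
  proof (rule ccontr)
    assume "\<not> ?thesis"
    then obtain h where h: "h \<in> carrier G" "generate G {v, h} = carrier G"
      using not_pth_power_generates[OF v_closed _ z_eq] by blast
    have "comm_group G"
      using comm_group_of_generators[OF fin v_closed h] centre_comm[OF v h(1)] by simp
    then show False using noncomm by contradiction
  qed
  then obtain g where g: "g \<in> carrier G" "v = g [^] p" by blast
  define P where "P = (\<lambda>s. 2 \<le> s \<and> (\<exists>g\<in>carrier G. z = g [^] (p ^ s)))"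
  have "z = g [^] (p ^ 2)" using g by (simp add: z_eq nat_pow_pow power2_eq_square)
  then have P2: "P 2" unfolding P_def using g by blast
  \<comment> \<open>A \<open>p^s\<close>-th power with \<open>s >= N\<close> is trivial, but
    \<open>z\<close> is not; so a largest \<open>s\<close> exists.\<close>
  have bound: "s \<le> N" if Ps: "P s" for s
  proof (rule ccontr)
    assume "\<not> s \<le> N"
    then obtain d where d: "p ^ s = p ^ N * d"
      using le_imp_power_dvd[of N s p] by (meson dvdE linear)
    obtain g where "g \<in> carrier G" "z = g [^] (p ^ s)" using Ps unfolding P_def by blast
    then have "z = (g [^] (p ^ N)) [^] d" unfolding d by (simp add: nat_pow_pow)
    then show False using z_neq exponent \<open>g \<in> carrier G\<close> by simp
  qed
  define s where "s = (GREATEST s. P s)"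
  have Ps: "P s" unfolding s_def by (rule GreatestI_nat[of P, OF P2 bound])
  have max: "s' \<le> s" if "P s'" for s' unfolding s_def by (rule Greatest_le_nat[of P, OF that bound])
  obtain a where a: "a \<in> carrier G" "z = a [^] (p ^ s)" and s: "2 \<le> s"
    using Ps unfolding P_def by blast
  have "a \<noteq> h [^] p" if h: "h \<in> carrier G" for h
  proof
    assume "a = h [^] p"
    then have "z = h [^] (p ^ Suc s)" using a h by (simp add: nat_pow_pow)
    then have "P (Suc s)" unfolding P_def using s h by auto
    then show False using max by fastforce
  qed
  then obtain b where b: "b \<in> carrier G" "generate G {a, b} = carrier G"
    using not_pth_power_generates[OF a(1) _ a(2)] by blast
  obtain l :: nat where l: "a \<otimes> b = b \<otimes> a \<otimes> z [^] l" using comm[OF a(1) b(1)] by blast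
  obtain d where d: "s = 2 + d" using s le_Suc_ex by blast
  have "z [^] l = a [^] (p ^ 2 * (p ^ d * l))"
    using a by (simp add: nat_pow_pow d power_add power2_eq_square mult_ac)
  then have "a \<otimes> b = b \<otimes> a [^] (1 + p ^ 2 * (p ^ d * l))"
    unfolding l using a(1) b(1) by (simp only: m_assoc nat_pow_closed nat_pow_mult[symmetric] nat_pow_eone)
  then show ?thesis using a b by blast
qed

end

section \<open>Descent through central subgroups of order \<open>p\<close>\<close>

context group
begin

text \<open>The induction on the group order ranges over groups on one fixed type, whereas coset
  groups live on a type of sets; the quotient is therefore replaced by a copy on
  \<open>nat\<close>.\<close>

lemma ex_nat_quotient:
  assumes "N \<lhd> G" "finite (carrier G)"
  shows "\<exists>(H :: nat monoid) f. group H \<and> f \<in> hom G H \<and> f ` carrier G = carrier H \<and> kernel G H f = N"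
proof -
  interpret N: normal N G by fact
  have "(\<lambda>x. N #> x) ` carrier G = carrier (G Mod N)"
    by (auto simp: FactGroup_def RCOSETS_def)
  then have "finite (carrier (G Mod N))" using assms(2) by (metis finite_imageI)
  then obtain H :: "nat monoid" where H: "group H" "G Mod N \<cong> H"
    using ex_iso_nat_monoid N.factorgroup_is_group by blast
  then show ?thesis using ex_hom_of_quotient_iso[OF assms(1) H] by blast
qed

lemma commutator_neq_one:
  assumes "g \<in> carrier G" "h \<in> carrier G" "g \<otimes> h \<noteq> h \<otimes> g"
  shows "inv g \<otimes> inv h \<otimes> g \<otimes> h \<noteq> \<one>"
proof
  assume "inv g \<otimes> inv h \<otimes> g \<otimes> h = \<one>"
  then have "inv (h \<otimes> g) \<otimes> (g \<otimes> h) = \<one>"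
    using assms(1,2) by (simp add: inv_mult_group m_assoc)
  then have "g \<otimes> h = h \<otimes> g"
    using assms(1,2) by (metis inv_solve_left m_closed one_closed r_one)
  then show False using assms(3) by contradiction
qed

text \<open>The first term of the chain that is not central provides the commutator.\<close>

lemma powerfully_nilpotent_central_commutator:
  assumes "powerfully_nilpotent p G" "\<not> comm_group G"
  shows "\<exists>c w. c \<in> commutator_subgroup G (carrier G) (carrier G) \<and> c \<noteq> \<one> \<and> w \<in> centre G
      \<and> c = w [^] p"
proof -
  obtain n K where nK: "K 0 = {\<one>} \<and> K n = carrier G \<and> (\<forall>i\<le>n. subgroup (K i) G) \<and>
      (\<forall>i<n. K i \<subseteq> K (Suc i) \<and>
        commutator_subgroup G (K (Suc i)) (carrier G) \<subseteq> power_subgroup G (K i) p)"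
    using assms(1) unfolding powerfully_nilpotent_def by (elim conjE exE) (rule that, intro conjI)
  define Q where "Q = (\<lambda>i. K i \<subseteq> centre G)"
  have Q0: "Q 0" unfolding Q_def using nK subgroup.one_closed[OF subgroup_centre] by simp
  have nQ: "\<not> Q n"
  proof
    assume "Q n"
    then have "carrier G \<subseteq> centre G" unfolding Q_def using nK by simp
    then have "comm_group G"
      using centre_comm[of _ G] by (intro group_comm_groupI) blast
    then show False using assms(2) by contradiction
  qed
  have "\<exists>i<n. Q i \<and> \<not> Q (Suc i)"
  proof (rule ccontr)
    assume neg: "\<not> (\<exists>i<n. Q i \<and> \<not> Q (Suc i))"
    have "Q i" if "i \<le> n" for i
      using that by (induction i) (use Q0 neg in auto)
    then show False using nQ by simp
  qed
  then obtain i where i: "i < n" "Q i" "\<not> Q (Suc i)" by blast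
  have sub: "K (Suc i) \<subseteq> carrier G" using nK i(1) subgroup.subset by (metis Suc_leI)
  obtain g where g: "g \<in> K (Suc i)" "g \<notin> centre G" using i(3) unfolding Q_def by blast
  then have gc: "g \<in> carrier G" using sub by blast
  obtain h where h: "h \<in> carrier G" "g \<otimes> h \<noteq> h \<otimes> g"
    using g(2) gc unfolding centre_def by blast
  define c where "c = inv g \<otimes> inv h \<otimes> g \<otimes> h"
  have "c \<in> commutator_subgroup G (K (Suc i)) (carrier G)"
    unfolding commutator_subgroup_def c_def by (rule generate.incl) (use g(1) h(1) in blast)
  then have "c \<in> power_subgroup G (K i) p" using nK i(1) by blast
  also have "power_subgroup G (K i) p \<subseteq> power_subgroup G (centre G) p"
    unfolding power_subgroup_def by (rule mono_generate) (use i(2) in \<open>auto simp: Q_def\<close>)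
  finally obtain w where "w \<in> centre G" "c = w [^] p"
    unfolding power_subgroup_centre by blast
  moreover have "c \<in> commutator_subgroup G (carrier G) (carrier G)"
    unfolding commutator_subgroup_def c_def by (rule generate.incl) (use gc h(1) in blast)
  moreover have "c \<noteq> \<one>" unfolding c_def by (rule commutator_neq_one[OF gc h])
  ultimately show ?thesis by blast
qed

lemma commutator_subgroup_leI:
  assumes "N \<lhd> G" "comm_group (G Mod N)"
  shows "commutator_subgroup G (carrier G) (carrier G) \<subseteq> N"
proof -
  interpret N: normal N G by fact
  have "inv x \<otimes> inv y \<otimes> x \<otimes> y \<in> N" if xy: "x \<in> carrier G" "y \<in> carrier G" for x y
  proof -
    obtain n where n: "n \<in> N" "x \<otimes> y = y \<otimes> x \<otimes> n"
      using comm_quotientD[OF assms xy] by blast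
    then have "inv (y \<otimes> x) \<otimes> (x \<otimes> y) = n"
      using xy N.subset inv_mult_cancel[of "y \<otimes> x" \<one> n] by auto
    then show ?thesis using n(1) xy by (simp add: inv_mult_group m_assoc)
  qed
  then show ?thesis
    unfolding commutator_subgroup_def
    by (intro generate_subgroup_incl N.subgroup_axioms) blast
qed

lemma central_powers_normal:
  assumes "z \<in> centre G" "z [^] (n::nat) = \<one>" "0 < n"
  shows "{z [^] (k::nat) | k. True} \<lhd> G"
proof -
  have z: "z \<in> carrier G" using assms(1) by (rule centre_closed)
  interpret Z: subgroup "centre G" G by (rule subgroup_centre)
  have "z [^] k \<in> centre G" for k :: nat
    by (induction k) (use assms(1) in auto)
  then have "g \<otimes> z [^] k \<otimes> inv g = z [^] k" if g: "g \<in> carrier G" for g and k :: nat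
  proof -
    have "g \<otimes> z [^] k \<otimes> inv g = z [^] k \<otimes> g \<otimes> inv g"
      by (subst centre_comm[OF \<open>z [^] k \<in> centre G\<close> g]) (rule refl)
    then show ?thesis using g z by (simp add: m_assoc)
  qed
  then show ?thesis
    using subgroup_torsion_powers[OF z assms(2,3)]
    by (intro normal_invI) auto
qed

text \<open>The conjugate of \<open>c = a\<^sup>m z\<close> by \<open>b\<close> is again a power of \<open>c\<close>, since \<open>z\<close> is central.\<close>

lemma cyclic_commutator_normal:
  assumes fin: "finite (carrier G)" and ab: "a \<in> carrier G" "b \<in> carrier G"
    and gen: "generate G {a, b} = carrier G" and z: "z \<in> centre G"
    and rel: "a \<otimes> b = b \<otimes> a \<otimes> c" and c: "c = a [^] (m::nat) \<otimes> z"
  shows "{c [^] (l::nat) | l. True} \<lhd> G"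
proof -
  have zc: "z \<in> carrier G" using z by (rule centre_closed)
  then have cc: "c \<in> carrier G" using ab c by simp
  have ac: "a \<otimes> c = c \<otimes> a"
  proof -
    have "a \<otimes> c = (a \<otimes> a [^] m) \<otimes> z" using ab zc by (simp add: c m_assoc)
    also have "\<dots> = (a [^] m \<otimes> a) \<otimes> z" using nat_pow_Suc2[OF ab(1), of m] by simp
    also have "\<dots> = a [^] m \<otimes> (z \<otimes> a)"
      using ab zc by (simp add: m_assoc centre_comm[OF z])
    finally show ?thesis using ab zc by (simp add: c m_assoc)
  qed
  have cpow_a: "c [^] k \<otimes> a = a \<otimes> c [^] k" for k :: nat
    using pow_conj_pow[OF cc ab(1), of 1 k 1] ac ab cc by simp
  have apow: "a [^] k \<otimes> b = b \<otimes> a [^] k \<otimes> c [^] k" for k :: nat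
  proof (induction k)
    case (Suc k)
    have "a [^] Suc k \<otimes> b = a [^] k \<otimes> (a \<otimes> b)" using ab by (simp add: m_assoc)
    also have "\<dots> = (a [^] k \<otimes> b) \<otimes> (a \<otimes> c)" unfolding rel using ab cc by (simp add: m_assoc)
    also have "\<dots> = b \<otimes> a [^] k \<otimes> (c [^] k \<otimes> a) \<otimes> c" unfolding Suc using ab cc by (simp add: m_assoc)
    also have "c [^] k \<otimes> a = a \<otimes> c [^] k"
      by (rule cpow_a)
    also have "b \<otimes> a [^] k \<otimes> (a \<otimes> c [^] k) \<otimes> c = b \<otimes> a [^] Suc k \<otimes> c [^] Suc k"
      using ab cc by (simp add: m_assoc)
    finally show ?case .
  qed (use ab in simp)
  have "c \<otimes> b = a [^] m \<otimes> (z \<otimes> b)" using ab zc by (simp add: c m_assoc)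
  also have "\<dots> = (a [^] m \<otimes> b) \<otimes> z" using ab zc by (simp add: m_assoc centre_comm[OF z])
  also have "\<dots> = b \<otimes> a [^] m \<otimes> (c [^] m \<otimes> z)" unfolding apow using ab zc cc by (simp add: m_assoc)
  also have "c [^] m \<otimes> z = z \<otimes> c [^] m" using centre_comm[OF z, of "c [^] m"] cc by simp
  also have "b \<otimes> a [^] m \<otimes> (z \<otimes> c [^] m) = b \<otimes> (c \<otimes> c [^] m)"
    using ab zc cc by (simp add: c m_assoc)
  also have "\<dots> = b \<otimes> c [^] (1 + m)"
    using cc by (simp only: nat_pow_mult[symmetric] nat_pow_eone)
  finally have cb: "c [^] (l::nat) \<otimes> b = b \<otimes> c [^] (l * (1 + m))" for l
    using pow_conj_pow[OF cc ab(2), of "1 + m" l 1] ab by simp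
  have torsion: "\<exists>n>0. g [^] (n::nat) = \<one>" if "g \<in> carrier G" for g
    using that ord_ge_1[OF fin that] by (intro exI[of _ "ord g"]) simp
  let ?N = "{c [^] (l::nat) | l. True}"
  have sub: "subgroup ?N G"
    using torsion[OF cc] subgroup_torsion_powers[OF cc] by blast
  have conj: "\<forall>l::nat. \<exists>l'::nat. c [^] l \<otimes> g = g \<otimes> c [^] l'" if g: "g \<in> carrier G" for g
  proof -
    have "g \<in> generate G {a, b}" using g gen by simp
    then show ?thesis
    proof (rule generate_torsion_induct)
      show "{a, b} \<subseteq> carrier G" using ab by simp
      show "\<exists>n>0. x [^] (n::nat) = \<one>" if "x \<in> {a, b}" for x using that ab torsion by auto
      show "\<forall>l::nat. \<exists>l'::nat. c [^] l \<otimes> \<one> = \<one> \<otimes> c [^] l'" using cc by auto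
      show "\<forall>l::nat. \<exists>l'::nat. c [^] l \<otimes> x = x \<otimes> c [^] l'" if x: "x \<in> {a, b}" for x
      proof
        fix l :: nat
        show "\<exists>l'::nat. c [^] l \<otimes> x = x \<otimes> c [^] l'"
          using x cb[of l] cpow_a[of l] by auto
      qed
      fix x y assume xy: "x \<in> carrier G" "y \<in> carrier G"
        and x: "\<forall>l::nat. \<exists>l'::nat. c [^] l \<otimes> x = x \<otimes> c [^] l'"
        and y: "\<forall>l::nat. \<exists>l'::nat. c [^] l \<otimes> y = y \<otimes> c [^] l'"
      show "\<forall>l::nat. \<exists>l'::nat. c [^] l \<otimes> (x \<otimes> y) = (x \<otimes> y) \<otimes> c [^] l'"
      proof
        fix l :: nat
        obtain l1 :: nat where l1: "c [^] l \<otimes> x = x \<otimes> c [^] l1" using x by blast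
        obtain l2 :: nat where l2: "c [^] l1 \<otimes> y = y \<otimes> c [^] l2" using y by blast
        have "c [^] l \<otimes> (x \<otimes> y) = (c [^] l \<otimes> x) \<otimes> y" using xy cc by (simp add: m_assoc)
        also have "\<dots> = x \<otimes> (c [^] l1 \<otimes> y)" unfolding l1 using xy cc by (simp add: m_assoc)
        also have "\<dots> = (x \<otimes> y) \<otimes> c [^] l2" unfolding l2 using xy cc by (simp add: m_assoc)
        finally show "\<exists>l'::nat. c [^] l \<otimes> (x \<otimes> y) = (x \<otimes> y) \<otimes> c [^] l'" by blast
      qed
    qed
  qed
  show ?thesis
  proof (rule normal_invI[OF sub])
    fix g n assume g: "g \<in> carrier G" and "n \<in> ?N"
    then obtain l :: nat where n: "n = c [^] l" by blast
    obtain l' :: nat where "c [^] l \<otimes> inv g = inv g \<otimes> c [^] l'"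
      using conj[OF inv_closed[OF g]] by blast
    then have "g \<otimes> n \<otimes> inv g = g \<otimes> (inv g \<otimes> c [^] l')"
      unfolding n using g cc by (simp add: m_assoc)
    also have "\<dots> = c [^] l'" using g cc by (simp add: m_assoc[symmetric])
    finally show "g \<otimes> n \<otimes> inv g \<in> ?N" by blast
  qed
qed

end

text \<open>Generators of the quotient by the powers of \<open>z\<close> lift, with the relation
  holding up to a factor \<open>z^s\<close>. If the relation in the quotient is that of commuting
  elements already in \<open>G\<close>, that is \<open>u = \<one>\<close>, the case of a small
  commutator subgroup applies. Otherwise the error is absorbed by showing that \<open>z\<close> is a
  power of \<open>a\<close> whose exponent is divisible by \<open>p^2\<close>.\<close>

theorem metacyclic_generators_exist:
  fixes G :: "nat monoid" (structure)
  assumes "Factorial_Ring.prime p" "powerfully_nilpotent p G" "two_generated G"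
  shows "\<exists>a\<in>carrier G. \<exists>b\<in>carrier G. \<exists>k. generate G {a, b} = carrier G
      \<and> a \<otimes> b = b \<otimes> a [^] (1 + p ^ 2 * k)"
  using assms(2,3)
proof (induction "card (carrier G)" arbitrary: G rule: less_induct)
  case (less G)
  note pn = powerfully_nilpotentD[OF less.prems(1)]
  interpret group G by (rule pn(1))
  obtain x y where xy: "x \<in> carrier G" "y \<in> carrier G" "generate G {x, y} = carrier G"
    using less.prems(2) unfolding two_generated_def by blast
  obtain N where "order G = p ^ N" using pn(3) by blast
  then have exponent: "g [^]\<^bsub>G\<^esub> (p ^ N) = \<one>\<^bsub>G\<^esub>" if "g \<in> carrier G" for g
    using pow_order_eq_1[OF that] by simp
  have p0: "1 < p" using assms(1) prime_gt_1_nat by blast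
  show ?case
  proof (cases "comm_group G")
    case True
    then have "x \<otimes>\<^bsub>G\<^esub> y = y \<otimes>\<^bsub>G\<^esub> x [^]\<^bsub>G\<^esub> (1 + p ^ 2 * 0)"
      using comm_groupE(4)[OF True xy(1,2)] xy by simp
    then show ?thesis using xy by blast
  next
    case noncomm: False
    obtain c0 w where c0: "c0 \<in> commutator_subgroup G (carrier G) (carrier G)" "c0 \<noteq> \<one>\<^bsub>G\<^esub>"
      "w \<in> centre G" "c0 = w [^]\<^bsub>G\<^esub> p"
      using powerfully_nilpotent_central_commutator[OF less.prems(1) noncomm] by blast
    have wc: "w \<in> carrier G" using c0(3) by (rule centre_closed)
    then have c0c: "c0 \<in> carrier G" using c0(4) by simp
    have "ord c0 dvd p ^ N" using exponent[OF c0c] pow_eq_id[OF c0c] by simp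
    then obtain m where m: "ord c0 = p ^ m" using assms(1) divides_primepow_nat by blast
    have "m \<noteq> 0" using m c0(2) ord_eq_1[OF c0c] by auto
    then obtain m' where m': "m = Suc m'" using not0_implies_Suc by blast
    \<comment> \<open>Raising both \<open>w\<close> and \<open>c0\<close> to the power
      \<open>p^m'\<close> keeps the relation between a central element and its \<open>p\<close>-th
      power, and brings the order of the latter from \<open>p^(m'+1)\<close> down to
      \<open>p\<close>.\<close>
    define v where "v = w [^]\<^bsub>G\<^esub> (p ^ m')"
    define z where "z = v [^]\<^bsub>G\<^esub> p"
    interpret Z: subgroup "centre G" G by (rule subgroup_centre)
    have powZ: "g [^]\<^bsub>G\<^esub> (k::nat) \<in> centre G" if "g \<in> centre G" for g k
      by (induction k) (use that in auto)
    have v: "v \<in> centre G" unfolding v_def by (rule powZ[OF c0(3)])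
    have z: "z \<in> centre G" unfolding z_def by (rule powZ[OF v])
    then have zc: "z \<in> carrier G" by (rule centre_closed)
    have z_eq: "z = c0 [^]\<^bsub>G\<^esub> (p ^ m')"
      unfolding z_def v_def c0(4) using wc by (simp add: nat_pow_pow mult.commute)
    have z_neq: "z \<noteq> \<one>\<^bsub>G\<^esub>"
      unfolding z_eq pow_eq_id[OF c0c] m m' using p0 by (auto dest: dvd_imp_le)
    have z_pow: "z [^]\<^bsub>G\<^esub> p = \<one>\<^bsub>G\<^esub>"
      unfolding z_eq nat_pow_pow[OF c0c] pow_eq_id[OF c0c] m m' by (simp add: mult.commute)
    let ?C = "commutator_subgroup G (carrier G) (carrier G)"
    have Csub: "subgroup ?C G"
      unfolding commutator_subgroup_def by (rule generate_is_subgroup) auto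
    have zC: "z \<in> ?C"
    proof -
      have "c0 [^]\<^bsub>G\<^esub> (k::nat) \<in> ?C" for k
        by (induction k) (use c0(1) subgroup.m_closed[OF Csub] subgroup.one_closed[OF Csub] in auto)
      then show ?thesis unfolding z_eq .
    qed
    define L where "L = {z [^]\<^bsub>G\<^esub> (k::nat) | k. True}"
    have L: "L \<lhd> G" unfolding L_def using central_powers_normal[OF z z_pow] p0 by simp
    interpret L: normal L G by (rule L)
    have base: ?thesis if "comm_group (G Mod L)"
    proof -
      interpret small_commutator G x y z v p N
      proof (unfold_locales)
        fix g h assume "g \<in> carrier G" "h \<in> carrier G"
        then show "\<exists>l::nat. g \<otimes>\<^bsub>G\<^esub> h = h \<otimes>\<^bsub>G\<^esub> g \<otimes>\<^bsub>G\<^esub> z [^]\<^bsub>G\<^esub> l"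
          using comm_quotientD[OF L that] unfolding L_def by blast
      qed (use assms(1) pn(2) exponent xy v z_def z_neq z_pow noncomm in auto)
      show ?thesis by (rule metacyclic_generators)
    qed
    obtain H :: "nat monoid" and f where H: "group H" and f: "f \<in> hom G H" "f ` carrier G
        = carrier H"
      and ker: "kernel G H f = L"
      using ex_nat_quotient[OF L pn(2)] by blast
    interpret f: group_hom G H f using group_homI[OF is_group H f(1)] .
    have "z [^]\<^bsub>G\<^esub> (1::nat) \<in> L" unfolding L_def by blast
    then have zL: "z \<in> L" using zc by simp
    then have fz: "f z = \<one>\<^bsub>H\<^esub>" using ker unfolding kernel_def by auto
    have "card (carrier H) < card (carrier G)"
    proof -
      have "card (carrier H) \<noteq> card (carrier G)"
      proof
        assume "card (carrier H) = card (carrier G)"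
        then have "inj_on f (carrier G)" using f(2) pn(2) by (simp add: eq_card_imp_inj_on)
        then show False using fz zc z_neq f.hom_one by (metis inj_onD one_closed)
      qed
      moreover have "card (carrier H) \<le> card (carrier G)"
        using card_image_le[OF pn(2), of f] f(2) by simp
      ultimately show ?thesis by simp
    qed
    then obtain a' b' k where ab': "a' \<in> carrier H" "b' \<in> carrier H" "generate H {a', b'}
        = carrier H"
      "a' \<otimes>\<^bsub>H\<^esub> b' = b' \<otimes>\<^bsub>H\<^esub> a' [^]\<^bsub>H\<^esub> (1 + p ^ 2 * k)"
      using less.hyps[of H] f.powerfully_nilpotent_img[OF assms(1) less.prems(1) f(2)]
        f.two_generated_img[OF less.prems(2) f(2)] by blast
    obtain a b where ab: "a \<in> carrier G" "b \<in> carrier G" and fab: "f a = a'" "f b = b'"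
      using ab'(1,2) f(2) by (metis imageE)
    define u where "u = a [^]\<^bsub>G\<^esub> (p ^ 2 * k)"
    have uc: "u \<in> carrier G" using ab by (simp add: u_def)
    have "f (inv\<^bsub>G\<^esub> (b \<otimes>\<^bsub>G\<^esub> a [^]\<^bsub>G\<^esub> (1 + p ^ 2 * k)) \<otimes>\<^bsub>G\<^esub> (a \<otimes>\<^bsub>G\<^esub> b)) = \<one>\<^bsub>H\<^esub>"
      using ab ab' by (simp add: f.hom_nat_pow fab del: nat_pow_Suc)
    then have "inv\<^bsub>G\<^esub> (b \<otimes>\<^bsub>G\<^esub> a [^]\<^bsub>G\<^esub> (1 + p ^ 2 * k)) \<otimes>\<^bsub>G\<^esub> (a \<otimes>\<^bsub>G\<^esub> b) \<in> kernel G H f"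
      using ab by (simp add: kernel_def)
    then obtain s :: nat where
      s: "inv\<^bsub>G\<^esub> (b \<otimes>\<^bsub>G\<^esub> a [^]\<^bsub>G\<^esub> (1 + p ^ 2 * k)) \<otimes>\<^bsub>G\<^esub> (a \<otimes>\<^bsub>G\<^esub> b) = z [^]\<^bsub>G\<^esub> s"
      unfolding ker L_def by blast
    have rel0: "a \<otimes>\<^bsub>G\<^esub> b = b \<otimes>\<^bsub>G\<^esub> a [^]\<^bsub>G\<^esub> (1 + p ^ 2 * k) \<otimes>\<^bsub>G\<^esub> z [^]\<^bsub>G\<^esub> s"
      unfolding s[symmetric] using ab by (simp add: m_assoc[symmetric] del: nat_pow_Suc)
    define c where "c = u \<otimes>\<^bsub>G\<^esub> z [^]\<^bsub>G\<^esub> s"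
    have cc: "c \<in> carrier G" unfolding c_def using uc zc by simp
    have rel: "a \<otimes>\<^bsub>G\<^esub> b = b \<otimes>\<^bsub>G\<^esub> a \<otimes>\<^bsub>G\<^esub> c"
      unfolding rel0 c_def u_def using ab zc
      by (simp only: nat_pow_mult[symmetric] nat_pow_eone m_assoc nat_pow_closed m_closed)
    \<comment> \<open>The lifts generate \<open>G\<close> because \<open>z\<close> is dispensable:
      central factors cancel in commutators, so every commutator of \<open>G\<close> is already one
      of elements of the subgroup generated by \<open>a\<close> and \<open>b\<close>. That subgroup
      hence contains \<open>[G, G]\<close>, and with it \<open>z\<close>.\<close>
    have gen: "generate G {a, b} = carrier G"
    proof -
      let ?M = "generate G {a, b}"
      have M: "subgroup ?M G" using ab by (intro generate_is_subgroup) simp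
      interpret M: subgroup ?M G by (rule M)
      have decomp: "\<exists>h\<in>?M. \<exists>k::nat. g = h \<otimes>\<^bsub>G\<^esub> z [^]\<^bsub>G\<^esub> k" if g: "g \<in> carrier G" for g
      proof -
        have "f ` ?M = carrier H"
          using f.generate_img[of "{a, b}"] ab ab'(3) fab by simp
        then have "f g \<in> f ` ?M"
          using g f.hom_closed by blast
        then obtain h where h: "h \<in> ?M" "f g = f h" by blast
        then have hc: "h \<in> carrier G" using M.subset by blast
        have "inv\<^bsub>G\<^esub> h \<otimes>\<^bsub>G\<^esub> g \<in> kernel G H f"
          using g hc h(2) by (simp add: kernel_def)
        then obtain k :: nat where k: "inv\<^bsub>G\<^esub> h \<otimes>\<^bsub>G\<^esub> g = z [^]\<^bsub>G\<^esub> k" unfolding ker L_def by blast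
        have "g = h \<otimes>\<^bsub>G\<^esub> z [^]\<^bsub>G\<^esub> k"
          unfolding k[symmetric] using g hc by (simp add: m_assoc[symmetric])
        then show ?thesis using h(1) by blast
      qed
      have "inv\<^bsub>G\<^esub> g \<otimes>\<^bsub>G\<^esub> inv\<^bsub>G\<^esub> h \<otimes>\<^bsub>G\<^esub> g \<otimes>\<^bsub>G\<^esub> h \<in> ?M" if gh: "g \<in> carrier G" "h \<in> carrier G" for g h
      proof -
        obtain g' and k :: nat where g: "g' \<in> ?M" "g = g' \<otimes>\<^bsub>G\<^esub> z [^]\<^bsub>G\<^esub> k" using decomp[OF gh(1)]
          by blast
        obtain h' and l :: nat where h: "h' \<in> ?M" "h = h' \<otimes>\<^bsub>G\<^esub> z [^]\<^bsub>G\<^esub> l" using decomp[OF gh(2)]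
          by blast
        have c': "g' \<in> carrier G" "h' \<in> carrier G" using g(1) h(1) M.subset by blast+
        have "g \<otimes>\<^bsub>G\<^esub> h = g' \<otimes>\<^bsub>G\<^esub> (z [^]\<^bsub>G\<^esub> k \<otimes>\<^bsub>G\<^esub> h') \<otimes>\<^bsub>G\<^esub> z [^]\<^bsub>G\<^esub> l"
          unfolding g h using c' zc by (simp add: m_assoc)
        also have "z [^]\<^bsub>G\<^esub> k \<otimes>\<^bsub>G\<^esub> h' = h' \<otimes>\<^bsub>G\<^esub> z [^]\<^bsub>G\<^esub> k"
          by (rule centre_comm[OF powZ[OF z] c'(2)])
        finally have gh1: "g \<otimes>\<^bsub>G\<^esub> h = (g' \<otimes>\<^bsub>G\<^esub> h') \<otimes>\<^bsub>G\<^esub> z [^]\<^bsub>G\<^esub> (k + l)"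
          using c' zc by (simp add: m_assoc nat_pow_mult)
        have "h \<otimes>\<^bsub>G\<^esub> g = h' \<otimes>\<^bsub>G\<^esub> (z [^]\<^bsub>G\<^esub> l \<otimes>\<^bsub>G\<^esub> g') \<otimes>\<^bsub>G\<^esub> z [^]\<^bsub>G\<^esub> k"
          unfolding g h using c' zc by (simp add: m_assoc)
        also have "z [^]\<^bsub>G\<^esub> l \<otimes>\<^bsub>G\<^esub> g' = g' \<otimes>\<^bsub>G\<^esub> z [^]\<^bsub>G\<^esub> l"
          by (rule centre_comm[OF powZ[OF z] c'(1)])
        finally have "h \<otimes>\<^bsub>G\<^esub> g = (h' \<otimes>\<^bsub>G\<^esub> g') \<otimes>\<^bsub>G\<^esub> z [^]\<^bsub>G\<^esub> (k + l)"
          using c' zc by (simp add: m_assoc nat_pow_mult add.commute)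
        also have "\<dots> = z [^]\<^bsub>G\<^esub> (k + l) \<otimes>\<^bsub>G\<^esub> (h' \<otimes>\<^bsub>G\<^esub> g')"
          using c' by (intro centre_comm[OF powZ[OF z], symmetric]) simp
        finally have hg1: "h \<otimes>\<^bsub>G\<^esub> g = z [^]\<^bsub>G\<^esub> (k + l) \<otimes>\<^bsub>G\<^esub> (h' \<otimes>\<^bsub>G\<^esub> g')" .
        have "g \<otimes>\<^bsub>G\<^esub> h = z [^]\<^bsub>G\<^esub> (k + l) \<otimes>\<^bsub>G\<^esub> (g' \<otimes>\<^bsub>G\<^esub> h')"
          unfolding gh1 using c' by (intro centre_comm[OF powZ[OF z], symmetric]) simp
        then have "inv\<^bsub>G\<^esub> (h \<otimes>\<^bsub>G\<^esub> g) \<otimes>\<^bsub>G\<^esub> (g \<otimes>\<^bsub>G\<^esub> h) = inv\<^bsub>G\<^esub> (h' \<otimes>\<^bsub>G\<^esub> g') \<otimes>\<^bsub>G\<^esub> (g' \<otimes>\<^bsub>G\<^esub> h')"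
          unfolding hg1 using c' zc by (simp only: inv_mult_cancel nat_pow_closed m_closed)
        moreover have "inv\<^bsub>G\<^esub> (h' \<otimes>\<^bsub>G\<^esub> g') \<otimes>\<^bsub>G\<^esub> (g' \<otimes>\<^bsub>G\<^esub> h') \<in> ?M"
          by (intro M.m_closed M.m_inv_closed g(1) h(1))
        ultimately show ?thesis using gh by (simp add: inv_mult_group m_assoc)
      qed
      then have "?C \<subseteq> ?M"
        unfolding commutator_subgroup_def by (intro generate_subgroup_incl M) blast
      then have zM: "z \<in> ?M" using zC by blast
      then have zkM: "z [^]\<^bsub>G\<^esub> (k::nat) \<in> ?M" for k by (induction k) auto
      have "carrier G \<subseteq> ?M"
      proof
        fix g assume "g \<in> carrier G"
        then obtain h and k :: nat where "h \<in> ?M" "g = h \<otimes>\<^bsub>G\<^esub> z [^]\<^bsub>G\<^esub> k"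
          using decomp by blast
        then show "g \<in> ?M" using M.m_closed zkM by simp
      qed
      then show ?thesis using M.subset by blast
    qed
    show ?thesis
    proof (cases "u = \<one>\<^bsub>G\<^esub>")
      case True
      then have "c \<in> L" unfolding L_def c_def using zc by auto
      then show ?thesis
        using base generators_comm_modI[OF pn(2) ab gen L _ rel] by blast
    next
      case u: False
      let ?N = "{c [^]\<^bsub>G\<^esub> (l::nat) | l. True}"
      \<comment> \<open>Modulo the normal subgroup of powers of \<open>c\<close> the generators
        commute. So \<open>[G, G]\<close> consists of powers of \<open>c\<close>, and
        \<open>z\<close> is one of them.\<close>
      have N: "?N \<lhd> G"
        using cyclic_commutator_normal[OF pn(2) ab gen powZ[OF z] rel] unfolding c_def u_def by blast
      have "c [^]\<^bsub>G\<^esub> (1::nat) \<in> ?N" by blast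
      then have "c \<in> ?N" using cc by simp
      then have "?C \<subseteq> ?N"
        using commutator_subgroup_leI[OF N] generators_comm_modI[OF pn(2) ab gen N _ rel] by blast
      then obtain l :: nat where l: "z = c [^]\<^bsub>G\<^esub> l" using zC by blast
      have "c [^]\<^bsub>G\<^esub> l = u [^]\<^bsub>G\<^esub> l \<otimes>\<^bsub>G\<^esub> (z [^]\<^bsub>G\<^esub> s) [^]\<^bsub>G\<^esub> l"
        unfolding c_def using uc zc centre_comm[OF powZ[OF z] uc, of s]
        by (intro pow_mult_distrib) simp_all
      then have z1: "z = u [^]\<^bsub>G\<^esub> l \<otimes>\<^bsub>G\<^esub> z [^]\<^bsub>G\<^esub> (s * l)"
        using l zc by (simp add: nat_pow_pow)
      \<comment> \<open>From \<open>z = u^l z^(s l)\<close> follows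
        \<open>u^l = z^(1 - s l)\<close>, where \<open>p - 1\<close> plays the part of
        \<open>-1\<close>. If \<open>p\<close> does not divide that exponent, \<open>z\<close> is a
        power of \<open>u^l\<close>, hence of \<open>a\<close>. If it does, then
        \<open>u^l = \<one>\<close>; as \<open>u\<close> is nontrivial, \<open>p\<close> divides
        \<open>l\<close>, and the relation collapses to \<open>z = \<one>\<close>.\<close>
      have "\<exists>j::nat. z = a [^]\<^bsub>G\<^esub> j"
      proof (rule ccontr)
        assume not_pow: "\<nexists>j::nat. z = a [^]\<^bsub>G\<^esub> j"
        have sl: "inv\<^bsub>G\<^esub> (z [^]\<^bsub>G\<^esub> i) = z [^]\<^bsub>G\<^esub> (i * (p - 1))" for i :: nat
          using inv_pow_eq_pow[OF zc z_pow] p0 by simp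
        have "u [^]\<^bsub>G\<^esub> l = z \<otimes>\<^bsub>G\<^esub> inv\<^bsub>G\<^esub> (z [^]\<^bsub>G\<^esub> (s * l))"
          using z1 uc zc by (metis inv_solve_right nat_pow_closed)
        also have "\<dots> = z [^]\<^bsub>G\<^esub> (1 + s * l * (p - 1))"
          unfolding sl using zc by (simp only: nat_pow_mult[symmetric] nat_pow_eone)
        finally have ul: "a [^]\<^bsub>G\<^esub> (p ^ 2 * k * l) = z [^]\<^bsub>G\<^esub> (1 + s * l * (p - 1))"
          using ab by (simp add: u_def nat_pow_pow)
        have pd: "p dvd 1 + s * l * (p - 1)"
        proof (rule ccontr)
          assume "\<not> p dvd 1 + s * l * (p - 1)"
          then obtain i :: nat where "(z [^]\<^bsub>G\<^esub> (1 + s * l * (p - 1))) [^]\<^bsub>G\<^esub> i = z"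
            using pow_of_coprime_exponent[OF zc, of p 1] z_pow assms(1) by (metis power_one_right)
          then have "z = a [^]\<^bsub>G\<^esub> (p ^ 2 * k * l * i)"
            unfolding ul[symmetric] using ab by (simp add: nat_pow_pow)
          then show False using not_pow by blast
        qed
        then have "z [^]\<^bsub>G\<^esub> (1 + s * l * (p - 1)) = \<one>\<^bsub>G\<^esub>"
          using zc z_pow by (metis dvd_def nat_pow_one nat_pow_pow)
        then have ul1: "u [^]\<^bsub>G\<^esub> l = \<one>\<^bsub>G\<^esub>"
          using ul ab by (simp add: u_def nat_pow_pow)
        have "p dvd l"
        proof (rule ccontr)
          assume "\<not> p dvd l"
          then obtain i :: nat where "(u [^]\<^bsub>G\<^esub> l) [^]\<^bsub>G\<^esub> i = u"
            using pow_of_coprime_exponent[OF uc exponent[OF uc] assms(1)] by blast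
          then show False using u ul1 by simp
        qed
        then have "z [^]\<^bsub>G\<^esub> (s * l) = \<one>\<^bsub>G\<^esub>"
          using zc z_pow by (metis dvd_def dvd_mult nat_pow_one nat_pow_pow)
        then show False using z1 ul1 z_neq by simp
      qed
      then obtain j :: nat where j: "z = a [^]\<^bsub>G\<^esub> j" by blast
      obtain n where n: "ord a = p ^ n"
        using exponent[OF ab(1)] pow_eq_id[OF ab(1)] assms(1) divides_primepow_nat by metis
      have "\<not> p ^ n dvd p ^ 2 * k"
        using u pow_eq_id[OF ab(1)] n unfolding u_def by metis
      \<comment> \<open>The element \<open>u\<close>, a power of \<open>a^(p^2)\<close>, is
        nontrivial, so \<open>a\<close> has order at least \<open>p^3\<close>. Since
        \<open>a^j = z\<close> has order \<open>p\<close>, \<open>p^3\<close> divides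
        \<open>j p\<close>, and the exponent \<open>j\<close> inherits the factor
        \<open>p^2\<close>.\<close>
      then have n3: "3 \<le> n"
        by (metis dvd_mult2 le_imp_power_dvd not_less_eq_eq numeral_2_eq_2 numeral_3_eq_3)
      have "a [^]\<^bsub>G\<^esub> (j * p) = \<one>\<^bsub>G\<^esub>" using z_pow ab unfolding j by (simp add: nat_pow_pow)
      then have "p ^ n dvd j * p" using pow_eq_id[OF ab(1)] n by simp
      moreover have "p ^ 3 dvd p ^ n" using n3 by (rule le_imp_power_dvd)
      ultimately have "p ^ 2 * p dvd j * p"
        by (metis dvd_trans power2_eq_square power3_eq_cube)
      then have "p ^ 2 dvd j" using p0 by simp
      then obtain i where i: "j = p ^ 2 * i" by (elim dvdE)
      have "c = a [^]\<^bsub>G\<^esub> (p ^ 2 * (k + i * s))"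
        unfolding c_def u_def j i using ab by (simp add: nat_pow_pow nat_pow_mult algebra_simps)
      then have "a \<otimes>\<^bsub>G\<^esub> b = b \<otimes>\<^bsub>G\<^esub> a [^]\<^bsub>G\<^esub> (1 + p ^ 2 * (k + i * s))"
        unfolding rel using ab by (simp only: m_assoc nat_pow_closed nat_pow_mult[symmetric] nat_pow_eone)
      then show ?thesis using ab gen by blast
    qed
  qed
qed

text \<open>The relation found so far has exponent \<open>1 + u p^r\<close> with \<open>p\<close>
  not dividing \<open>u\<close>. Replacing \<open>b\<close> by \<open>b^t\<close> raises this
  multiplier to the power \<open>t\<close>, and a suitable \<open>t\<close> turns it into
  \<open>1 + p^r\<close> modulo the order of \<open>a\<close>.\<close>

theorem ex_metacyclic_ord:
  fixes G :: "nat monoid" (structure)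
  assumes "Factorial_Ring.prime p" "powerfully_nilpotent p G" "two_generated G" "\<not> comm_group G"
  shows "\<exists>a b r e. metacyclic_ord G a b p r e \<and> 1 \<le> e"
proof -
  note pn = powerfully_nilpotentD[OF assms(2)]
  interpret group G by (rule pn(1))
  obtain a b k where ab: "a \<in> carrier G" "b \<in> carrier G" "generate G {a, b} = carrier G"
    and rel: "a \<otimes> b = b \<otimes> a [^] (1 + p ^ 2 * k)"
    using metacyclic_generators_exist[OF assms(1-3)] by blast
  obtain M where M: "order G = p ^ M" using pn(3) by blast
  have p1: "1 < p" using assms(1) prime_gt_1_nat by blast
  obtain n where n: "ord a = p ^ n"
    using ord_dvd_group_order[OF ab(1)] M assms(1) divides_primepow_nat by metis
  have not_dvd: "\<not> p ^ n dvd p ^ 2 * k"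
  proof
    assume "p ^ n dvd p ^ 2 * k"
    then have "a [^] (p ^ 2 * k) = \<one>" using pow_eq_id[OF ab(1)] n by simp
    then have "a \<otimes> b = b \<otimes> a"
      unfolding rel nat_pow_mult[OF ab(1), symmetric] using ab by simp
    then show False
      using comm_group_of_generators[OF pn(2) ab] assms(4) by blast
  qed
  then have "p ^ 2 * k \<noteq> 0" by (metis dvd_0_right)
  then obtain r u where ru: "p ^ 2 * k = u * p ^ r" "\<not> p dvd u"
    using prime_power_canonical[OF assms(1)] by (metis neq0_conv mult.commute)
  have r2: "2 \<le> r"
  proof (rule ccontr)
    assume "\<not> 2 \<le> r"
    then have "p ^ (r + 1) dvd p ^ 2" by (intro le_imp_power_dvd) simp
    then have "p ^ (r + 1) dvd u * p ^ r" using ru(1) by (metis dvd_mult2)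
    then have "p dvd u" using p1 by simp
    then show False using ru(2) by contradiction
  qed
  have rn: "r < n"
  proof (rule ccontr)
    assume "\<not> r < n"
    then have "p ^ n dvd p ^ r" by (intro le_imp_power_dvd) simp
    then show False using not_dvd ru(1) by (metis dvd_mult)
  qed
  obtain t where t: "[(1 + u * p ^ r) ^ t = 1 + p ^ r] (mod p ^ n)"
    using ex_power_cong_one_plus_prime_power[OF assms(1) r2 ru(2)] rn by (metis less_imp_le_nat)
  \<comment> \<open>Only a \<open>t\<close> prime to \<open>p\<close> keeps \<open>b\<close>
    recoverable from \<open>b^t\<close>. If \<open>p\<close> divided \<open>t\<close>, the power
    would be 1 modulo \<open>p^(r+1)\<close>, whereas \<open>1 + p^r\<close> is not; since
    \<open>r < n\<close>, the congruence modulo \<open>p^n\<close> can be read modulo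
    \<open>p^(r+1)\<close>.\<close>
  have pt: "\<not> p dvd t"
  proof
    assume "p dvd t"
    then obtain t' where t': "t = p * t'" by (elim dvdE)
    obtain w where "(1 + u * p ^ r) ^ (p ^ 1 * t') = 1 + t' * u * p ^ (r + 1) + w * p ^ (r + 1 + 1)"
      using one_plus_power_prime_power_mult[OF r2] by blast
    then have "(1 + u * p ^ r) ^ t = 1 + p ^ (r + 1) * (t' * u + w * p)"
      by (simp add: t' algebra_simps)
    then have "[1 + p ^ (r + 1) * (t' * u + w * p) = 1 + p ^ r] (mod p ^ n)" using t by simp
    then have "[1 + p ^ (r + 1) * (t' * u + w * p) = 1 + p ^ r] (mod p ^ (r + 1))"
      by (rule cong_dvd_modulus_nat) (rule le_imp_power_dvd, use rn in simp)
    then have "[p ^ (r + 1) * (t' * u + w * p) = p ^ r] (mod p ^ (r + 1))"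
      by (simp only: cong_add_lcancel_nat)
    then have "p ^ (r + 1) dvd p ^ r"
      by (metis cong_dvd_iff dvd_triv_left)
    then show False using p1 by (simp add: power_dvd_imp_le)
  qed
  let ?b = "b [^] t"
  have rel': "a \<otimes> ?b = ?b \<otimes> a [^] (1 + p ^ r)"
  proof -
    have "a \<otimes> ?b = ?b \<otimes> a [^] ((1 + u * p ^ r) ^ t)"
      using pow_conj_pow[OF ab(1,2) rel, of 1 t] ab ru(1) by simp
    also have "a [^] ((1 + u * p ^ r) ^ t) = a [^] (1 + p ^ r)"
      using t pow_mod_eq[OF ab(1), of "p ^ n"] n ab(1) unfolding cong_def by (metis pow_ord_eq_1)
    finally show ?thesis .
  qed
  have "generate G {a, ?b} = carrier G"
  proof -
    have sub: "subgroup (generate G {a, ?b}) G" using ab by (intro generate_is_subgroup) simp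
    have "b [^] (p ^ M) = \<one>" using pow_order_eq_1[OF ab(2)] M by simp
    then obtain i :: nat where i: "?b [^] i = b"
      using pow_of_coprime_exponent[OF ab(2) _ assms(1) pt] by blast
    have "?b [^] (i::nat) \<in> generate G {a, ?b}" for i
      by (induction i) (auto intro: generate.intros)
    then have "b \<in> generate G {a, ?b}" using i by metis
    moreover have "a \<in> generate G {a, ?b}" by (rule generate.incl) simp
    ultimately have "generate G {a, b} \<subseteq> generate G {a, ?b}"
      by (intro generate_subgroup_incl sub) simp
    then show ?thesis using ab(3) subgroup.subset[OF sub] by simp
  qed
  moreover have "finite_p_group p G"
    using assms(2) unfolding powerfully_nilpotent_def powerful_def by blast
  moreover have "ord a = p ^ (r + (n - r))" using n rn by simp
  ultimately have "metacyclic_ord G a ?b p r (n - r)"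
    using assms(1) r2 ab rel' is_group
    by (intro metacyclic_ord.intro metacyclic.intro metacyclic_axioms.intro metacyclic_ord_axioms.intro)
      simp_all
  then show ?thesis using rn by (intro exI[of _ a] exI[of _ ?b] exI[of _ r] exI[of _ "n - r"]) simp
qed

section \<open>Lifting generators and taking two quotients\<close>

text \<open>Elements of \<open>Z(G)^p\<close> are non-generators: each element is
  \<open>h w^p\<close> with \<open>h\<close> generated by the lifts and \<open>w\<close> central.
  Applying this decomposition to \<open>w\<close> itself raises the exponent of the central factor
  again, until it kills that factor.\<close>

lemma direct_ancestor_two_generated:
  fixes G (structure)
  assumes "direct_ancestor p H G" "two_generated H"
  shows "two_generated G"
proof -
  have pn: "powerfully_nilpotent p G" "powerfully_nilpotent p H"
    using assms(1) unfolding direct_ancestor_def by blast+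
  interpret group G by (rule powerfully_nilpotentD(1)[OF pn(1)])
  obtain f where f: "f \<in> hom G H" "f ` carrier G = carrier H"
    "kernel G H f = power_subgroup G (centre G) p"
    using assms(1) unfolding direct_ancestor_def by blast
  interpret f: group_hom G H f
    using group_homI[OF is_group powerfully_nilpotentD(1)[OF pn(2)] f(1)] .
  interpret Z: subgroup "centre G" G by (rule subgroup_centre)
  have powZ: "w [^] (k::nat) \<in> centre G" if "w \<in> centre G" for w k
    by (induction k) (use that in auto)
  obtain x' y' where xy': "x' \<in> carrier H" "y' \<in> carrier H" "generate H {x', y'} = carrier H"
    using assms(2) unfolding two_generated_def by blast
  obtain x y where xy: "x \<in> carrier G" "y \<in> carrier G" and fxy: "f x = x'" "f y = y'"
    using xy'(1,2) f(2) by (metis imageE)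
  let ?M = "generate G {x, y}"
  have M: "subgroup ?M G" using xy by (intro generate_is_subgroup) simp
  interpret M: subgroup ?M G by (rule M)
  have fM: "f ` ?M = carrier H"
    using f.generate_img[of "{x, y}"] xy xy'(3) fxy by simp
  have decomp: "\<exists>h\<in>?M. \<exists>w\<in>centre G. g = h \<otimes> w [^] p" if g: "g \<in> carrier G" for g
  proof -
    have "f g \<in> f ` ?M" unfolding fM using g f.hom_closed by blast
    then obtain h where h: "h \<in> ?M" "f g = f h" by blast
    then have hc: "h \<in> carrier G" using M.subset by blast
    have "inv h \<otimes> g \<in> kernel G H f"
      using g hc h(2) by (simp add: kernel_def)
    then obtain w where w: "w \<in> centre G" "inv h \<otimes> g = w [^] p"
      unfolding f(3) power_subgroup_centre by blast
    have "g = h \<otimes> w [^] p"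
      unfolding w(2)[symmetric] using g hc by (simp add: m_assoc[symmetric])
    then show ?thesis using h(1) w(1) by blast
  qed
  have iter: "\<forall>g\<in>carrier G. \<exists>h\<in>?M. \<exists>w\<in>centre G. g = h \<otimes> w [^] (p ^ i)" for i
  proof (induction i)
    case 0
    show ?case
    proof
      fix g assume "g \<in> carrier G"
      then obtain h w where hw: "h \<in> ?M" "w \<in> centre G" "g = h \<otimes> w [^] p"
        using decomp by blast
      then have "g = h \<otimes> (w [^] p) [^] (p ^ 0)" using centre_closed[of w G] by simp
      then show "\<exists>h\<in>?M. \<exists>w\<in>centre G. g = h \<otimes> w [^] (p ^ 0)"
        using hw powZ by blast
    qed
  next
    case (Suc i)
    show ?case
    proof
      fix g assume "g \<in> carrier G"
      then obtain h w where hw: "h \<in> ?M" "w \<in> centre G" "g = h \<otimes> w [^] (p ^ i)"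
        using Suc by blast
      have wc: "w \<in> carrier G" using hw(2) by (rule centre_closed)
      obtain h' w' where hw': "h' \<in> ?M" "w' \<in> centre G" "w = h' \<otimes> w' [^] p"
        using decomp[OF wc] by blast
      have c: "h' \<in> carrier G" "w' \<in> carrier G" "h \<in> carrier G"
        using hw'(1) hw(1) M.subset centre_closed[OF hw'(2)] by blast+
      \<comment> \<open>The power distributes because \<open>w' [^] p\<close> is central.\<close>
      have "w [^] (p ^ i) = h' [^] (p ^ i) \<otimes> (w' [^] p) [^] (p ^ i)"
        unfolding hw'(3)
        by (rule pow_mult_distrib) (use c centre_comm[OF powZ[OF hw'(2)] c(1)] in simp_all)
      then have "g = (h \<otimes> h' [^] (p ^ i)) \<otimes> w' [^] (p ^ Suc i)"
        unfolding hw(3) using c by (simp add: m_assoc nat_pow_pow)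
      moreover have "h' [^] (k::nat) \<in> ?M" for k
        by (induction k) (use hw'(1) in auto)
      ultimately show "\<exists>h\<in>?M. \<exists>w\<in>centre G. g = h \<otimes> w [^] (p ^ Suc i)"
        using hw(1) hw'(2) M.m_closed by blast
    qed
  qed
  obtain N where N: "order G = p ^ N" using powerfully_nilpotentD(3)[OF pn(1)] by blast
  have "g \<in> ?M" if g: "g \<in> carrier G" for g
  proof -
    obtain h w where hw: "h \<in> ?M" "w \<in> centre G" "g = h \<otimes> w [^] (p ^ N)"
      using iter[of N] g by blast
    have "w [^] (p ^ N) = \<one>" using pow_order_eq_1[OF centre_closed[OF hw(2)]] N by simp
    then show ?thesis using hw M.subset by auto
  qed
  then have "?M = carrier G" using M.subset by blast
  then show ?thesis unfolding two_generated_def using xy by blast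
qed

text \<open>Relations between powers of the generators are controlled modulo \<open>p^e\<close> in
  \<open>T\<close>, and this modulus survives in \<open>G\<close> since the kernel involves only
  \<open>p^(e+1)\<close>-th powers. Commutator order and kernel of the next step are governed by a
  smaller \<open>e'\<close>, so the surviving control meets the demand of
  \<open>card_img\<close>.\<close>

theorem two_fold_quotient:
  fixes T :: "nat monoid"
  assumes prime: "Factorial_Ring.prime p" and HG: "direct_ancestor p H G" and GT: "direct_ancestor p G T"
    and H2: "two_generated H"
  shows "\<exists>k r. 2 \<le> k \<and> 2 \<le> r \<and> G_group p k k r \<cong> H"
proof -
  have T: "powerfully_nilpotent p T" "\<not> comm_group T" "two_generated T"
    using GT direct_ancestor_two_generated[OF GT direct_ancestor_two_generated[OF HG H2]]
    unfolding direct_ancestor_def by blast+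
  have pn: "powerfully_nilpotent p G" "powerfully_nilpotent p H" "\<not> comm_group G"
    using HG unfolding direct_ancestor_def by blast+
  obtain a b r e where T_ord: "metacyclic_ord T a b p r e"
    using ex_metacyclic_ord[OF prime T(1,3,2)] by blast
  interpret T: metacyclic_ord T a b p r e by (rule T_ord)
  obtain f where f: "f \<in> hom T G" "f ` carrier T = carrier G"
    "kernel T G f = power_subgroup T (centre T) p"
    using GT unfolding direct_ancestor_def by blast
  interpret Q: metacyclic_quotient T a b p r e G f
    by (intro metacyclic_quotient.intro metacyclic_quotient_axioms.intro T_ord f
        powerfully_nilpotentD(1)[OF pn(1)])
  interpret G: metacyclic G "f a" "f b" p r by (rule Q.metacyclic_img)
  have indep: "p ^ e dvd i \<and> p ^ e dvd j" if "f a [^]\<^bsub>G\<^esub> i = f b [^]\<^bsub>G\<^esub> j" for i j :: nat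
    by (rule Q.img_pow_eqD[OF that]) (use T.pow_a_eq_pow_bD in \<open>auto simp: le_imp_power_dvd\<close>)
  have "group.ord G (f a) dvd p ^ (e + 1)"
    using Q.img_pow_eq_one(1) Q.f.H.pow_eq_id[OF G.a] by simp
  then obtain n where n: "n \<le> e + 1" "group.ord G (f a) = p ^ n"
    using prime divides_primepow_nat by blast
  have "\<not> p ^ n dvd p ^ r"
    using pn(3) G.comm_group_iff Q.f.H.pow_eq_id[OF G.a] n(2) by metis
  then have rn: "r < n" by (metis le_imp_power_dvd not_le)
  define e' where "e' = n - r"
  \<comment> \<open>Here \<open>e' = n - r\<close> with \<open>n <= e + 1\<close> and
    \<open>r >= 2\<close>, so \<open>e' <= e - 1\<close>: the missing factor \<open>p\<close> is
    gained. Noncommutativity of \<open>G\<close> gives \<open>r < n\<close> and hence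
    \<open>e' >= 1\<close>.\<close>
  have e': "n = r + e'" "1 \<le> e'" "e' + 1 \<le> e" using rn n(1) T.r unfolding e'_def by auto
  interpret G: metacyclic_ord G "f a" "f b" p r e'
    by unfold_locales (use n(2) e'(1) in simp)
  obtain g where g: "g \<in> hom G H" "g ` carrier G = carrier H"
    "kernel G H g = power_subgroup G (centre G) p"
    using HG unfolding direct_ancestor_def by blast
  interpret R: metacyclic_quotient G "f a" "f b" p r e' H g
    by (intro metacyclic_quotient.intro metacyclic_quotient_axioms.intro g
        G.metacyclic_ord_axioms powerfully_nilpotentD(1)[OF pn(2)])
  interpret H: metacyclic H "g (f a)" "g (f b)" p r by (rule R.metacyclic_img)
  have "p ^ (e' + 1) dvd p ^ e" using e'(3) by (rule le_imp_power_dvd)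
  then have "card (carrier H) = p ^ (e' + 1) * p ^ (e' + 1)"
    using R.card_img indep dvd_trans by blast
  then have "G_group p (e' + 1) (e' + 1) r \<cong> H"
    using R.f.H.G_group_isoI[OF H.a H.b R.img_pow_eq_one H.rel H.gen] H.p_gt_1 by simp
  then show ?thesis using e'(2) T.r by (intro exI[of _ "e' + 1"] exI[of _ r]) simp
qed

section \<open>A concrete model of \<open>G(n, n, r)\<close>\<close>

text \<open>The pair \<open>(j, i)\<close> stands for \<open>b\<^sup>j a\<^sup>i\<close>.\<close>

definition split_metacyclic :: "nat \<Rightarrow> nat \<Rightarrow> nat \<Rightarrow> (nat \<times> nat) monoid" where
  "split_metacyclic p n r =
     \<lparr>carrier = {..<p ^ n} \<times> {..<p ^ n},
      monoid.mult = (\<lambda>(j, i) (j', i'). ((j + j') mod p ^ n, (i * (1 + p ^ r) ^ j' + i') mod p ^ n)),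
      one = (0, 0)\<rparr>"

context
  fixes p n r :: nat
  assumes prime: "Factorial_Ring.prime p" and n: "1 \<le> n" and r: "2 \<le> r"
begin

lemma split_modulus_gt_1: "1 < p ^ n"
  using prime n by (intro one_less_power prime_gt_1_nat) simp_all

lemma split_prime_pos [simp]: "0 < p"
  using prime by (rule prime_gt_0_nat)

text \<open>The first coordinate only counts modulo \<open>p^n\<close>, so the twist
  \<open>(1 + p^r)^j\<close> must depend on \<open>j\<close> modulo \<open>p^n\<close>. It does,
  since \<open>(1 + p^r)^(p^n)\<close> is 1 even modulo \<open>p^(r+n)\<close>.\<close>

lemma split_power_mod: "[(1 + p ^ r) ^ (j mod p ^ n) = (1 + p ^ r) ^ j] (mod p ^ n)"
proof -
  have "p ^ (r + n) dvd (1 + p ^ r) ^ (p ^ n) - 1"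
    using prime_power_dvd_one_plus_power_diff_iff[OF prime r] by simp
  then have "p ^ n dvd (1 + p ^ r) ^ (p ^ n) - 1"
    by (rule dvd_trans[rotated]) (simp add: le_imp_power_dvd)
  then have "[(1 + p ^ r) ^ (p ^ n) = 1] (mod p ^ n)"
    by (subst cong_diff_iff_cong_0_nat[symmetric]) (simp_all add: cong_0_iff)
  then have "[((1 + p ^ r) ^ (p ^ n)) ^ (j div p ^ n) = 1 ^ (j div p ^ n)] (mod p ^ n)"
    by (rule cong_pow)
  then have "[(1 + p ^ r) ^ (j mod p ^ n) * ((1 + p ^ r) ^ (p ^ n)) ^ (j div p ^ n)
      = (1 + p ^ r) ^ (j mod p ^ n) * 1] (mod p ^ n)"
    by (intro cong_mult cong_refl) simp
  moreover have "(1 + p ^ r) ^ (j mod p ^ n) * ((1 + p ^ r) ^ (p ^ n)) ^ (j div p ^ n)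
      = (1 + p ^ r) ^ j"
    by (simp only: power_mult[symmetric] power_add[symmetric] mod_mult_div_eq)
  ultimately show ?thesis by (simp add: cong_sym)
qed

lemma group_split_metacyclic: "group (split_metacyclic p n r)"
proof (rule groupI)
  let ?G = "split_metacyclic p n r" and ?P = "p ^ n" and ?q = "1 + p ^ r"
  have P: "0 < ?P" using split_modulus_gt_1 by simp
  show "\<one>\<^bsub>?G\<^esub> \<in> carrier ?G" using P by (simp add: split_metacyclic_def)
  fix x assume x: "x \<in> carrier ?G"
  obtain j i where ji: "x = (j, i)" by fastforce
  show "\<one>\<^bsub>?G\<^esub> \<otimes>\<^bsub>?G\<^esub> x = x" using x by (auto simp: split_metacyclic_def)
  show "\<exists>y\<in>carrier ?G. y \<otimes>\<^bsub>?G\<^esub> x = \<one>\<^bsub>?G\<^esub>"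
  proof
    \<comment> \<open>The inverse of \<open>b^j a^i\<close> is \<open>b^(-j) a^(-i q^(-j))\<close>.
      The differences \<open>?P - i\<close> and \<open>?P - j\<close> represent the negatives, and
      the outer reduction brings the value \<open>?P\<close>, which occurs for \<open>j = 0\<close>,
      back into range.\<close>
    define j' where "j' = (?P - j) mod ?P"
    define i' where "i' = ((?P - i) * ?q ^ (?P - j)) mod ?P"
    show "(j', i') \<in> carrier ?G" using P by (simp add: split_metacyclic_def j'_def i'_def)
    have lt: "j < ?P" "i < ?P" using x ji by (auto simp: split_metacyclic_def)
    have 1: "(j' + j) mod ?P = 0"
      unfolding j'_def using lt by (simp add: mod_add_left_eq)
    have "[?q ^ (?P mod ?P) = ?q ^ ?P] (mod ?P)" by (rule split_power_mod)
    then have q: "[?q ^ ?P = 1] (mod ?P)" by (simp add: cong_sym)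
    have "[i' = (?P - i) * ?q ^ (?P - j)] (mod ?P)" by (simp add: cong_def i'_def)
    then have "[i' * ?q ^ j = (?P - i) * ?q ^ (?P - j) * ?q ^ j] (mod ?P)"
      by (rule cong_scalar_right)
    also have "(?P - i) * ?q ^ (?P - j) * ?q ^ j = (?P - i) * ?q ^ ?P"
      using lt by (simp add: mult.assoc power_add[symmetric])
    also have "[(?P - i) * ?q ^ ?P = (?P - i) * 1] (mod ?P)"
      by (rule cong_scalar_left[OF q])
    finally have "[i' * ?q ^ j + i = (?P - i) * 1 + i] (mod ?P)"
      by (rule cong_add) simp
    then have 2: "(i' * ?q ^ j + i) mod ?P = 0"
      using lt by (simp add: cong_def)
    show "(j', i') \<otimes>\<^bsub>?G\<^esub> x = \<one>\<^bsub>?G\<^esub>"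
      using 1 2 by (simp add: split_metacyclic_def ji)
  qed
  fix y assume y: "y \<in> carrier ?G"
  obtain j' i' where ji': "y = (j', i')" by fastforce
  show "x \<otimes>\<^bsub>?G\<^esub> y \<in> carrier ?G" using P by (simp add: split_metacyclic_def ji ji')
  fix z assume z: "z \<in> carrier ?G"
  obtain j'' i'' where ji'': "z = (j'', i'')" by fastforce
  have "[(i * ?q ^ j' + i') mod ?P * ?q ^ j'' + i'' = (i * ?q ^ j' + i') * ?q ^ j'' + i''] (mod ?P)"
    by (intro cong_add cong_mult cong_refl) (simp add: cong_def)
  also have "(i * ?q ^ j' + i') * ?q ^ j'' + i'' = i * ?q ^ (j' + j'') + (i' * ?q ^ j'' + i'')"
    by (simp add: algebra_simps power_add)
  also have "[\<dots> = i * ?q ^ ((j' + j'') mod ?P) + (i' * ?q ^ j'' + i'') mod ?P] (mod ?P)"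
    by (intro cong_add cong_mult cong_refl cong_sym[OF split_power_mod]) (simp add: cong_def)
  finally show "x \<otimes>\<^bsub>?G\<^esub> y \<otimes>\<^bsub>?G\<^esub> z = x \<otimes>\<^bsub>?G\<^esub> (y \<otimes>\<^bsub>?G\<^esub> z)"
    by (simp add: split_metacyclic_def ji ji' ji'' cong_def mod_add_left_eq mod_add_right_eq add.assoc)
qed

lemma card_split_metacyclic: "card (carrier (split_metacyclic p n r)) = p ^ n * p ^ n"
  by (simp add: split_metacyclic_def card_cartesian_product)

lemma split_pow_a: "(0, 1) [^]\<^bsub>split_metacyclic p n r\<^esub> (k::nat) = (0, k mod p ^ n)"
  by (induction k) (simp_all add: split_metacyclic_def mod_Suc_eq)

lemma split_pow_b: "(1, 0) [^]\<^bsub>split_metacyclic p n r\<^esub> (k::nat) = (k mod p ^ n, 0)"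
  by (induction k) (simp_all add: split_metacyclic_def mod_Suc_eq)

lemma split_normal_form:
  "(1, 0) [^]\<^bsub>split_metacyclic p n r\<^esub> (j::nat) \<otimes>\<^bsub>split_metacyclic p n r\<^esub> (0, 1) [^]\<^bsub>split_metacyclic p n r\<^esub> (i::nat)
    = (j mod p ^ n, i mod p ^ n)"
  unfolding split_pow_a split_pow_b by (simp add: split_metacyclic_def)

lemma metacyclic_split_metacyclic: "metacyclic (split_metacyclic p n r) (0, 1) (1, 0) p r"
proof -
  let ?G = "split_metacyclic p n r"
  interpret group ?G by (rule group_split_metacyclic)
  have ab: "(0, 1) \<in> carrier ?G" "(1, 0) \<in> carrier ?G"
    using split_modulus_gt_1 by (simp_all add: split_metacyclic_def)
  show ?thesis
  proof
    show "finite_p_group p ?G"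
      unfolding finite_p_group_def order_def card_split_metacyclic power_add[symmetric]
      using is_group by (auto simp: split_metacyclic_def)
    show "generate ?G {(0, 1), (1, 0)} = carrier ?G"
    proof
      show "generate ?G {(0, 1), (1, 0)} \<subseteq> carrier ?G"
        using ab by (intro generate_incl) simp
      have sub: "subgroup (generate ?G {(0, 1), (1, 0)}) ?G"
        using ab by (intro generate_is_subgroup) simp
      have pow: "x [^]\<^bsub>?G\<^esub> (k::nat) \<in> generate ?G {(0, 1), (1, 0)}" if "x \<in> {(0, 1), (1, 0)}" for x k
        by (induction k) (use that in \<open>auto intro: generate.intros\<close>)
      show "carrier ?G \<subseteq> generate ?G {(0, 1), (1, 0)}"
      proof
        fix x assume x: "x \<in> carrier ?G"
        obtain j i where ji: "x = (j, i)" by fastforce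
        then have "x = (1, 0) [^]\<^bsub>?G\<^esub> j \<otimes>\<^bsub>?G\<^esub> (0, 1) [^]\<^bsub>?G\<^esub> i"
          using x unfolding split_normal_form by (simp add: split_metacyclic_def)
        then show "x \<in> generate ?G {(0, 1), (1, 0)}"
          using generate.eng[OF pow[of "(1, 0)" j] pow[of "(0, 1)" i]] by simp
      qed
    qed
    have "(1, 0) \<otimes>\<^bsub>?G\<^esub> (0, 1) [^]\<^bsub>?G\<^esub> (1 + p ^ r) = (1, (1 + p ^ r) mod p ^ n)"
      unfolding split_pow_a using split_modulus_gt_1 mod_less[OF split_modulus_gt_1]
      by (simp add: split_metacyclic_def)
    then show "(0, 1) \<otimes>\<^bsub>?G\<^esub> (1, 0) = (1, 0) \<otimes>\<^bsub>?G\<^esub> (0, 1) [^]\<^bsub>?G\<^esub> (1 + p ^ r)"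
      using mod_less[OF split_modulus_gt_1] by (simp add: split_metacyclic_def)
  qed (use prime r ab in auto)
qed

lemma split_pow_a_eq_one_iff:
  "(0, 1) [^]\<^bsub>split_metacyclic p n r\<^esub> (k::nat) = \<one>\<^bsub>split_metacyclic p n r\<^esub> \<longleftrightarrow> p ^ n dvd k"
  unfolding split_pow_a by (simp add: split_metacyclic_def dvd_eq_mod_eq_0)

lemma comm_group_split_metacyclic_iff: "comm_group (split_metacyclic p n r) \<longleftrightarrow> n \<le> r"
  unfolding metacyclic.comm_group_iff[OF metacyclic_split_metacyclic] split_pow_a_eq_one_iff
  using prime prime_gt_1_nat[of p] by (metis le_imp_power_dvd power_dvd_imp_le)

lemma G_group_iso_split_metacyclic: "G_group p n n r \<cong> split_metacyclic p n r"
proof -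
  interpret metacyclic "split_metacyclic p n r" "(0, 1)" "(1, 0)" p r
    by (rule metacyclic_split_metacyclic)
  show ?thesis
  proof (rule G_group_isoI[OF a b _ _ rel gen _ card_split_metacyclic])
    show "(0, 1) [^]\<^bsub>split_metacyclic p n r\<^esub> (p ^ n) = \<one>\<^bsub>split_metacyclic p n r\<^esub>"
      unfolding split_pow_a by (simp add: split_metacyclic_def)
    show "(1, 0) [^]\<^bsub>split_metacyclic p n r\<^esub> (p ^ n) = \<one>\<^bsub>split_metacyclic p n r\<^esub>"
      unfolding split_pow_b by (simp add: split_metacyclic_def)
  qed (use p_gt_1 in simp)
qed

text \<open>A cyclic group is abelian, and in the abelian case both generators having exponent
  \<open>p^n\<close> forces this exponent on every element. A single generator then yields at most
  \<open>p^n\<close> elements, fewer than \<open>p^(2n)\<close>.\<close>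

lemma split_metacyclic_not_cyclic:
  assumes x: "x \<in> carrier (split_metacyclic p n r)"
  shows "generate (split_metacyclic p n r) {x} \<noteq> carrier (split_metacyclic p n r)"
proof
  let ?G = "split_metacyclic p n r"
  assume gen_x: "generate ?G {x} = carrier ?G"
  interpret metacyclic ?G "(0, 1)" "(1, 0)" p r
    by (rule metacyclic_split_metacyclic)
  obtain N where N: "x [^]\<^bsub>?G\<^esub> (p ^ N) = \<one>\<^bsub>?G\<^esub>" using ex_exponent x by blast
  \<comment> \<open>The two-generator normal form with both generators equal to \<open>x\<close> and
    trivial twist \<open>q = 1\<close> lists the cyclic subgroup by natural powers.\<close>
  have "generate ?G {x, x} = {x [^]\<^bsub>?G\<^esub> j \<otimes>\<^bsub>?G\<^esub> x [^]\<^bsub>?G\<^esub> i | (i::nat) (j::nat). True}"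
    by (rule generate_normal_form[OF x x _ N _ N, of 1]) (use x p_gt_1 in simp_all)
  then have pow: "\<exists>k::nat. g = x [^]\<^bsub>?G\<^esub> k" if "g \<in> carrier ?G" for g
    using gen_x that x by (auto simp: nat_pow_mult)
  have "comm_group ?G"
  proof (rule group_comm_groupI)
    fix g h assume "g \<in> carrier ?G" "h \<in> carrier ?G"
    then obtain k l :: nat where "g = x [^]\<^bsub>?G\<^esub> k" "h = x [^]\<^bsub>?G\<^esub> l" using pow by metis
    then show "g \<otimes>\<^bsub>?G\<^esub> h = h \<otimes>\<^bsub>?G\<^esub> g" using x by (simp add: nat_pow_mult add.commute)
  qed
  then interpret comm_group ?G .
  obtain i j :: nat where ij: "x = (1, 0) [^]\<^bsub>?G\<^esub> j \<otimes>\<^bsub>?G\<^esub> (0, 1) [^]\<^bsub>?G\<^esub> i"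
    using normal_formE[OF x] by blast
  have "x [^]\<^bsub>?G\<^esub> (p ^ n) = (1, 0) [^]\<^bsub>?G\<^esub> (j * p ^ n) \<otimes>\<^bsub>?G\<^esub> (0, 1) [^]\<^bsub>?G\<^esub> (i * p ^ n)"
    unfolding ij using a b by (simp only: nat_pow_distrib nat_pow_pow nat_pow_closed)
  then have xP: "x [^]\<^bsub>?G\<^esub> (p ^ n) = \<one>\<^bsub>?G\<^esub>"
    unfolding split_normal_form by (simp add: split_metacyclic_def)
  have "carrier ?G \<subseteq> (\<lambda>k. x [^]\<^bsub>?G\<^esub> k) ` {..<p ^ n}"
  proof
    fix g assume "g \<in> carrier ?G"
    then obtain k :: nat where "g = x [^]\<^bsub>?G\<^esub> k" using pow by blast
    then have "g = x [^]\<^bsub>?G\<^esub> (k mod p ^ n)" using pow_mod_eq[OF x xP] by simp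
    then show "g \<in> (\<lambda>k. x [^]\<^bsub>?G\<^esub> k) ` {..<p ^ n}"
      by (rule image_eqI) (use p_gt_1 in simp)
  qed
  then have "card (carrier ?G) \<le> card ((\<lambda>k. x [^]\<^bsub>?G\<^esub> k) ` {..<p ^ n})"
    by (rule card_mono[rotated]) simp
  also have "\<dots> \<le> p ^ n"
    using card_image_le[of "{..<p ^ n}" "\<lambda>k. x [^]\<^bsub>?G\<^esub> k"] by simp
  finally show False
    unfolding card_split_metacyclic using split_modulus_gt_1 by simp
qed

lemma group_rank_split_metacyclic: "group_rank (split_metacyclic p n r) = 2"
  using group_rank_eq_twoI[OF group_split_metacyclic] split_metacyclic_not_cyclic
    metacyclic.two_generated[OF metacyclic_split_metacyclic] by blast

lemma powerfully_nilpotent_split_metacyclic: "powerfully_nilpotent p (split_metacyclic p n r)"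
  by (rule metacyclic.powerfully_nilpotent[OF metacyclic_split_metacyclic])

lemma group_A_group: "group (A_group p n)"
  unfolding A_group_def by (intro DirProd_group group_integer_mod_group)

text \<open>For \<open>n <= r\<close> the modulus \<open>p^n\<close> divides \<open>p^r\<close>, so
  every twist factor is 1 modulo \<open>p^n\<close> and the product is componentwise
  addition.\<close>

lemma A_group_iso_split_metacyclic:
  assumes "n \<le> r"
  shows "split_metacyclic p n r \<cong> A_group p n"
proof -
  let ?G = "split_metacyclic p n r"
  define f where "f = (\<lambda>(j::nat, i::nat). (int j, int i))"
  have P: "p ^ n \<noteq> 0" using split_modulus_gt_1 by simp
  have carA: "carrier (A_group p n) = {0..<int (p ^ n)} \<times> {0..<int (p ^ n)}"
    using P by (simp add: A_group_def carrier_integer_mod_group)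
  have img: "f ` carrier ?G = carrier (A_group p n)"
  proof (intro equalityI subsetI)
    fix z assume "z \<in> carrier (A_group p n)"
    then have "z = f (nat (fst z), nat (snd z))" "(nat (fst z), nat (snd z)) \<in> carrier ?G"
      unfolding carA by (auto simp: f_def split_metacyclic_def nat_less_iff)
    then show "z \<in> f ` carrier ?G" by (rule image_eqI)
  qed (auto simp: carA f_def split_metacyclic_def simp flip: of_nat_power)
  have "f \<in> hom ?G (A_group p n)"
  proof (rule homI)
    fix x assume x: "x \<in> carrier ?G"
    then show "f x \<in> carrier (A_group p n)" using img by blast
    fix y assume "y \<in> carrier ?G"
    obtain j i where ji: "x = (j, i)" by fastforce
    obtain j' i' where ji': "y = (j', i')" by fastforce
    obtain s where s: "(1 + p ^ r) ^ j' = 1 + j' * p ^ r + (p ^ r)\<^sup>2 * s"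
      using one_plus_power_expand by blast
    obtain d where d: "p ^ r = p ^ n * d" using assms by (metis le_imp_power_dvd dvdE)
    have "i * (1 + p ^ r) ^ j' + i' = (i + i') + p ^ n * (d * (i * (j' + p ^ r * s)))"
      unfolding s power2_eq_square by (simp add: d algebra_simps)
    then have "(i * (1 + p ^ r) ^ j' + i') mod p ^ n = (i + i') mod p ^ n"
      by (metis mod_mult_self2)
    then show "f (x \<otimes>\<^bsub>?G\<^esub> y) = f x \<otimes>\<^bsub>A_group p n\<^esub> f y"
      by (simp add: ji ji' f_def split_metacyclic_def A_group_def zmod_int)
  qed
  moreover have "inj_on f (carrier ?G)" by (auto simp: inj_on_def f_def)
  ultimately show ?thesis
    using img unfolding is_iso_def iso_def bij_betw_def by blast
qed

lemma iso_class_G_group: "iso_class (G_group p n n r) = iso_class (split_metacyclic p n r)"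
  by (rule iso_class_eqI[OF group_G_group group_split_metacyclic G_group_iso_split_metacyclic])

lemma iso_class_A_group:
  assumes "n \<le> r"
  shows "iso_class (A_group p n) = iso_class (split_metacyclic p n r)"
  using iso_class_eqI[OF group_split_metacyclic group_A_group A_group_iso_split_metacyclic[OF assms]] by simp

lemma finite_split_metacyclic: "finite (carrier (split_metacyclic p n r))"
  by (simp add: split_metacyclic_def)

end

section \<open>Edges between the groups \<open>G(n, n, r)\<close>\<close>

text \<open>In the model the two cyclic subgroups meet trivially and relations are controlled modulo
  \<open>p^N\<close>. This is more than the modulus \<open>p^(e+1)\<close> required, so a single
  quotient already has the full order.\<close>

lemma direct_ancestor_split_metacyclic:
  assumes prime: "Factorial_Ring.prime p" and n: "2 \<le> n" and r: "2 \<le> r"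
  shows "direct_ancestor p (split_metacyclic p n r) (split_metacyclic p (n + (r - 1)) r)"
proof -
  define N where "N = n + (r - 1)"
  \<comment> \<open>Chosen so that \<open>a\<close>, of order \<open>p^N\<close>, has order
    \<open>p^(r+e)\<close>, while the quotient has parameter \<open>e + 1 = n\<close>.\<close>
  define e where "e = n - 1"
  have N: "1 \<le> N" "N = r + e" "e + 1 = n" "r < N" "n \<le> N" using n r by (auto simp: N_def e_def)
  have n1: "1 \<le> n" using n by simp
  let ?G = "split_metacyclic p N r"
  note mc = metacyclic_split_metacyclic[OF prime N(1) r]
  interpret M: metacyclic ?G "(0, 1)" "(1, 0)" p r by (rule mc)
  have "group.ord ?G (0, 1) = p ^ (r + e)"
    using M.ord_unique[OF M.a] split_pow_a_eq_one_iff[OF prime N(1) r] N(2) by simp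
  then interpret M: metacyclic_ord ?G "(0, 1)" "(1, 0)" p r e
    by (intro metacyclic_ord.intro mc metacyclic_ord_axioms.intro)
  obtain H :: "nat monoid" and f where H: "group H" and f: "f \<in> hom ?G H" "f ` carrier ?G
      = carrier H"
      "kernel ?G H f = power_subgroup ?G (centre ?G) p"
    using M.ex_nat_quotient[OF M.normal_power_subgroup_centre M.fin] by blast
  interpret Q: metacyclic_quotient ?G "(0, 1)" "(1, 0)" p r e H f
    by (intro metacyclic_quotient.intro metacyclic_quotient_axioms.intro M.metacyclic_ord_axioms H f)
  interpret H: metacyclic H "f (0, 1)" "f (1, 0)" p r by (rule Q.metacyclic_img)
  have "card (carrier H) = p ^ (e + 1) * p ^ (e + 1)"
  proof (rule Q.card_img)
    fix i j :: nat assume "(0, 1) [^]\<^bsub>?G\<^esub> i = (1, 0) [^]\<^bsub>?G\<^esub> j"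
    then have "p ^ N dvd i" "p ^ N dvd j"
      unfolding split_pow_a[OF prime N(1) r] split_pow_b[OF prime N(1) r] by (auto simp: dvd_eq_mod_eq_0)
    moreover have "p ^ (e + 1) dvd p ^ N" using N(3,5) by (intro le_imp_power_dvd) simp
    ultimately show "p ^ (e + 1) dvd i \<and> p ^ (e + 1) dvd j" using dvd_trans by blast
  qed
  then have GH: "G_group p n n r \<cong> H"
    using Q.f.H.G_group_isoI[OF H.a H.b Q.img_pow_eq_one H.rel H.gen] H.p_gt_1 N(3) by simp
  have "H \<cong> G_group p n n r" using group.iso_sym[OF group_G_group GH] .
  then have HM: "H \<cong> split_metacyclic p n r"
    using G_group_iso_split_metacyclic[OF prime n1 r] by (rule iso_trans)
  have "\<not> comm_group ?G"
    using comm_group_split_metacyclic_iff[OF prime N(1) r] N(4) by simp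
  then have "direct_ancestor p H ?G"
    unfolding direct_ancestor_def using H.powerfully_nilpotent M.powerfully_nilpotent f by blast
  then show ?thesis
    using direct_ancestor_iso[OF prime _ HM iso_refl group_split_metacyclic[OF prime n1 r] M.is_group]
    unfolding N_def by blast
qed

lemma generating_set_iso:
  assumes gr: "group G" "group H" and iso: "G \<cong> H"
    and S: "\<exists>S\<subseteq>carrier G. finite S \<and> card S = d \<and> generate G S = carrier G"
  shows "\<exists>S\<subseteq>carrier H. finite S \<and> card S = d \<and> generate H S = carrier H"
proof -
  obtain S where S: "S \<subseteq> carrier G" "finite S" "card S = d" "generate G S = carrier G"
    using S by blast
  obtain h where h: "h \<in> hom G H" "bij_betw h (carrier G) (carrier H)"
    using iso by (rule is_isoE)
  interpret h: group_hom G H h using group_homI[OF gr h(1)] .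
  have "inj_on h S" using h(2) S(1) unfolding bij_betw_def by (metis inj_on_subset)
  then have "card (h ` S) = d" using S(3) card_image by blast
  moreover have "generate H (h ` S) = carrier H"
    using h.generate_img[OF S(1)] S(4) h(2) unfolding bij_betw_def by simp
  moreover have "h ` S \<subseteq> carrier H" using S(1) h.hom_closed by blast
  ultimately show ?thesis using S(2) by (intro exI[of _ "h ` S"]) simp
qed

lemma group_rank_iso:
  assumes "group G" "group H" "G \<cong> H"
  shows "group_rank G = group_rank H"
proof -
  have "(\<exists>S\<subseteq>carrier G. finite S \<and> card S = d \<and> generate G S = carrier G)
      \<longleftrightarrow> (\<exists>S\<subseteq>carrier H. finite S \<and> card S = d \<and> generate H S = carrier H)" for d
    by (rule iffI)
      (erule generating_set_iso[OF assms], erule generating_set_iso[OF assms(2,1) group.iso_sym[OF assms(1,3)]])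
  then show ?thesis unfolding group_rank_def by simp
qed

section \<open>Vertices with grandparents and infinite branches\<close>

context
  fixes p :: nat
  assumes prime: "Factorial_Ring.prime p"
begin

abbreviation (input) M where "M n r \<equiv> split_metacyclic p n r"

lemma split_edge:
  assumes "2 \<le> n" "2 \<le> r"
  shows "ancestry_edge p (iso_class (M n r)) (iso_class (M (n + (r - 1)) r))"
  using ancestry_edgeI[OF prime direct_ancestor_split_metacyclic[OF prime assms]] .

lemma split_iso_classD:
  assumes "iso_class (M n r) = iso_class (M n' r')" "1 \<le> n" "1 \<le> n'" "2 \<le> r" "2 \<le> r'"
  shows "M n r \<cong> M n' r'" "n = n'" "n \<le> r \<longleftrightarrow> n' \<le> r'"
proof -
  note gr = group_split_metacyclic[OF prime assms(2,4)] group_split_metacyclic[OF prime assms(3,5)]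
  show iso: "M n r \<cong> M n' r'"
    using iso_class_eqD[OF gr(1) finite_split_metacyclic[OF prime assms(2,4)] gr(2) assms(1)] .
  have "p ^ n * p ^ n = p ^ n' * p ^ n'"
    using iso_carrier(1)[OF iso] card_split_metacyclic[OF prime assms(2,4)]
      card_split_metacyclic[OF prime assms(3,5)] by simp
  then have "p ^ (n + n) = p ^ (n' + n')" by (simp add: power_add)
  then show "n = n'" using prime_gt_1_nat[OF prime] by simp
  have "comm_group (M n r) \<longleftrightarrow> comm_group (M n' r')"
    using comm_group_iso[OF _ iso gr(2)] comm_group_iso[OF _ group.iso_sym[OF gr(1) iso] gr(1)] by blast
  then show "n \<le> r \<longleftrightarrow> n' \<le> r'"
    using comm_group_split_metacyclic_iff[OF prime assms(2,4)]
      comm_group_split_metacyclic_iff[OF prime assms(3,5)] by simp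
qed

text \<open>The upper group determines its quotient, which is known explicitly from
  \<open>r'\<close>. Comparing it with the lower group fixes \<open>n\<close> by the order. Only the
  classes for \<open>r\<close> and \<open>r'\<close> are identified, since for abelian groups the
  parameters themselves may differ.\<close>

lemma split_edgeD:
  assumes edge: "ancestry_edge p (iso_class (M n r)) (iso_class (M n' r'))"
    and "1 \<le> n" "1 \<le> n'" "2 \<le> r" "2 \<le> r'"
  shows "r' < n'" "n' = n + (r' - 1)" "iso_class (M n r) = iso_class (M n r')"
proof -
  note gr = group_split_metacyclic[OF prime assms(2,4)] group_split_metacyclic[OF prime assms(3,5)]
  note fin = finite_split_metacyclic[OF prime assms(2,4)] finite_split_metacyclic[OF prime assms(3,5)]
  have D: "direct_ancestor p (M n r) (M n' r')"
    using direct_ancestor_of_edge[OF prime edge gr(1) fin(1) gr(2) fin(2)] .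
  then have "\<not> comm_group (M n' r')" unfolding direct_ancestor_def by blast
  then show lt: "r' < n'"
    using comm_group_split_metacyclic_iff[OF prime assms(3,5)] by simp
  \<comment> \<open>The parameter of the quotient of the upper group; it is at least 2 because
    noncommutativity gives \<open>r' < n'\<close>.\<close>
  define k where "k = n' - (r' - 1)"
  have k: "2 \<le> k" "n' = k + (r' - 1)" using lt assms(5) by (auto simp: k_def)
  have k1: "1 \<le> k" using k(1) by simp
  have "direct_ancestor p (M k r') (M n' r')"
    using direct_ancestor_split_metacyclic[OF prime k(1) assms(5)] unfolding k(2)[symmetric] .
  then have "M n r \<cong> M k r'" using direct_ancestor_unique[OF D] by blast
  then have eq: "iso_class (M n r) = iso_class (M k r')"
    by (rule iso_class_eqI[OF gr(1) group_split_metacyclic[OF prime k1 assms(5)]])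
  then have nk: "n = k" using split_iso_classD(2) assms k1 by blast
  show "n' = n + (r' - 1)" "iso_class (M n r) = iso_class (M n r')"
    using k(2) eq unfolding nk by blast+
qed

text \<open>In a nonabelian group, \<open>r - 1\<close> is the amount by which \<open>n\<close>
  drops on passing to the unique quotient, so it is an invariant of the class.\<close>

lemma split_nonabelian_unique:
  assumes eq: "iso_class (M n r) = iso_class (M n r')" and "2 \<le> r" "2 \<le> r'" "r < n"
  shows "r = r'"
proof -
  have n1: "1 \<le> n" using assms by simp
  have r'n: "r' < n" using split_iso_classD(3)[OF eq n1 n1 assms(2,3)] assms(4) by simp
  define k where "k = n - (r - 1)"
  define k' where "k' = n - (r' - 1)"
  have k: "2 \<le> k" "n = k + (r - 1)" and k': "2 \<le> k'" "n = k' + (r' - 1)"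
    using assms r'n by (auto simp: k_def k'_def)
  have k1: "1 \<le> k" "1 \<le> k'" using k(1) k'(1) by simp_all
  have "ancestry_edge p (iso_class (M k r)) (iso_class (M n r'))"
    using split_edge[OF k(1) assms(2)] unfolding k(2)[symmetric] eq .
  then have "n = k + (r' - 1)" using split_edgeD(2) k1 n1 assms(2,3) by blast
  then show ?thesis using k(2) assms(2,3) by simp
qed

text \<open>Replaces the upper end of an edge by a group still known to be generated by two
  elements, so that the argument can climb a branch step by step.\<close>

lemma ancestry_edge_two_generated:
  assumes "ancestry_edge p (iso_class K) W" "group K" "finite (carrier K)" "two_generated K"
  obtains L :: "nat monoid" where "W = iso_class L" "group L" "finite (carrier L)" "two_generated L"
    "direct_ancestor p K L"
proof -
  obtain H L :: "nat monoid" where HL: "iso_class K = iso_class H" "W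
      = iso_class L" "direct_ancestor p H L"
    using assms(1) by (rule ancestry_edgeE)
  then have pn: "powerfully_nilpotent p H" "powerfully_nilpotent p L"
    unfolding direct_ancestor_def by blast+
  note D = powerfully_nilpotentD[OF pn(1)] powerfully_nilpotentD[OF pn(2)]
  have "H \<cong> K" using iso_class_eqD[OF D(1,2) assms(2)] HL(1) by simp
  then have KL: "direct_ancestor p K L"
    using direct_ancestor_iso[OF prime HL(3) _ iso_refl assms(2) D(4)] by blast
  then have "two_generated L" using direct_ancestor_two_generated assms(4) by blast
  then show ?thesis using that HL(2) D KL by blast
qed

lemma grandparent_split:
  fixes K :: "nat monoid"
  assumes "ancestry_edge p (iso_class K) W" "ancestry_edge p W U"
    "group K" "finite (carrier K)" "two_generated K"
  shows "\<exists>k r. 2 \<le> k \<and> 2 \<le> r \<and> iso_class K = iso_class (M k r)"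
proof -
  obtain L :: "nat monoid" where L: "W
      = iso_class L" "group L" "finite (carrier L)" "two_generated L"
    "direct_ancestor p K L"
    using ancestry_edge_two_generated[OF assms(1,3-5)] by blast
  obtain T :: "nat monoid" where T: "direct_ancestor p L T"
    using ancestry_edge_two_generated[OF assms(2)[unfolded L(1)] L(2-4)] by blast
  obtain k r where kr: "2 \<le> k" "2 \<le> r" "G_group p k k r \<cong> K"
    using two_fold_quotient[OF prime L(5) T assms(5)] by blast
  have "iso_class K = iso_class (G_group p k k r)"
    using iso_class_eqI[OF group_G_group assms(3) kr(3)] by simp
  also have "\<dots> = iso_class (M k r)" by (rule iso_class_G_group) (use prime kr in auto)
  finally show ?thesis using kr by blast
qed

lemma split_in_vertices:
  assumes "1 \<le> n" "2 \<le> r"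
  shows "iso_class (M n r) \<in> vertices_of_rank p 2"
proof -
  note gr = group_split_metacyclic[OF prime assms]
  obtain K :: "nat monoid" where K: "group K" "M n r \<cong> K"
    using ex_iso_nat_monoid[OF gr finite_split_metacyclic[OF prime assms]] by blast
  have "iso_class (M n r) = iso_class K" by (rule iso_class_eqI[OF gr K])
  moreover have "powerfully_nilpotent p K"
    by (rule powerfully_nilpotent_iso[OF prime powerfully_nilpotent_split_metacyclic[OF prime assms] K(2,1)])
  moreover have "group_rank K = 2"
    using group_rank_iso[OF gr K] group_rank_split_metacyclic[OF prime assms] by simp
  ultimately show ?thesis unfolding vertices_of_rank_def by blast
qed

text \<open>Positive indices fit the uniform formula for all parameters. At index 0 the chain has
  \<open>A(n)\<close>, which is the model group only when \<open>n <= r\<close> makes the latter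
  abelian.\<close>

lemma ancestor_chain_eq:
  assumes "2 \<le> n" "2 \<le> r"
  shows "1 \<le> i \<Longrightarrow> ancestor_chain p n r i = iso_class (M (n + i * (r - 1)) r)"
    and "n \<le> r \<Longrightarrow> ancestor_chain p n r i = iso_class (M (n + i * (r - 1)) r)"
proof -
  have n1: "1 \<le> n + i * (r - 1)" "1 \<le> n" using assms by simp_all
  note G = iso_class_G_group[OF prime n1(1) assms(2)] and A
      = iso_class_A_group[OF prime n1(2) assms(2)]
  show "1 \<le> i \<Longrightarrow> ancestor_chain p n r i = iso_class (M (n + i * (r - 1)) r)"
    using G by (simp add: ancestor_chain_def)
  show "n \<le> r \<Longrightarrow> ancestor_chain p n r i = iso_class (M (n + i * (r - 1)) r)"
    using G A by (cases "i = 0") (simp_all add: ancestor_chain_def)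
qed

lemma split_edge_step:
  assumes "2 \<le> n" "2 \<le> r"
  shows "ancestry_edge p (iso_class (M (n + i * (r - 1)) r)) (iso_class (M (n + Suc i * (r - 1)) r))"
  using split_edge[of "n + i * (r - 1)" r] assms by (simp add: add.commute add.left_commute)

lemma ancestor_chain_edge:
  assumes "2 \<le> n" "2 \<le> r" "1 \<le> i \<or> n \<le> r"
  shows "ancestry_edge p (ancestor_chain p n r i) (ancestor_chain p n r (Suc i))"
proof -
  have "ancestor_chain p n r i = iso_class (M (n + i * (r - 1)) r)"
    using ancestor_chain_eq[OF assms(1,2)] assms(3) by blast
  moreover have "ancestor_chain p n r (Suc i) = iso_class (M (n + Suc i * (r - 1)) r)"
    by (rule ancestor_chain_eq(1)[OF assms(1,2)]) simp
  ultimately show ?thesis using split_edge_step[OF assms(1,2)] by simp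
qed

lemma infinite_branch_ancestor_chain:
  assumes "2 \<le> n" "2 \<le> r" "n \<le> r"
  shows "infinite_branch p (ancestor_chain p n r)"
  unfolding infinite_branch_def
proof (intro conjI allI)
  show "ancestry_edge p (ancestor_chain p n r i) (ancestor_chain p n r (Suc i))" for i
    using ancestor_chain_edge assms by blast
  have n1: "1 \<le> n" using assms by simp
  note gr = group_split_metacyclic[OF prime n1 assms(2)]
  obtain K :: "nat monoid" where K: "group K" "M n r \<cong> K"
    using ex_iso_nat_monoid[OF gr finite_split_metacyclic[OF prime n1 assms(2)]] by blast
  have "comm_group K"
    using comm_group_iso[OF _ K(2,1)] comm_group_split_metacyclic_iff[OF prime n1 assms(2)] assms(3) by blast
  moreover have "powerfully_nilpotent p K"
    by (rule powerfully_nilpotent_iso[OF prime powerfully_nilpotent_split_metacyclic[OF prime n1 assms(2)] K(2,1)])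
  moreover have "group_rank K = 2"
    using group_rank_iso[OF gr K] group_rank_split_metacyclic[OF prime n1 assms(2)] by simp
  moreover have "ancestor_chain p n r 0 = iso_class K"
    using ancestor_chain_eq(2)[OF assms(1,2,3), of 0] iso_class_eqI[OF gr K] by simp
  ultimately show "\<exists>H :: nat monoid. powerfully_nilpotent p H \<and> comm_group H \<and> group_rank H = 2
      \<and> ancestor_chain p n r 0 = iso_class H"
    by blast
qed

text \<open>Every vertex of a branch has a grandparent, so it is a model group with its own
  parameters. The edges then tie these parameters together.\<close>

lemma infinite_branchE:
  assumes "infinite_branch p S"
  obtains n r where "2 \<le> n" "2 \<le> r" "n \<le> r" "S = ancestor_chain p n r"
proof -
  obtain H :: "nat monoid" where H: "powerfully_nilpotent p H" "comm_group H" "group_rank H = 2"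
    "S 0 = iso_class H" and edge: "\<And>i. ancestry_edge p (S i) (S (Suc i))"
    using assms unfolding infinite_branch_def by blast
  note Hg = powerfully_nilpotentD[OF H(1)]
  have reps: "\<exists>K :: nat monoid. S i = iso_class K \<and> group K \<and> finite (carrier K)
      \<and> two_generated K" for i
  proof (induction i)
    case 0
    then show ?case using H Hg group_rank_two_imp_two_generated by blast
  next
    case (Suc i)
    then obtain K :: "nat monoid" where K: "S i
        = iso_class K" "group K" "finite (carrier K)" "two_generated K"
      by blast
    show ?case
      using ancestry_edge_two_generated[OF edge[of i, unfolded K(1)] K(2-4)] by metis
  qed
  have "\<exists>k r. 2 \<le> k \<and> 2 \<le> r \<and> S i = iso_class (M k r)" for i
  proof -
    obtain K :: "nat monoid" where K: "S i
        = iso_class K" "group K" "finite (carrier K)" "two_generated K"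
      using reps by blast
    then show ?thesis
      using grandparent_split[OF edge[of i, unfolded K(1)] edge[of "Suc i"] K(2-4)] by simp
  qed
  then obtain k r where kr: "\<And>i. 2 \<le> k i" "\<And>i. 2 \<le> r i" "\<And>i. S i = iso_class (M (k i) (r i))"
    by metis
  have k1: "1 \<le> k i" for i using kr(1)[of i] by simp
  have step: "r (Suc i) < k (Suc i)" "k (Suc i) = k i + (r (Suc i) - 1)"
    "iso_class (M (k i) (r i)) = iso_class (M (k i) (r (Suc i)))" for i
    using split_edgeD[OF edge[of i, unfolded kr(3)] k1 k1 kr(2) kr(2)] by blast+
  \<comment> \<open>Constancy starts at index 1: from there on the vertices are nonabelian and
    determine \<open>r\<close>. The value \<open>r 0\<close> belongs to an abelian group and carries
    no information.\<close>
  have r_const: "r (Suc i) = r 1" for i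
  proof (induction i)
    case (Suc i)
    have "r (Suc i) = r (Suc (Suc i))"
      using split_nonabelian_unique[OF step(3)[of "Suc i"] kr(2) kr(2) step(1)[of i]] .
    then show ?case using Suc by simp
  qed simp
  have k_eq: "k i = k 0 + i * (r 1 - 1)" for i
  proof (induction i)
    case (Suc i)
    then show ?case using step(2)[of i] r_const[of i] by simp
  qed simp
  have "M (k 0) (r 0) \<cong> H"
    using iso_class_eqD[OF group_split_metacyclic[OF prime k1 kr(2)] finite_split_metacyclic[OF prime k1 kr(2)] Hg(1)]
      H(4) kr(3)[of 0] by simp
  then have "H \<cong> M (k 0) (r 0)" using group.iso_sym[OF group_split_metacyclic[OF prime k1 kr(2)]]
    by blast
  then have "comm_group (M (k 0) (r 0))"
    using comm_group_iso[OF H(2)] group_split_metacyclic[OF prime k1 kr(2)] by blast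
  then have "k 0 \<le> r 0" using comm_group_split_metacyclic_iff[OF prime k1 kr(2)] by blast
  \<comment> \<open>The starting group is abelian, and its class can equally be written with
    \<open>r 1\<close>; hence \<open>r 1\<close> may serve as the parameter of the whole
    chain.\<close>
  then have le: "k 0 \<le> r 1"
    using split_iso_classD(3)[OF step(3)[of 0] k1 k1 kr(2) kr(2)] by simp
  have "S i = iso_class (M (k 0 + i * (r 1 - 1)) (r 1))" for i
  proof (cases i)
    case 0
    then show ?thesis using kr(3)[of 0] step(3)[of 0] by simp
  next
    case (Suc j)
    then show ?thesis using kr(3)[of i] k_eq[of i] r_const[of j] by simp
  qed
  then have "S = ancestor_chain p (k 0) (r 1)"
    using ancestor_chain_eq(2)[OF kr(1) kr(2) le] by (intro ext) simp
  then show ?thesis using that kr(1,2) le by blast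
qed

lemma vertices_with_grandparent:
  "{V \<in> vertices_of_rank p 2. has_grandparent p V} =
     {iso_class (A_group p n) | n. 2 \<le> n} \<union>
     {iso_class (G_group p n n r) | n r. 3 \<le> n \<and> 2 \<le> r \<and> r \<le> n - 1}" (is "?L = ?R")
proof (intro equalityI subsetI)
  fix V assume "V \<in> ?L"
  then obtain W U and H :: "nat monoid" where H: "V
      = iso_class H" "powerfully_nilpotent p H" "group_rank H = 2"
    and e: "ancestry_edge p V W" "ancestry_edge p W U"
    unfolding vertices_of_rank_def has_grandparent_def by blast
  note Hg = powerfully_nilpotentD[OF H(2)]
  obtain k r where kr: "2 \<le> k" "2 \<le> r" "V = iso_class (M k r)"
    using grandparent_split[OF e(1)[unfolded H(1)] e(2) Hg(1,2)]
      group_rank_two_imp_two_generated[OF Hg(1,2) H(3)] H(1) by blast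
  have k1: "1 \<le> k" using kr(1) by simp
  show "V \<in> ?R"
  proof (cases "k \<le> r")
    case True
    then have "V = iso_class (A_group p k)"
      using iso_class_A_group[OF prime k1 kr(2)] kr(3) by simp
    then show ?thesis using kr(1) by blast
  next
    case False
    then have "3 \<le> k \<and> 2 \<le> r \<and> r \<le> k - 1" using kr(2) by simp
    moreover have "V = iso_class (G_group p k k r)"
      using iso_class_G_group[OF prime k1 kr(2)] kr(3) by simp
    ultimately show ?thesis by blast
  qed
next
  have split: "iso_class (M n r) \<in> ?L" if nr: "2 \<le> n" "2 \<le> r" for n r
  proof -
    have "2 \<le> n + (r - 1)" "1 \<le> n" using nr by simp_all
    then show ?thesis
      using split_in_vertices[of n r] split_edge[OF nr] split_edge[of "n + (r - 1)" r] nr(2)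
      unfolding has_grandparent_def by blast
  qed
  fix V assume "V \<in> ?R"
  then consider n where "2 \<le> n" "V = iso_class (A_group p n)"
    | n r where "3 \<le> n" "2 \<le> r" "V = iso_class (G_group p n n r)" by blast
  then show "V \<in> ?L"
  proof cases
    case 1
    \<comment> \<open>Any second parameter from \<open>n\<close> upwards represents
      \<open>A(n)\<close>; the choice \<open>n\<close> is also at least 2, as the edges above
      require.\<close>
    then have "V = iso_class (M n n)" using iso_class_A_group[OF prime, of n n] by simp
    then show ?thesis using split[OF 1(1) 1(1)] by simp
  next
    case 2
    then have "2 \<le> n" "V = iso_class (M n r)" using iso_class_G_group[OF prime, of n r] by simp_all
    then show ?thesis using split[OF _ 2(2)] by simp
  qed
qed

text \<open>Below the group at index 1 lies the model group with parameters \<open>n\<close> and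
  \<open>r\<close>. If \<open>A(n)\<close>, written as \<open>M n n\<close>, is that group up to
  isomorphism, the group is abelian, which means \<open>n <= r\<close>.\<close>

lemma ancestor_chain_first_edge_iff:
  assumes "2 \<le> n" "2 \<le> r"
  shows "ancestry_edge p (ancestor_chain p n r 0) (ancestor_chain p n r 1) \<longleftrightarrow> n \<le> r"
proof
  assume edge: "ancestry_edge p (ancestor_chain p n r 0) (ancestor_chain p n r 1)"
  have n1: "1 \<le> n" "1 \<le> n + 1 * (r - 1)" using assms by simp_all
  have "ancestor_chain p n r 0 = iso_class (M n n)"
    using iso_class_A_group[OF prime n1(1) assms(1)] by (simp add: ancestor_chain_def)
  then have "ancestry_edge p (iso_class (M n n)) (iso_class (M (n + 1 * (r - 1)) r))"
    using edge ancestor_chain_eq(1)[OF assms, of 1] by simp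
  from split_edgeD(3)[OF this n1 assms] show "n \<le> r"
    using split_iso_classD(3) n1(1) assms by blast
next
  assume "n \<le> r"
  then show "ancestry_edge p (ancestor_chain p n r 0) (ancestor_chain p n r 1)"
    using ancestor_chain_edge[OF assms, of 0] by simp
qed

lemma inj_on_ancestor_chain:
  "inj_on (\<lambda>(n, r). ancestor_chain p n r) {(n, r). 2 \<le> n \<and> 2 \<le> r \<and> n \<le> r}"
proof (rule inj_onI)
  fix x y
  assume x: "x \<in> {(n, r). 2 \<le> n \<and> 2 \<le> r \<and> n \<le> r}" and y: "y \<in> {(n, r). 2 \<le> n \<and> 2 \<le> r \<and> n \<le> r}"
    and eq: "(\<lambda>(n, r). ancestor_chain p n r) x = (\<lambda>(n, r). ancestor_chain p n r) y"
  obtain n r where nr: "x = (n, r)" by fastforce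
  obtain n' r' where nr': "y = (n', r')" by fastforce
  have n: "2 \<le> n" "2 \<le> r" "n \<le> r" and n': "2 \<le> n'" "2 \<le> r'" "n' \<le> r'"
    using x y by (auto simp: nr nr')
  have "iso_class (M (n + i * (r - 1)) r) = iso_class (M (n' + i * (r' - 1)) r')" for i
    using eq ancestor_chain_eq(2)[OF n, of i] ancestor_chain_eq(2)[OF n', of i] by (simp add: nr nr')
  moreover have "1 \<le> n + i * (r - 1)" "1 \<le> n' + i * (r' - 1)" for i using n n' by simp_all
  ultimately have *: "n + i * (r - 1) = n' + i * (r' - 1)" for i
    using split_iso_classD(2) n(2) n'(2) by blast
  \<comment> \<open>The group orders at index 0 give \<open>n\<close>, those at index 1 then give
    \<open>r\<close>.\<close>
  have "n = n'" "r = r'" using *[of 0] *[of 1] n(2) n'(2) by simp_all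
  then show "x = y" by (simp add: nr nr')
qed

end

text \<open>The branches are indexed by the pairs with \<open>n <= r\<close>. For
  \<open>r < n\<close> the group at index 1 lies above the nonabelian \<open>G(n,n,r)\<close>
  instead of \<open>A(n)\<close>, so the edges at positive indices remain but the start does not
  match.\<close>

theorem mainTheorem5:
  fixes p :: nat
  assumes "Factorial_Ring.prime p"
  shows "{V \<in> vertices_of_rank p 2. has_grandparent p V} =
           {iso_class (A_group p n) | n. 2 \<le> n} \<union>
           {iso_class (G_group p n n r) | n r. 3 \<le> n \<and> 2 \<le> r \<and> r \<le> n - 1} \<and>
         (\<forall>S. infinite_branch p S \<longrightarrow>
           (\<exists>n\<ge>2. S 0 = iso_class (A_group p n)) \<and>
           (\<forall>i\<ge>1. \<exists>k r. 3 \<le> k \<and> 2 \<le> r \<and> r \<le> k - 1 \<and> S i = iso_class (G_group p k k r))) \<and>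
         (\<forall>n\<ge>2. \<forall>r\<ge>2.
           (\<forall>i\<ge>1. ancestry_edge p (ancestor_chain p n r i) (ancestor_chain p n r (Suc i))) \<and>
           (ancestry_edge p (ancestor_chain p n r 0) (ancestor_chain p n r 1) \<longleftrightarrow> n \<le> r)) \<and>
         bij_betw (\<lambda>(n, r). ancestor_chain p n r)
           {(n, r). 2 \<le> n \<and> 2 \<le> r \<and> n \<le> r} {S. infinite_branch p S}"
proof (intro conjI allI impI)
  note prime = assms
  show "{V \<in> vertices_of_rank p 2. has_grandparent p V} =
      {iso_class (A_group p n) | n. 2 \<le> n} \<union>
      {iso_class (G_group p n n r) | n r. 3 \<le> n \<and> 2 \<le> r \<and> r \<le> n - 1}"
    by (rule vertices_with_grandparent[OF prime])
  show "\<exists>n\<ge>2. S 0 = iso_class (A_group p n)" if "infinite_branch p S" for S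
    using infinite_branchE[OF prime that] by (metis ancestor_chain_def)
  show "\<exists>k r. 3 \<le> k \<and> 2 \<le> r \<and> r \<le> k - 1 \<and> S i = iso_class (G_group p k k r)"
    if S: "infinite_branch p S" and i: "1 \<le> i" for S i
  proof -
    obtain n r where nr: "2 \<le> n" "2 \<le> r" "S = ancestor_chain p n r"
      using infinite_branchE[OF prime S] by metis
    define k where "k = n + i * (r - 1)"
    \<comment> \<open>Thus \<open>k >= n + (r - 1)\<close>, and \<open>n >= 2\<close> yields both
      \<open>k >= 3\<close> and \<open>r <= k - 1\<close>.\<close>
    have "1 * (r - 1) \<le> i * (r - 1)" using i by (rule mult_le_mono1)
    then have "3 \<le> k" "r \<le> k - 1" using nr(1,2) unfolding k_def by linarith+
    moreover have "S i = iso_class (G_group p k k r)"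
      using i unfolding nr(3) k_def by (simp add: ancestor_chain_def)
    ultimately show ?thesis using nr(2) by blast
  qed
  show "ancestry_edge p (ancestor_chain p n r i) (ancestor_chain p n r (Suc i))"
    if "2 \<le> n" "2 \<le> r" "1 \<le> i" for n r i
    using ancestor_chain_edge[OF prime that(1,2)] that(3) by blast
  show "ancestry_edge p (ancestor_chain p n r 0) (ancestor_chain p n r 1) \<longleftrightarrow> n \<le> r"
    if "2 \<le> n" "2 \<le> r" for n r
    by (rule ancestor_chain_first_edge_iff[OF prime that])
  show "bij_betw (\<lambda>(n, r). ancestor_chain p n r)
      {(n, r). 2 \<le> n \<and> 2 \<le> r \<and> n \<le> r} {S. infinite_branch p S}"
    unfolding bij_betw_def
  proof (intro conjI equalityI subsetI inj_on_ancestor_chain[OF prime])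
    fix S assume "S \<in> (\<lambda>(n, r). ancestor_chain p n r) ` {(n, r). 2 \<le> n \<and> 2 \<le> r \<and> n \<le> r}"
    then show "S \<in> {S. infinite_branch p S}"
      using infinite_branch_ancestor_chain[OF prime] by auto
  next
    fix S assume "S \<in> {S. infinite_branch p S}"
    then obtain n r where "2 \<le> n" "2 \<le> r" "n \<le> r" "S = ancestor_chain p n r"
      using infinite_branchE[OF prime] by blast
    then show "S \<in> (\<lambda>(n, r). ancestor_chain p n r) ` {(n, r). 2 \<le> n \<and> 2 \<le> r \<and> n \<le> r}"
      by (intro image_eqI[of _ _ "(n, r)"]) simp_all
  qed
qed

end
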